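(* Let $\beta'$ be an $n$-braid of length $c$ with $\ell$ negative crossings, where $0\le\ell\le n$, and let $\beta=\Delta_n^2\,\beta'$, where $\Delta_n^2$ is the positive full twist in the braid group $B_n$. Then $$2\min\deg\bigl(V_{\overline{\beta}}(t)\bigr)=w(\beta)-n+1 .$$ Thus, if $n$ is the minimal braid index of $\overline{\beta}$, then $w(\beta)$ is a topological invariant of $\overline{\beta}$.
   Context: $B_n$ is the braid group on $n$ strands with standard generators $\sigma_1,\dots,\sigma_{n-1}$, each $\sigma_i$ being a positive crossing and each $\sigma_i^{-1}$ a negative crossing. The $n$-braid $\beta'$ is given by a braid word; its length $c$ is the number of letters (crossings), of which $\ell$ are negative. $\Delta_n^2=(\sigma_1\cdots\sigma_{n-1})^n$ is the positive full twist on all $n$ strands, $\overline{\beta}$ is the closure of $\beta$ (all strands oriented in parallel), and $w(\beta)$ is the writhe, i.e. the algebraic crossing number, of $\beta$. The minimal braid index of a link is the least number of strands of a braid whose closure is that link. $V_L(t)$ is the Jones polynomial, with the convention $t^{-1}V_{L_+}-tV_{L_-}=(t^{1/2}-t^{-1/2})V_{L_0}$ and $V_{\bigcirc}(t)=1$; $\min\deg$ is the lowest exponent of $t$ (possibly a half-integer) occurring with nonzero coefficient. The last assertion is the conclusion, for these braids, of the conjecture of V. Jones that the writhe of an $n$-braid is a topological invariant of its closure whenever $n$ is the minimal braid index of the closure (i.e. that the writhe of a braid representative of minimal index is determined by the link). *)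

theory Defs
  imports "HOL-Analysis.Analysis" "HOL-Library.Poly_Mapping"
begin

text \<open>
  A braid word is a list of nonzero integers: for \<open>i \<ge> 1\<close> the letter \<open>i\<close> stands for the generator
  \<open>\<sigma>\<^sub>i\<close> and \<open>- i\<close> for its inverse. Braids are braid words modulo \<open>braid_equiv n\<close>, the congruence
  given by the Artin presentation of the braid group on \<open>n\<close> strands.
\<close>

definition braid_word :: "nat \<Rightarrow> int list \<Rightarrow> bool" where
  "braid_word n w \<longleftrightarrow> (\<forall>s\<in>set w. 1 \<le> \<bar>s\<bar> \<and> \<bar>s\<bar> < int n)"

inductive braid_step :: "nat \<Rightarrow> int list \<Rightarrow> int list \<Rightarrow> bool" for n where
  cancel: "braid_word n (u @ [s, - s] @ v) \<Longrightarrow> braid_step n (u @ [s, - s] @ v) (u @ v)"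
| far: "braid_word n (u @ [i, j] @ v) \<Longrightarrow> 1 \<le> i \<Longrightarrow> i + 2 \<le> j \<Longrightarrow>
    braid_step n (u @ [i, j] @ v) (u @ [j, i] @ v)"
| braid: "braid_word n (u @ [i, i + 1, i] @ v) \<Longrightarrow> 1 \<le> i \<Longrightarrow>
    braid_step n (u @ [i, i + 1, i] @ v) (u @ [i + 1, i, i + 1] @ v)"

definition braid_equiv :: "nat \<Rightarrow> int list \<Rightarrow> int list \<Rightarrow> bool" where
  "braid_equiv n = equivclp (braid_step n)"

definition num_neg :: "int list \<Rightarrow> nat" where
  "num_neg w = length (filter (\<lambda>s. s < 0) w)"

definition writhe :: "int list \<Rightarrow> int" where
  "writhe w = sum_list (map sgn w)"

definition full_twist :: "nat \<Rightarrow> int list" where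
  "full_twist n = concat (replicate n [1..int n - 1])"

text \<open>
  Tame oriented links are given as oriented polygonal links: finite sets of directed edges
  \<open>(a, b)\<close>. Every vertex has exactly one incoming and one outgoing edge, and distinct edges meet at
  most in common endpoints. Isotopy of polygonal links is the equivalence relation generated by
  triangle moves, which replace an edge \<open>ab\<close> by \<open>ac\<close>, \<open>cb\<close> whenever the triangle
  \<open>abc\<close> does not touch the rest of the link (\<open>c\<close> inside the edge \<open>ab\<close> is a subdivision).
\<close>

type_synonym edges = "((real^3) \<times> (real^3)) set"

definition points :: "edges \<Rightarrow> (real^3) set" where
  "points L = (\<Union>(a, b)\<in>L. closed_segment a b)"

definition is_link :: "edges \<Rightarrow> bool" where
  "is_link L \<longleftrightarrow> finite L \<and> L \<noteq> {} \<and>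
     (\<forall>(a, b)\<in>L. a \<noteq> b \<and> (\<exists>!c. (b, c) \<in> L) \<and> (\<exists>!c. (c, a) \<in> L)) \<and>
     (\<forall>(a, b)\<in>L. \<forall>(c, d)\<in>L. (a, b) \<noteq> (c, d) \<longrightarrow>
        closed_segment a b \<inter> closed_segment c d \<subseteq> {a, b} \<inter> {c, d})"

definition triangle_move :: "edges \<Rightarrow> edges \<Rightarrow> bool" where
  "triangle_move L L' \<longleftrightarrow> is_link L \<and> is_link L' \<and>
     (\<exists>a b c. (a, b) \<in> L \<and> L' = (L - {(a, b)}) \<union> {(a, c), (c, b)} \<and>
        convex hull {a, b, c} \<inter> points (L - {(a, b)}) \<subseteq> {a, b})"

definition isotopic :: "edges \<Rightarrow> edges \<Rightarrow> bool" where
  "isotopic = equivclp triangle_move"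

definition pt :: "real \<Rightarrow> real \<Rightarrow> real \<Rightarrow> real^3" where
  "pt x y z = vector [x, y, z]"

text \<open>
  Strands run in the direction of increasing \<open>y\<close>, strand \<open>j\<close> in the plane \<open>x = j\<close>, and letter number
  \<open>k\<close> occupies \<open>k \<le> y \<le> k + 1\<close>. Looking down the \<open>z\<close>-axis, at \<open>\<sigma>\<^sub>i\<close> the strand going from position
  \<open>i\<close> to position \<open>i + 1\<close> (left to right) passes over the other one, which makes the crossing
  positive; at the inverse generator it passes under.
\<close>

definition level_edges :: "nat \<Rightarrow> nat \<Rightarrow> int \<Rightarrow> edges" where
  "level_edges n k s =
     (let i = real_of_int \<bar>s\<bar>; y = real k; apex = pt (i + 1/2) (y + 1/2) (of_int (sgn s) / 2) in
      {(pt (real j) y 0, pt (real j) (y + 1) 0) |j.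
          j \<in> {1..n} \<and> int j \<noteq> \<bar>s\<bar> \<and> int j \<noteq> \<bar>s\<bar> + 1} \<union>
      {(pt i y 0, apex), (apex, pt (i + 1) (y + 1) 0), (pt (i + 1) y 0, pt i (y + 1) 0)})"

text \<open>Strand \<open>j\<close> is closed up inside the plane \<open>x = j\<close>, returning at height \<open>z = 1\<close>.\<close>

definition return_edges :: "nat \<Rightarrow> nat \<Rightarrow> edges" where
  "return_edges n m = (\<Union>j\<in>{1..n}.
     {(pt (real j) (real m) 0, pt (real j) (real m + 1) 1),
      (pt (real j) (real m + 1) 1, pt (real j) (- 1) 1),
      (pt (real j) (- 1) 1, pt (real j) 0 0)})"

definition braid_closure :: "nat \<Rightarrow> int list \<Rightarrow> edges" where
  "braid_closure n w =
     (\<Union>k<length w. level_edges n k (w ! k)) \<union> return_edges n (length w)"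

definition braid_index :: "edges \<Rightarrow> nat" where
  "braid_index L = (LEAST n. \<exists>w. braid_word n w \<and> isotopic (braid_closure n w) L)"

text \<open>
  Laurent polynomials in \<open>t\<^sup>1\<^sup>/\<^sup>2\<close> with integer coefficients: the coefficient at \<open>k :: int\<close> belongs
  to \<open>t\<^sup>k\<^sup>/\<^sup>2\<close>.
\<close>

type_synonym half_laurent = "int \<Rightarrow>\<^sub>0 int"

definition t_half :: "int \<Rightarrow> half_laurent" where
  "t_half k = Poly_Mapping.single k 1"

definition min_deg :: "half_laurent \<Rightarrow> real" where
  "min_deg p = real_of_int (Min (Poly_Mapping.keys p)) / 2"

text \<open>
  Three links \<open>L\<^sub>+\<close>, \<open>L\<^sub>-\<close>, \<open>L\<^sub>0\<close> that agree outside an octahedron with equatorial vertices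
  \<open>sw\<close>, \<open>se\<close>, \<open>ne\<close>, \<open>nw\<close> and poles \<open>c \<plusminus> e3\<close>. Since \<open>(e1, e2, e3)\<close> is positively oriented, the crossing
  is positive if the strand from \<open>sw\<close> to \<open>ne\<close> passes on the \<open>e3\<close>-side of the strand from
  \<open>se\<close> to \<open>nw\<close>.
\<close>

definition skein_triple :: "edges \<Rightarrow> edges \<Rightarrow> edges \<Rightarrow> bool" where
  "skein_triple Lp Lm L0 \<longleftrightarrow> is_link Lp \<and> is_link Lm \<and> is_link L0 \<and>
     (\<exists>c e1 e2 e3 sw se ne nw E.
        inner (cross3 e1 e2) e3 > 0 \<and>
        sw = c - e1 - e2 \<and> se = c + e1 - e2 \<and> ne = c + e1 + e2 \<and> nw = c - e1 + e2 \<and>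
        convex hull {sw, se, ne, nw, c + e3, c - e3} \<inter> points E \<subseteq> {sw, se, ne, nw} \<and>
        Lp = E \<union> {(sw, c + e3), (c + e3, ne), (se, nw)} \<and>
        Lm = E \<union> {(sw, c - e3), (c - e3, ne), (se, nw)} \<and>
        L0 = E \<union> {(sw, nw), (se, ne)})"

definition jones_polynomial :: "(edges \<Rightarrow> half_laurent) \<Rightarrow> bool" where
  "jones_polynomial V \<longleftrightarrow>
     (\<forall>L L'. is_link L \<and> is_link L' \<and> isotopic L L' \<longrightarrow> V L = V L') \<and>
     (\<forall>a b c. is_link {(a, b), (b, c), (c, a)} \<longrightarrow> V {(a, b), (b, c), (c, a)} = 1) \<and>
     (\<forall>Lp Lm L0. skein_triple Lp Lm L0 \<longrightarrow>
        t_half (- 2) * V Lp - t_half 2 * V Lm = (t_half 1 - t_half (- 1)) * V L0)"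

end

theory Submission
  imports Defs
begin

text \<open>
  Let \<open>V\<close> be a Jones polynomial. Multiplying \<open>V\<close> of the closure of an \<open>n\<close>-braid word of writhe \<open>w\<close> by a sign
  and by \<open>t\<close> to the power \<open>-(w - n + 1)/2\<close> gives an invariant \<open>F\<close> whose skein relation is
  \<open>F(\<sigma>) = t F(\<sigma>\<^sup>-\<^sup>1) + (1 - t) F(1)\<close> and which does not change under positive stabilisation. The degree
  formula says that for \<open>\<Delta>\<^sup>2 \<beta>'\<close> the invariant \<open>F\<close> has no negative exponents and constant term \<open>1\<close>.

  By the skein and braid relations, each word on \<open>n + 1\<close> strands can be reduced to words in which \<open>\<sigma>\<^sub>n\<close>
  occurs at most once (\<open>hecke_functional_vanish\<close>), and for those stabilisation removes the last strand.
  So the relations determine \<open>F\<close>, and \<open>(1 + t) F\<close> must be the Markov trace of any representation that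
  satisfies them too. The one used here acts on functions of \<open>0\<close>-\<open>1\<close> states of the strands, and the trace
  weights a state by \<open>t\<close> to its number of ones (\<open>F_weighted_trace\<close>).

  In this representation \<open>\<sigma>\<^sub>i\<close> involves no negative powers of \<open>t\<close>, and \<open>1 - \<sigma>\<^sub>i\<close> factors as a cap followed
  by a cup. A full twist on \<open>n\<close> strands slides through a cup at the price of the factor \<open>t\<^sup>n\<close> (\<open>twist_cup\<close>).
  Since \<open>\<sigma>\<^sub>i\<^sup>-\<^sup>1 = 1 - t\<^sup>-\<^sup>1 (1 - \<sigma>\<^sub>i)\<close>, a negative crossing introduces \<open>t\<^sup>-\<^sup>1\<close> only together with a cup,
  and the full twist, being central, can be moved next to one of the cups. Hence \<open>\<Delta>\<^sup>2 \<beta>'\<close> acts without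
  negative powers as long as \<open>\<beta>'\<close> has at most \<open>n\<close> negative crossings (\<open>regular_twisted\<close>). In the trace, the
  state without ones contributes exactly \<open>1\<close>, every other state a multiple of \<open>t\<close>, so the constant term is
  \<open>1\<close> (\<open>F_constant_term\<close>).

  It remains to see that \<open>V\<close> of polygonal closures respects the braid relations, stabilisation and the
  skein relation. All isotopies are composed of triangle moves inside small regions that the rest of
  the link meets in prescribed points only (\<open>tangle_eq_isotopic\<close>). Removing two cancelling crossings
  leaves levels without crossings; they are pushed upwards past the remaining crossings and removed at
  the top (\<open>drop_level\<close>), so that the diagram never has to be rescaled.

  The invariance of the writhe follows because isotopic links have the same braid index and the same
  Jones polynomial, and the degree formula can be solved for the writhe.
\<close>

section \<open>Triangle moves as local surgery\<close>

definition proper_crossings :: "edges \<Rightarrow> bool" where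
  "proper_crossings L \<longleftrightarrow> (\<forall>(a, b)\<in>L. \<forall>(c, d)\<in>L. (a, b) \<noteq> (c, d) \<longrightarrow>
        closed_segment a b \<inter> closed_segment c d \<subseteq> {a, b} \<inter> {c, d})"

text \<open>
  In this form the conditions on the vertices can be checked for unions of edge sets, and they survive
  the subdivision of an edge.
\<close>

lemma is_link_iff:
  "is_link L \<longleftrightarrow> finite L \<and> L \<noteq> {} \<and> (\<forall>(a, b)\<in>L. a \<noteq> b) \<and> Domain L = Range L \<and>
     single_valued L \<and> single_valued (L\<inverse>) \<and> proper_crossings L"
proof -
  have "(\<forall>(a, b)\<in>L. a \<noteq> b \<and> (\<exists>!c. (b, c) \<in> L) \<and> (\<exists>!c. (c, a) \<in> L)) \<longleftrightarrow>
     (\<forall>(a, b)\<in>L. a \<noteq> b) \<and> Domain L = Range L \<and> single_valued L \<and> single_valued (L\<inverse>)" (is "?A \<longleftrightarrow> ?B")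
  proof
    assume A: ?A
    have A': "a \<noteq> b" "\<exists>!c. (b, c) \<in> L" "\<exists>!c. (c, a) \<in> L" if "(a, b) \<in> L" for a b
      using A that by auto
    have "Domain L \<subseteq> Range L" "Range L \<subseteq> Domain L" using A'(2,3) by (fast elim!: DomainE RangeE)+
    moreover have "single_valued L" unfolding single_valued_def using A'(2,3) by metis
    moreover have "single_valued (L\<inverse>)" unfolding single_valued_def converse_iff using A'(2,3) by metis
    ultimately show ?B using A'(1) by blast
  next
    assume B: ?B
    have "a \<noteq> b \<and> (\<exists>!c. (b, c) \<in> L) \<and> (\<exists>!c. (c, a) \<in> L)" if "(a, b) \<in> L" for a b
    proof (intro conjI)
      show "a \<noteq> b" using B that by blast
      have "b \<in> Domain L" "a \<in> Range L" using B that by blast+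
      then show "\<exists>!c. (b, c) \<in> L" "\<exists>!c. (c, a) \<in> L"
        using B unfolding single_valued_def by blast+
    qed
    then show ?A unfolding Ball_def split_paired_All prod.case by simp
  qed
  then show ?thesis unfolding is_link_def proper_crossings_def by (simp only: conj_assoc)
qed

lemma points_insert [simp]: "points (insert (a, b) L) = closed_segment a b \<union> points L"
  by (auto simp: points_def)

lemma points_Un [simp]: "points (L \<union> M) = points L \<union> points M"
  by (auto simp: points_def)

lemma points_empty [simp]: "points {} = {}"
  by (auto simp: points_def)

lemma points_UN: "points (\<Union>i\<in>I. L i) = (\<Union>i\<in>I. points (L i))"
  by (auto simp: points_def)

lemma edge_in_points: "(a, b) \<in> L \<Longrightarrow> closed_segment a b \<subseteq> points L"
  by (auto simp: points_def)

lemma Domain_in_points: "a \<in> Domain L \<Longrightarrow> a \<in> points L"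
  and Range_in_points: "a \<in> Range L \<Longrightarrow> a \<in> points L"
  by (force simp: points_def)+

lemma converse_insert: "(insert (a, b) R)\<inverse> = insert (b, a) (R\<inverse>)"
  by auto

lemma proper_crossings_insert:
  "proper_crossings (insert (a, b) L) \<longleftrightarrow> proper_crossings L \<and>
     (\<forall>(c, d)\<in>L. (a, b) \<noteq> (c, d) \<longrightarrow>
        closed_segment a b \<inter> closed_segment c d \<subseteq> {a, b} \<inter> {c, d})"
proof -
  define X where "X = (\<lambda>e e'. e \<noteq> e' \<longrightarrow> closed_segment (fst e) (snd e) \<inter> closed_segment (fst e') (snd e')
    \<subseteq> {fst e, snd e :: real^3} \<inter> {fst e', snd e'})"
  have sym: "X e e' \<longleftrightarrow> X e' e" for e e' unfolding X_def by (simp add: Int_commute eq_commute)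
  have refl: "X e e" for e unfolding X_def by simp
  have pc: "proper_crossings M \<longleftrightarrow> (\<forall>e\<in>M. \<forall>e'\<in>M. X e e')" for M
    unfolding proper_crossings_def X_def case_prod_beta prod_eq_iff fst_conv snd_conv by simp
  have "(\<forall>(c, d)\<in>L. (a, b) \<noteq> (c, d) \<longrightarrow>
        closed_segment a b \<inter> closed_segment c d \<subseteq> {a, b} \<inter> {c, d}) \<longleftrightarrow> (\<forall>e\<in>L. X (a, b) e)"
    unfolding X_def case_prod_beta prod_eq_iff fst_conv snd_conv by simp
  moreover have "proper_crossings (insert (a, b) L) \<longleftrightarrow>
      (\<forall>e\<in>L. X (a, b) e) \<and> (\<forall>e\<in>L. X (a, b) e \<and> (\<forall>e'\<in>L. X e e'))"
  proof -
    have "(\<forall>e\<in>L. X e (a, b) \<and> (\<forall>e'\<in>L. X e e')) \<longleftrightarrow> (\<forall>e\<in>L. X (a, b) e \<and> (\<forall>e'\<in>L. X e e'))"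
      using sym by (intro ball_cong) auto
    then show ?thesis unfolding pc ball_simps(7) using refl by simp
  qed
  ultimately show ?thesis unfolding pc ball_conj_distrib by argo
qed

lemma single_valued_insert:
  "single_valued (insert (a, b) R) \<longleftrightarrow> single_valued R \<and> (\<forall>y. (a, y) \<in> R \<longrightarrow> y = b)"
proof
  assume "single_valued (insert (a, b) R)"
  then show "single_valued R \<and> (\<forall>y. (a, y) \<in> R \<longrightarrow> y = b)"
    by (auto intro: single_valued_subset dest: single_valuedD)
next
  assume "single_valued R \<and> (\<forall>y. (a, y) \<in> R \<longrightarrow> y = b)"
  then show "single_valued (insert (a, b) R)"
    by (intro single_valuedI) (auto dest: single_valuedD)
qed

text \<open>
  The side condition that allows replacing the edge \<open>ab\<close> by \<open>ac\<close>, \<open>cb\<close> and vice versa, where \<open>X\<close> is the rest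
  of the link. The triangle may be degenerate, but then \<open>c\<close> has to lie strictly between \<open>a\<close> and \<open>b\<close>.
\<close>

definition clean_triangle :: "real^3 \<Rightarrow> real^3 \<Rightarrow> real^3 \<Rightarrow> (real^3) set \<Rightarrow> bool" where
  "clean_triangle a b c X \<longleftrightarrow> a \<noteq> b \<and> c \<noteq> a \<and> c \<noteq> b \<and>
     closed_segment a c \<inter> closed_segment c b \<subseteq> {c} \<and> convex hull {a, b, c} \<inter> X \<subseteq> {a, b}"

lemma segments_in_triangle:
  "closed_segment a b \<subseteq> convex hull {a, b, c}" "closed_segment a c \<subseteq> convex hull {a, b, c}"
  "closed_segment c b \<subseteq> convex hull {a, b, c}"
  by (simp_all add: segment_convex_hull hull_mono)

text \<open>
  Across a clean triangle the property of being a link passes in both directions, so during a sequence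
  of moves it has to be checked only at the start. The other edges meet \<open>ab\<close>, \<open>ac\<close> and \<open>cb\<close> at most in \<open>a\<close> or
  \<open>b\<close>, and they meet \<open>ab\<close> there if and only if they meet \<open>ac\<close> or \<open>cb\<close> there.
\<close>

lemma is_link_triangle:
  assumes clean: "clean_triangle a b c (points R)"
  shows "is_link (insert (a, b) R) \<longleftrightarrow> is_link (insert (a, c) (insert (c, b) R))"
proof -
  have ne: "a \<noteq> b" "c \<noteq> a" "c \<noteq> b" and ac_cb: "closed_segment a c \<inter> closed_segment c b \<subseteq> {c}"
    and hull: "convex hull {a, b, c} \<inter> points R \<subseteq> {a, b}"
    using clean by (auto simp: clean_triangle_def)
  have "c \<in> convex hull {a, b, c}" by (simp add: hull_inc)
  then have cR: "c \<notin> Domain R" "c \<notin> Range R"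
    using hull ne Domain_in_points[of c R] Range_in_points[of c R] by blast+
  have bac: "b \<notin> closed_segment a c" "a \<notin> closed_segment c b"
    using ac_cb ne by auto
  have seg: "closed_segment a b \<inter> closed_segment x y \<subseteq> {a, b}"
    "closed_segment a c \<inter> closed_segment x y \<subseteq> {a}"
    "closed_segment c b \<inter> closed_segment x y \<subseteq> {b}" if "(x, y) \<in> R" for x y
    using segments_in_triangle[where a=a and b=b and c=c] hull edge_in_points[OF that] bac by blast+
  have abR: "(a, b) \<notin> R"
  proof
    assume "(a, b) \<in> R"
    from seg(1)[OF this] have "midpoint a b \<in> {a, b}" using midpoint_in_closed_segment[of a b] by blast
    then show False using ne by (auto simp: midpoint_eq_endpoint)
  qed
  have acR: "(a, c) \<notin> R" "(c, b) \<notin> R" "(x, c) \<notin> R" "(c, x) \<notin> R" for x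
    using cR by blast+
  have dom: "Domain (insert (a, b) R) = Range (insert (a, b) R) \<longleftrightarrow>
    Domain (insert (a, c) (insert (c, b) R)) = Range (insert (a, c) (insert (c, b) R))"
    using cR ne by auto
  have sv: "single_valued (insert (a, b) R) \<longleftrightarrow> single_valued (insert (a, c) (insert (c, b) R))"
    unfolding single_valued_insert using acR abR ne by auto
  have svc: "single_valued ((insert (a, b) R)\<inverse>) \<longleftrightarrow>
     single_valued ((insert (a, c) (insert (c, b) R))\<inverse>)"
    unfolding converse_insert single_valued_insert using acR abR ne by auto
  have pc: "proper_crossings (insert (a, b) R) \<longleftrightarrow>
     proper_crossings (insert (a, c) (insert (c, b) R))"
  proof -
    have 1: "closed_segment a b \<inter> closed_segment x y \<subseteq> {a, b} \<inter> {x, y} \<longleftrightarrow>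
      closed_segment a c \<inter> closed_segment x y \<subseteq> {a, c} \<inter> {x, y} \<and>
      closed_segment c b \<inter> closed_segment x y \<subseteq> {c, b} \<inter> {x, y}" if xy: "(x, y) \<in> R" for x y
    proof -
      have "a \<in> closed_segment a b" "a \<in> closed_segment a c" "b \<in> closed_segment a b" "b \<in> closed_segment c b" by auto
      then show ?thesis using seg[OF xy] by blast
    qed
    have 2: "closed_segment a c \<inter> closed_segment c b \<subseteq> {a, c} \<inter> {c, b}" using ac_cb by auto
    have "(\<forall>(x, y)\<in>R. (a, b) \<noteq> (x, y) \<longrightarrow> closed_segment a b \<inter> closed_segment x y \<subseteq> {a, b} \<inter> {x, y}) \<longleftrightarrow>
      (\<forall>(x, y)\<in>R. ((c, b) \<noteq> (x, y) \<longrightarrow> closed_segment c b \<inter> closed_segment x y \<subseteq> {c, b} \<inter> {x, y}) \<and>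
          ((a, c) \<noteq> (x, y) \<longrightarrow> closed_segment a c \<inter> closed_segment x y \<subseteq> {a, c} \<inter> {x, y}))"
    proof (intro ball_cong refl, clarify)
      fix x y assume xy: "(x, y) \<in> R"
      then have "(a, b) \<noteq> (x, y)" "(c, b) \<noteq> (x, y)" "(a, c) \<noteq> (x, y)" using abR acR by auto
      then show "((a, b) \<noteq> (x, y) \<longrightarrow> closed_segment a b \<inter> closed_segment x y \<subseteq> {a, b} \<inter> {x, y}) \<longleftrightarrow>
        ((c, b) \<noteq> (x, y) \<longrightarrow> closed_segment c b \<inter> closed_segment x y \<subseteq> {c, b} \<inter> {x, y}) \<and>
          ((a, c) \<noteq> (x, y) \<longrightarrow> closed_segment a c \<inter> closed_segment x y \<subseteq> {a, c} \<inter> {x, y})"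
        using 1[OF xy] by argo
    qed
    then show ?thesis
      unfolding proper_crossings_insert ball_simps(7) prod.case case_prod_beta fst_conv snd_conv
        ball_conj_distrib using 2
      by argo
  qed
  show ?thesis unfolding is_link_iff using dom sv svc pc ne by simp
qed

lemma triangle_moveI:
  assumes clean: "clean_triangle a b c (points R)"
    and link: "is_link (insert (a, b) R) \<or> is_link (insert (a, c) (insert (c, b) R))"
  shows "triangle_move (insert (a, b) R) (insert (a, c) (insert (c, b) R))"
proof -
  have ne: "a \<noteq> b" "c \<noteq> a" "c \<noteq> b" 
    and hull: "convex hull {a, b, c} \<inter> points R \<subseteq> {a, b}"
    using clean by (auto simp: clean_triangle_def)
  have "(a, b) \<notin> R"
  proof
    assume "(a, b) \<in> R"
    then have "midpoint a b \<in> {a, b}"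
      using hull segments_in_triangle(1)[of a b c] edge_in_points[of a b R]
        midpoint_in_closed_segment[of a b] by blast
    then show False using ne by (auto simp: midpoint_eq_endpoint)
  qed
  then have R: "insert (a, b) R - {(a, b)} = R" by auto
  show ?thesis unfolding triangle_move_def
  proof (intro conjI exI)
    show "(a, b) \<in> insert (a, b) R" by simp
    show "insert (a, c) (insert (c, b) R) = insert (a, b) R - {(a, b)} \<union> {(a, c), (c, b)}"
      unfolding R by blast
    show "convex hull {a, b, c} \<inter> points (insert (a, b) R - {(a, b)}) \<subseteq> {a, b}" unfolding R by (fact hull)
  qed (use is_link_triangle[OF clean] link in blast)+
qed

text \<open>
  A triangle move of a part \<open>T\<close> of a link, independent of the rest: the triangle stays in the region \<open>K\<close>,
  and \<open>F\<close> contains the points of \<open>K\<close> that the rest of the link may pass through.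
\<close>

definition tangle_step :: "(real^3) set \<Rightarrow> (real^3) set \<Rightarrow> edges \<Rightarrow> edges \<Rightarrow> bool" where
  "tangle_step K F T T' \<longleftrightarrow> (\<exists>a b c R. T = insert (a, b) R \<and> T' = insert (a, c) (insert (c, b) R) \<and>
     clean_triangle a b c (points R \<union> F) \<and> convex hull {a, b, c} \<subseteq> K)"

definition tangle_eq :: "(real^3) set \<Rightarrow> (real^3) set \<Rightarrow> edges \<Rightarrow> edges \<Rightarrow> bool" where
  "tangle_eq K F = equivclp (tangle_step K F)"

lemma tangle_eq_refl: "tangle_eq K F T T"
  and tangle_eq_sym: "tangle_eq K F T T' \<Longrightarrow> tangle_eq K F T' T"
  and tangle_eq_trans [trans]: "tangle_eq K F T T' \<Longrightarrow> tangle_eq K F T' T'' \<Longrightarrow> tangle_eq K F T T''"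
  unfolding tangle_eq_def by (auto intro: equivclp_sym equivclp_trans)

lemma isotopic_refl: "isotopic L L"
  and isotopic_sym: "isotopic L L' \<Longrightarrow> isotopic L' L"
  and isotopic_trans [trans]: "isotopic L L' \<Longrightarrow> isotopic L' L'' \<Longrightarrow> isotopic L L''"
  unfolding isotopic_def by (auto intro: equivclp_sym equivclp_trans)

lemma tangle_step_move:
  assumes step: "tangle_step K F T T'" and out: "points E \<inter> K \<subseteq> F"
    and link: "is_link (E \<union> T) \<or> is_link (E \<union> T')"
  shows "triangle_move (E \<union> T) (E \<union> T')"
proof -
  obtain a b c R where T: "T = insert (a, b) R" "T' = insert (a, c) (insert (c, b) R)"
    and clean: "clean_triangle a b c (points R \<union> F)" and K: "convex hull {a, b, c} \<subseteq> K"
    using step unfolding tangle_step_def by blast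
  have "convex hull {a, b, c} \<inter> points (E \<union> R) \<subseteq> {a, b}"
    using clean K out unfolding clean_triangle_def points_Un by blast
  then have "clean_triangle a b c (points (E \<union> R))"
    using clean unfolding clean_triangle_def by blast
  from triangle_moveI[OF this] show ?thesis using T link by simp
qed

lemma tangle_eq_isotopic:
  assumes eq: "tangle_eq K F T T'" and out: "points E \<inter> K \<subseteq> F"
    and link: "is_link (E \<union> T)"
  shows "is_link (E \<union> T') \<and> isotopic (E \<union> T) (E \<union> T')"
  using eq unfolding tangle_eq_def
proof (induction rule: equivclp_induct)
  case base
  then show ?case using link by (simp add: isotopic_refl)
next
  case (step y z)
  have "triangle_move (E \<union> y) (E \<union> z) \<or> triangle_move (E \<union> z) (E \<union> y)"
    using tangle_step_move[OF _ out, of y z] tangle_step_move[OF _ out, of z y] step by blast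
  moreover from this have "is_link (E \<union> z)" unfolding triangle_move_def by blast
  ultimately show ?case using step(3) unfolding isotopic_def
    by (metis equivclp_into_equivclp)
qed

lemma tangle_insert:
  assumes "clean_triangle a b c (points R \<union> F)" "convex hull {a, b, c} \<subseteq> K"
  shows "tangle_eq K F (insert (a, b) R) (insert (a, c) (insert (c, b) R))"
  using assms unfolding tangle_eq_def tangle_step_def by (intro r_into_equivclp) blast

text \<open>
  Tangles may be traversed backwards; this and the next lemma let one explicit sequence of moves serve
  for all positions and all symmetric variants of a tangle.
\<close>

lemma tangle_eq_converse:
  assumes "tangle_eq K F T T'" shows "tangle_eq K F (T\<inverse>) (T'\<inverse>)"
proof -
  have "points (R\<inverse>) = points R" for R :: edges
    unfolding points_def by (auto simp: closed_segment_commute)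
  then have *: "tangle_step K F (S\<inverse>) (S'\<inverse>)" if "tangle_step K F S S'" for S S'
    using that unfolding tangle_step_def
  proof (elim exE conjE)
    fix a b c R assume S: "S = insert (a, b) R" "S' = insert (a, c) (insert (c, b) R)"
     "clean_triangle a b c (points R \<union> F)" "convex hull {a, b, c} \<subseteq> K"
    have "S\<inverse> = insert (b, a) (R\<inverse>) \<and> S'\<inverse> = insert (b, c) (insert (c, a) (R\<inverse>)) \<and>
     clean_triangle b a c (points (R\<inverse>) \<union> F) \<and> convex hull {b, a, c} \<subseteq> K"
      using S \<open>\<And>R. points (R\<inverse>) = points R\<close>
      by (auto simp: clean_triangle_def insert_commute closed_segment_commute)
    then show "\<exists>a b c R. S\<inverse> = insert (a, b) R \<and> S'\<inverse> = insert (a, c) (insert (c, b) R) \<and>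
       clean_triangle a b c (points R \<union> F) \<and> convex hull {a, b, c} \<subseteq> K" by blast
  qed
  show ?thesis using assms unfolding tangle_eq_def
    by (induction rule: equivclp_induct) (auto intro: equivclp_into_equivclp dest: *)
qed

lemma tangle_eq_affine:
  fixes g :: "real^3 \<Rightarrow> real^3"
  assumes "tangle_eq K F T T'" and f: "linear f" "inj f" and g: "g = (\<lambda>x. d + f x)"
  shows "tangle_eq (g ` K) (g ` F) (map_prod g g ` T) (map_prod g g ` T')"
proof -
  have inj: "inj g" using f unfolding g by (auto simp: inj_def)
  have hull: "convex hull (g ` S) = g ` (convex hull S)" for S
  proof -
    have "g ` X = (+) d ` f ` X" for X unfolding g by auto
    then show ?thesis using convex_hull_translation[of d "f ` S"] convex_hull_linear_image[OF f(1), of S] by simp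
  qed
  have seg: "closed_segment (g a) (g b) = g ` closed_segment a b" for a b
    using hull[of "{a,b}"] by (simp add: segment_convex_hull)
  have pts: "points (map_prod g g ` R) = g ` points R" for R
    unfolding points_def image_UN image_image by (simp add: case_prod_beta seg)
  have *: "tangle_step (g ` K) (g ` F) (map_prod g g ` S) (map_prod g g ` S')" if "tangle_step K F S S'" for S S'
    using that unfolding tangle_step_def
  proof (elim exE conjE)
    fix a b c R assume S: "S = insert (a, b) R" "S' = insert (a, c) (insert (c, b) R)"
     "clean_triangle a b c (points R \<union> F)" "convex hull {a, b, c} \<subseteq> K"
    have h: "convex hull {g a, g b, g c} = g ` (convex hull {a, b, c})" using hull[of "{a,b,c}"] by simp
    have "clean_triangle (g a) (g b) (g c) (points (map_prod g g ` R) \<union> g ` F)"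
    proof -
      have "g ` (closed_segment a c \<inter> closed_segment c b) \<subseteq> g ` {c}"
        "g ` (convex hull {a, b, c} \<inter> (points R \<union> F)) \<subseteq> g ` {a, b}"
        using S(3) unfolding clean_triangle_def by (intro image_mono; simp only:)+
      then show ?thesis using S(3) unfolding clean_triangle_def h seg pts image_Un[symmetric]
          image_Int[OF inj] inj_eq[OF inj] by simp
    qed
    then show "\<exists>a b c R. map_prod g g ` S = insert (a, b) R \<and> map_prod g g ` S' = insert (a, c) (insert (c, b) R) \<and>
       clean_triangle a b c (points R \<union> g ` F) \<and> convex hull {a, b, c} \<subseteq> g ` K"
      using S(1,2) image_mono[OF S(4), of g]
      by (intro exI[of _ "g a"] exI[of _ "g b"] exI[of _ "g c"] exI[of _ "map_prod g g ` R"])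
         (simp add: h)
  qed
  show ?thesis using assms(1) unfolding tangle_eq_def
    by (induction rule: equivclp_induct) (auto intro: equivclp_into_equivclp dest: *)
qed

text \<open>
  Used to modify all strands at once: moves in regions that do not see each other are performed one
  after the other.
\<close>

lemma parallel_tangles_isotopic:
  assumes "finite I" and eq: "\<And>j. j \<in> I \<Longrightarrow> tangle_eq (K j) (F j) (T j) (T' j)"
    and out: "\<And>j. j \<in> I \<Longrightarrow> points E \<inter> K j \<subseteq> F j"
    and disj: "\<And>i j. i \<in> I \<Longrightarrow> j \<in> I \<Longrightarrow> i \<noteq> j \<Longrightarrow> points (T i \<union> T' i) \<inter> K j \<subseteq> F j"
    and link: "is_link (E \<union> (\<Union>j\<in>I. T j))"
  shows "is_link (E \<union> (\<Union>j\<in>I. T' j)) \<and> isotopic (E \<union> (\<Union>j\<in>I. T j)) (E \<union> (\<Union>j\<in>I. T' j))"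
  using assms
proof (induction I arbitrary: E rule: finite_induct)
  case empty
  then show ?case by (simp add: isotopic_refl)
next
  case (insert i I)
  have 1: "points (E \<union> (\<Union>j\<in>I. T j)) \<inter> K i \<subseteq> F i"
    using insert.prems(2)[of i] insert.prems(3)[of _ i] insert.hyps(2)
    by (auto simp: points_UN)
  have s: "E \<union> (\<Union>j\<in>insert i I. T j) = (E \<union> (\<Union>j\<in>I. T j)) \<union> T i" by auto
  have 2: "is_link ((E \<union> (\<Union>j\<in>I. T j)) \<union> T' i) \<and>
    isotopic (E \<union> (\<Union>j\<in>insert i I. T j)) ((E \<union> (\<Union>j\<in>I. T j)) \<union> T' i)"
    unfolding s using tangle_eq_isotopic[OF insert.prems(1)[of i] 1] insert.prems(4) s by simp
  have s2: "(E \<union> (\<Union>j\<in>I. T j)) \<union> T' i = (E \<union> T' i) \<union> (\<Union>j\<in>I. T j)" by auto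
  have 3: "is_link ((E \<union> T' i) \<union> (\<Union>j\<in>I. T' j)) \<and>
    isotopic ((E \<union> T' i) \<union> (\<Union>j\<in>I. T j)) ((E \<union> T' i) \<union> (\<Union>j\<in>I. T' j))"
  proof (rule insert.IH)
    show "points (E \<union> T' i) \<inter> K j \<subseteq> F j" if "j \<in> I" for j
      using insert.prems(2)[of j] insert.prems(3)[of i j] insert.hyps(2) that by auto
    show "is_link (E \<union> T' i \<union> (\<Union>j\<in>I. T j))" using 2 s2 by simp
    show "tangle_eq (K j) (F j) (T j) (T' j)" if "j \<in> I" for j
      using insert.prems(1) that by blast
    show "points (T k \<union> T' k) \<inter> K j \<subseteq> F j" if "k \<in> I" "j \<in> I" "k \<noteq> j" for k j
      using insert.prems(3)[of k j] that by blast
  qed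
  have s3: "(E \<union> T' i) \<union> (\<Union>j\<in>I. T' j) = E \<union> (\<Union>j\<in>insert i I. T' j)" by auto
  show ?case using conjunct1[OF 3] isotopic_trans[OF conjunct2[OF 2, unfolded s2] conjunct2[OF 3]]
    unfolding s3 by blast
qed

section \<open>Closed diagrams are polygonal links\<close>

lemma pt_nth [simp]: "pt x y z $ 1 = x" "pt x y z $ 2 = y" "pt x y z $ 3 = z"
  by (simp_all add: pt_def)

lemma pt_eq_iff [simp]: "pt x y z = pt x' y' z' \<longleftrightarrow> x = x' \<and> y = y' \<and> z = z'"
  by (metis pt_nth)

lemma pt_combo: "a *\<^sub>R pt x y z + b *\<^sub>R pt x' y' z' = pt (a * x + b * x') (a * y + b * y') (a * z + b * z')"
  by (simp add: vec_eq_iff forall_3)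

lemma mem_segment_pt:
  "p \<in> closed_segment (pt x y z) (pt x' y' z') \<longleftrightarrow>
    (\<exists>u. 0 \<le> u \<and> u \<le> 1 \<and> p = pt (x + u * (x' - x)) (y + u * (y' - y)) (z + u * (z' - z)))"
proof -
  have "(1 - u) *\<^sub>R pt x y z + u *\<^sub>R pt x' y' z' = pt (x + u * (x' - x)) (y + u * (y' - y)) (z + u * (z' - z))" for u
    unfolding pt_combo by (simp add: algebra_simps)
  then show ?thesis unfolding closed_segment_def by auto
qed

definition straight :: "real \<Rightarrow> real \<Rightarrow> (real^3) \<times> (real^3)" where
  "straight x y = (pt x y 0, pt x (y + 1) 0)"

definition crossing :: "real \<Rightarrow> real \<Rightarrow> real \<Rightarrow> edges" where
  "crossing x y h = {(pt x y 0, pt (x + 1/2) (y + 1/2) h), (pt (x + 1/2) (y + 1/2) h, pt (x + 1) (y + 1) 0),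
     (pt (x + 1) y 0, pt x (y + 1) 0)}"

definition letter_edges :: "nat \<Rightarrow> int \<Rightarrow> edges" where
  "letter_edges k s = crossing (real_of_int \<bar>s\<bar>) (real k) (of_int (sgn s) / 2)"

definition occupied :: "int set \<Rightarrow> int set" where
  "occupied C = (\<Union>s\<in>C. {\<bar>s\<bar>, \<bar>s\<bar> + 1})"

text \<open>
  A level may contain several crossings far from each other, so that a crossing can slide past another
  one; the empty set of letters is a level without crossings. The strands in the positions \<open>B\<close> are left
  out, which makes room for a tangle to be filled in.
\<close>

definition level :: "nat \<Rightarrow> nat \<Rightarrow> int set \<Rightarrow> int set \<Rightarrow> edges" where
  "level n k C B = {straight (real j) (real k) |j. j \<in> {1..n} \<and> int j \<notin> occupied C \<union> B} \<union>
     (\<Union>s\<in>C. letter_edges k s)"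

definition valid_level :: "nat \<Rightarrow> int set \<Rightarrow> int set \<Rightarrow> bool" where
  "valid_level n C B \<longleftrightarrow> (\<forall>s\<in>C. 1 \<le> \<bar>s\<bar> \<and> \<bar>s\<bar> < int n \<and> \<bar>s\<bar> \<notin> B \<and> \<bar>s\<bar> + 1 \<notin> B) \<and>
     (\<forall>s\<in>C. \<forall>s'\<in>C. s \<noteq> s' \<longrightarrow> 2 \<le> \<bar>\<bar>s\<bar> - \<bar>s'\<bar>\<bar>)"

definition frame :: "nat \<Rightarrow> (int set \<times> int set) list \<Rightarrow> edges" where
  "frame n D = (\<Union>k<length D. level n k (fst (D ! k)) (snd (D ! k))) \<union> return_edges n (length D)"

definition valid_frame :: "nat \<Rightarrow> (int set \<times> int set) list \<Rightarrow> bool" where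
  "valid_frame n D \<longleftrightarrow> (\<forall>(C, B)\<in>set D. valid_level n C B)"

definition diagram :: "nat \<Rightarrow> int set list \<Rightarrow> edges" where
  "diagram n Cs = frame n (map (\<lambda>C. (C, {})) Cs)"

definition valid_diagram :: "nat \<Rightarrow> int set list \<Rightarrow> bool" where
  "valid_diagram n Cs \<longleftrightarrow> (\<forall>C\<in>set Cs. valid_level n C {})"

lemma diagram_alt: "diagram n Cs = (\<Union>k<length Cs. level n k (Cs ! k) {}) \<union> return_edges n (length Cs)"
  by (simp add: diagram_def frame_def)

lemma half_sgn: "s \<noteq> 0 \<Longrightarrow> \<bar>of_int (sgn (s::int)) / 2 :: real\<bar> = 1/2" "\<bar>of_int (sgn (s::int)) / 2 :: real\<bar> \<le> 1/2"
  by (auto simp: sgn_if)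

lemma straight_point:
  assumes "p \<in> closed_segment (fst (straight x y)) (snd (straight x y))"
  shows "p $ 1 = x \<and> y \<le> p $ 2 \<and> p $ 2 \<le> y + 1 \<and> p $ 3 = 0"
  using assms unfolding straight_def fst_conv snd_conv mem_segment_pt by auto

lemma crossing_point:
  assumes "e \<in> crossing x y h" "p \<in> closed_segment (fst e) (snd e)"
  shows "x \<le> p $ 1 \<and> p $ 1 \<le> x + 1 \<and> y \<le> p $ 2 \<and> p $ 2 \<le> y + 1 \<and> \<bar>p $ 3\<bar> \<le> \<bar>h\<bar> \<and>
    (p $ 2 = y \<longrightarrow> p = fst e \<and> (p = pt x y 0 \<or> p = pt (x + 1) y 0)) \<and>
    (p $ 2 = y + 1 \<longrightarrow> p = snd e \<and> (p = pt x (y + 1) 0 \<or> p = pt (x + 1) (y + 1) 0))"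
proof -
  have m: "\<bar>u * h\<bar> \<le> \<bar>h\<bar>" if "0 \<le> u" "u \<le> 1" for u
    using that by (simp add: abs_mult mult_left_le_one_le)
  have m': "\<bar>h - u * h\<bar> \<le> \<bar>h\<bar>" if "0 \<le> u" "u \<le> 1" for u
    using m[of "1 - u"] that by (simp add: algebra_simps)
  consider (1) u where "0 \<le> u" "u \<le> 1" "e = (pt x y 0, pt (x + 1/2) (y + 1/2) h)" "p = pt (x + u / 2) (y + u /
    2) (u * h)"
    | (2) u where "0 \<le> u" "u \<le> 1" "e = (pt (x + 1/2) (y + 1/2) h, pt (x + 1) (y + 1) 0)"
        "p = pt (x + 1/2 + u / 2) (y + 1/2 + u / 2) (h - u * h)"
    | (3) u where "0 \<le> u" "u \<le> 1" "e = (pt (x + 1) y 0, pt x (y + 1) 0)" "p = pt (x + 1 - u) (y + u) 0"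
    using assms unfolding crossing_def by (auto simp: mem_segment_pt)
  then show ?thesis
  proof cases
    case 1
    show ?thesis unfolding 1(3,4) using 1(1,2) m by auto
  next
    case 2
    show ?thesis unfolding 2(3,4) using 2(1,2) m' by auto
  next
    case 3
    show ?thesis unfolding 3(3,4) using 3(1,2) by auto
  qed
qed

lemma level_cases [consumes 1, case_names straight crossing]:
  assumes "e \<in> level n k C B"
  obtains j where "j \<in> {1..n}" "int j \<notin> occupied C" "int j \<notin> B" "e = straight (real j) (real k)"
  | s where "s \<in> C" "e \<in> letter_edges k s"
  using assms unfolding level_def by blast

lemma level_point:
  assumes e: "e \<in> level n k C B" and v: "valid_level n C B" and p: "p \<in> closed_segment (fst e) (snd e)"
  shows "real k \<le> p $ 2 \<and> p $ 2 \<le> real k + 1 \<and> \<bar>p $ 3\<bar> \<le> 1/2 \<and>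
    (p $ 2 = real k \<longrightarrow> p = fst e \<and> (\<exists>j\<in>{1..n}. p = pt (real j) (real k) 0)) \<and>
    (p $ 2 = real k + 1 \<longrightarrow> p = snd e \<and> (\<exists>j\<in>{1..n}. p = pt (real j) (real k + 1) 0))"
  using e
proof (cases rule: level_cases)
  case (straight j)
  then show ?thesis using p by (auto simp: straight_def mem_segment_pt)
next
  case (crossing s)
  have s: "1 \<le> \<bar>s\<bar>" "\<bar>s\<bar> < int n" using v crossing(1) unfolding valid_level_def by auto
  have j: "real_of_int \<bar>s\<bar> = real (nat \<bar>s\<bar>)" "real_of_int \<bar>s\<bar> + 1 = real (nat \<bar>s\<bar> + 1)"
    "nat \<bar>s\<bar> \<in> {1..n}" "nat \<bar>s\<bar> + 1 \<in> {1..n}" using s by auto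
  note cp = crossing_point[OF crossing(2)[unfolded letter_edges_def] p]
  have "p $ 2 = real k \<Longrightarrow> p = fst e \<and> (\<exists>j\<in>{1..n}. p = pt (real j) (real k) 0)"
    "p $ 2 = real k + 1 \<Longrightarrow> p = snd e \<and> (\<exists>j\<in>{1..n}. p = pt (real j) (real k + 1) 0)"
    using cp j(3,4) unfolding j(2) unfolding j(1) by blast+
  moreover have "\<bar>p $ 3\<bar> \<le> 1/2" using cp half_sgn(2)[of s] order_trans by blast
  ultimately show ?thesis using cp by blast
qed

lemma level_ends:
  assumes e: "e \<in> level n k C B"
  shows "(fst e $ 2 = real k \<or> fst e $ 2 = real k + 1/2) \<and> (snd e $ 2 = real k + 1 \<or> snd e $ 2 = real k + 1/2)"
  using e by (cases rule: level_cases) (auto simp: straight_def letter_edges_def crossing_def)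

lemma return_edges_cases [consumes 1, case_names up over down]:
  assumes "e \<in> return_edges n m"
  obtains j where "j \<in> {1..n}" "e = (pt (real j) (real m) 0, pt (real j) (real m + 1) 1)"
  | j where "j \<in> {1..n}" "e = (pt (real j) (real m + 1) 1, pt (real j) (- 1) 1)"
  | j where "j \<in> {1..n}" "e = (pt (real j) (- 1) 1, pt (real j) 0 0)"
  using assms unfolding return_edges_def by auto

lemma frame_cases [consumes 1, case_names level return]:
  assumes "e \<in> frame n D"
  obtains k where "k < length D" "e \<in> level n k (fst (D ! k)) (snd (D ! k))"
  | "e \<in> return_edges n (length D)"
  using assms unfolding frame_def by blast

text \<open>
  The part of a diagram outside a hole meets the block around the hole in the obvious end points only.
  This is the hypothesis that every local move needs: edges of other levels can reach the block only
  at its bottom and top, edges of the same levels are at integer distance, and the return edges are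
  too high.
\<close>

lemma frame_box:
  assumes v: "valid_frame n D" and kr: "k + r \<le> length D"
    and hole: "\<And>l. k \<le> l \<Longrightarrow> l < k + r \<Longrightarrow> {i..i + d} \<subseteq> snd (D ! l)" and d: "0 \<le> d"
    and p: "p \<in> points (frame n D)" and x: "real_of_int i \<le> p $ 1" "p $ 1 \<le> real_of_int (i + d)"
    and y: "real k \<le> p $ 2" "p $ 2 \<le> real (k + r)" and z: "p $ 3 \<le> 3/4"
  shows "\<exists>j\<in>{i..i + d}. p = pt (real_of_int j) (real k) 0 \<or> p = pt (real_of_int j) (real (k + r)) 0"
proof -
  obtain e where e: "e \<in> frame n D" and pe: "p \<in> closed_segment (fst e) (snd e)"
    using p unfolding points_def by force
  have int_pt: ?thesis if "p = pt (real j) t 0" "t = real k \<or> t = real (k + r)" for j t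
  proof -
    have "real_of_int i \<le> real_of_int (int j)" "real_of_int (int j) \<le> real_of_int (i + d)"
      using x that by simp_all
    then have "int j \<in> {i..i + d}" unfolding of_int_le_iff by simp
    then show ?thesis using that by (intro bexI[of _ "int j"]) auto
  qed
  show ?thesis using e
  proof (cases rule: frame_cases)
    case (level l)
    have vl: "valid_level n (fst (D ! l)) (snd (D ! l))"
      using v level(1) unfolding valid_frame_def by (metis case_prodE fst_conv nth_mem snd_conv)
    note lp = level_point[OF level(2) vl pe]
    consider "l < k" | "k + r \<le> l" | "k \<le> l" "l < k + r" by linarith
    then show ?thesis
    proof cases
      case 1
      then have "p $ 2 = real l + 1" "real l + 1 = real k" using lp y by linarith+
      then show ?thesis using lp int_pt by metis
    next
      case 2
      then have "p $ 2 = real l" "real l = real (k + r)" using lp y by linarith+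
      then show ?thesis using lp int_pt by metis
    next
      case 3
      note B = hole[OF 3]
      show ?thesis using level(2)
      proof (cases rule: level_cases)
        case (straight j)
        have "p $ 1 = real j" using straight_point pe straight(4) by blast
        then have "real_of_int i \<le> real_of_int (int j)" "real_of_int (int j) \<le> real_of_int (i + d)"
          using x by simp_all
        then have "int j \<in> {i..i + d}" unfolding of_int_le_iff by simp
        then show ?thesis using straight(3) B by blast
      next
        case (crossing s)
        have "real_of_int \<bar>s\<bar> \<le> p $ 1" "p $ 1 \<le> real_of_int \<bar>s\<bar> + 1"
          using crossing_point[OF crossing(2)[unfolded letter_edges_def] pe] by auto
        then have "i \<le> \<bar>s\<bar> + 1" "\<bar>s\<bar> \<le> i + d" using x by linarith+
        moreover have "\<bar>s\<bar> \<notin> {i..i + d}" "\<bar>s\<bar> + 1 \<notin> {i..i + d}"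
          using vl crossing(1) B unfolding valid_level_def by blast+
        ultimately show ?thesis using d by auto
      qed
    qed
  next
    case return
    then show ?thesis
    proof (cases rule: return_edges_cases)
      case (up j)
      then obtain u where u: "0 \<le> u" "p = pt (real j) (real (length D) + u) u"
        using pe by (auto simp: mem_segment_pt)
      then have "u = 0" "real (length D) = real (k + r)" using y kr by auto
      then show ?thesis using u int_pt[of j "real (length D)"] by simp
    next
      case (over j)
      then have "p $ 3 = 1" using pe by (auto simp: mem_segment_pt)
      then show ?thesis using z by simp
    next
      case (down j)
      then obtain u where u: "u \<le> 1" "p = pt (real j) (- 1 + u) (1 - u)"
        using pe by (auto simp: mem_segment_pt)
      then have "u = 1" "real k = 0" using y by auto
      then show ?thesis using u int_pt[of j 0] by simp
    qed
  qed
qed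

definition meet_properly :: "(real^3) \<times> (real^3) \<Rightarrow> (real^3) \<times> (real^3) \<Rightarrow> bool" where
  "meet_properly e e' \<longleftrightarrow> (\<forall>p. p \<in> closed_segment (fst e) (snd e) \<longrightarrow> p \<in> closed_segment (fst e') (snd e')
     \<longrightarrow> (p = fst e \<or> p = snd e) \<and> (p = fst e' \<or> p = snd e'))"

lemma meet_properly_sym: "meet_properly e e' \<longleftrightarrow> meet_properly e' e"
  unfolding meet_properly_def by blast

lemma proper_crossingsI:
  assumes "\<And>e e'. e \<in> L \<Longrightarrow> e' \<in> L \<Longrightarrow> e \<noteq> e' \<Longrightarrow> meet_properly e e'"
  shows "proper_crossings L"
  unfolding proper_crossings_def
proof (clarify, goal_cases)
  case (1 a b c d p)
  then show ?case using assms[of "(a, b)" "(c, d)"] unfolding meet_properly_def by auto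
qed

lemma crossing_meet_properly:
  assumes h: "h \<noteq> 0" and e: "e \<in> crossing x y h" "e' \<in> crossing x y h" "e \<noteq> e'"
  shows "meet_properly e e'"
proof -
  let ?A = "(pt x y 0, pt (x + 1/2) (y + 1/2) h)" and ?B = "(pt (x + 1/2) (y + 1/2) h, pt (x + 1) (y + 1) 0)"
    and ?C = "(pt (x + 1) y 0, pt x (y + 1) 0)"
  have AB: "meet_properly ?A ?B" unfolding meet_properly_def fst_conv snd_conv mem_segment_pt
    by (auto simp: field_simps)
  have AC: "meet_properly ?A ?C" unfolding meet_properly_def fst_conv snd_conv mem_segment_pt
    using h by (auto simp: field_simps)
  have BC: "meet_properly ?B ?C" unfolding meet_properly_def fst_conv snd_conv mem_segment_pt
    using h by (auto simp: field_simps)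
  show ?thesis using e AB AC BC meet_properly_sym unfolding crossing_def by blast
qed

lemma level_meet_properly:
  assumes v: "valid_level n C B" and e: "e \<in> level n k C B" "e' \<in> level n k C B" "e \<noteq> e'"
  shows "meet_properly e e'"
proof -
  have sc: "meet_properly (straight (real j) (real k)) f" if "int j \<notin> occupied C" "s \<in> C" "f \<in> letter_edges k s"
    for j s f
  proof -
    have False if p: "p \<in> closed_segment (fst (straight (real j) (real k))) (snd (straight (real j) (real k)))"
      "p \<in> closed_segment (fst f) (snd f)" for p
    proof -
      have "p $ 1 = real_of_int (int j)" using straight_point[OF p(1)] by simp
      moreover have "real_of_int \<bar>s\<bar> \<le> p $ 1" "p $ 1 \<le> real_of_int (\<bar>s\<bar> + 1)"
        using crossing_point[OF \<open>f \<in> letter_edges k s\<close>[unfolded letter_edges_def] p(2)] by auto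
      ultimately have "\<bar>s\<bar> \<le> int j" "int j \<le> \<bar>s\<bar> + 1" by linarith+
      then show False using \<open>int j \<notin> occupied C\<close> \<open>s \<in> C\<close> unfolding occupied_def by force
    qed
    then show ?thesis unfolding meet_properly_def by blast
  qed
  show ?thesis using e(1)
  proof (cases rule: level_cases)
    case (straight j)
    note s1 = straight
    show ?thesis using e(2)
    proof (cases rule: level_cases)
      case (straight j')
      have "real j \<noteq> real j'" using straight(4) s1(4) e(3) by auto
      then show ?thesis unfolding meet_properly_def s1(4) straight(4) using straight_point by metis
    next
      case (crossing s)
      then show ?thesis using sc s1 by blast
    qed
  next
    case (crossing s)
    note c1 = crossing
    show ?thesis using e(2)
    proof (cases rule: level_cases)
      case (straight j')
      then show ?thesis using sc c1 meet_properly_sym by blast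
    next
      case (crossing s')
      show ?thesis
      proof (cases "s = s'")
        case True
        have "s \<noteq> 0" using c1(1) v unfolding valid_level_def by force
        then have "of_int (sgn s) / 2 \<noteq> (0::real)" by (simp add: sgn_0_0)
        then show ?thesis using crossing_meet_properly c1(2) crossing(2) e(3) True unfolding letter_edges_def by metis
      next
        case False
        then have "2 \<le> \<bar>\<bar>s\<bar> - \<bar>s'\<bar>\<bar>" using v c1(1) crossing(1) unfolding valid_level_def by blast
        then have far: "real_of_int \<bar>s\<bar> + 1 < real_of_int \<bar>s'\<bar> \<or> real_of_int \<bar>s'\<bar> + 1 < real_of_int \<bar>s\<bar>"
          by linarith
        show ?thesis unfolding meet_properly_def
        proof (intro allI impI, goal_cases)
          case (1 p)
          have "real_of_int \<bar>s\<bar> \<le> p $ 1" "p $ 1 \<le> real_of_int \<bar>s\<bar> + 1"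
            "real_of_int \<bar>s'\<bar> \<le> p $ 1" "p $ 1 \<le> real_of_int \<bar>s'\<bar> + 1"
            using crossing_point[OF c1(2)[unfolded letter_edges_def] 1(1)]
              crossing_point[OF crossing(2)[unfolded letter_edges_def] 1(2)] by blast+
          then have False using far by linarith
          then show ?case ..
        qed
      qed
    qed
  qed
qed

lemma return_meet_properly:
  assumes e: "e \<in> return_edges n m" "e' \<in> return_edges n m" "e \<noteq> e'"
  shows "meet_properly e e'"
proof -
  have x: "\<exists>j. e = (pt (real j) (real m) 0, pt (real j) (real m + 1) 1) \<or>
     e = (pt (real j) (real m + 1) 1, pt (real j) (- 1) 1) \<or> e = (pt (real j) (- 1) 1, pt (real j) 0 0)"
    if "e \<in> return_edges n m" for e
    using that by (cases rule: return_edges_cases) blast+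
  obtain j where j: "e = (pt (real j) (real m) 0, pt (real j) (real m + 1) 1) \<or>
     e = (pt (real j) (real m + 1) 1, pt (real j) (- 1) 1) \<or> e = (pt (real j) (- 1) 1, pt (real j) 0 0)"
    using x[OF e(1)] by blast
  obtain j' where j': "e' = (pt (real j') (real m) 0, pt (real j') (real m + 1) 1) \<or>
     e' = (pt (real j') (real m + 1) 1, pt (real j') (- 1) 1) \<or> e' = (pt (real j') (- 1) 1, pt (real j') 0 0)"
    using x[OF e(2)] by blast
  have m: "0 \<le> real m" by simp
  show ?thesis
  proof (cases "j = j'")
    case False
    then show ?thesis using j j' unfolding meet_properly_def by (auto simp: mem_segment_pt)
  next
    case True
    let ?x = "real j"
    have 1: "meet_properly (pt ?x (real m) 0, pt ?x (real m + 1) 1) (pt ?x (real m + 1) 1, pt ?x (- 1) 1)"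
      unfolding meet_properly_def by (auto simp: mem_segment_pt)
    have 2: "meet_properly (pt ?x (real m + 1) 1, pt ?x (- 1) 1) (pt ?x (- 1) 1, pt ?x 0 0)"
      unfolding meet_properly_def by (auto simp: mem_segment_pt)
    have 3: "meet_properly (pt ?x (real m) 0, pt ?x (real m + 1) 1) (pt ?x (- 1) 1, pt ?x 0 0)"
      unfolding meet_properly_def using m by (auto simp: mem_segment_pt)
    show ?thesis using j j' e(3) 1 2 3 meet_properly_sym True by metis
  qed
qed

lemma level_return_meet_properly:
  assumes v: "valid_level n C B" and k: "k < m" and e: "e \<in> level n k C B" "e' \<in> return_edges n m"
  shows "meet_properly e e'"
  unfolding meet_properly_def
proof (intro allI impI, goal_cases)
  case (1 p)
  note lp = level_point[OF e(1) v 1(1)]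
  have km: "real k + 1 \<le> real m" using k by linarith
  show ?case using e(2)
  proof (cases rule: return_edges_cases)
    case (up j)
    then obtain u where u: "0 \<le> u" "p = pt (real j) (real m + u) u" using 1(2) by (auto simp: mem_segment_pt)
    then have "u = 0" "p $ 2 = real k + 1" using lp km by auto
    then show ?thesis using lp u up by auto
  next
    case (over j)
    then have "p $ 3 = 1" using 1(2) by (auto simp: mem_segment_pt)
    then show ?thesis using lp by simp
  next
    case (down j)
    then obtain u where u: "u \<le> 1" "p = pt (real j) (- 1 + u) (1 - u)" using 1(2) by (auto simp: mem_segment_pt)
    then have "u = 1" "p $ 2 = real k" using lp by auto
    then show ?thesis using lp u down by auto
  qed
qed

lemma level_level_meet_properly:
  assumes v: "valid_level n C B" "valid_level n C' B'" and k: "k < l"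
    and e: "e \<in> level n k C B" "e' \<in> level n l C' B'"
  shows "meet_properly e e'"
  unfolding meet_properly_def
proof (intro allI impI, goal_cases)
  case (1 p)
  have "real k + 1 \<le> real l" using k by linarith
  then have "p $ 2 = real k + 1" "p $ 2 = real l"
    using level_point[OF e(1) v(1) 1(1)] level_point[OF e(2) v(2) 1(2)] by linarith+
  then show ?case using level_point[OF e(1) v(1) 1(1)] level_point[OF e(2) v(2) 1(2)] by blast
qed

lemma valid_nth: "valid_diagram n Cs \<Longrightarrow> k < length Cs \<Longrightarrow> valid_level n (Cs ! k) {}"
  by (simp add: valid_diagram_def)

lemma diagram_cases [consumes 1, case_names level return]:
  assumes "e \<in> diagram n Cs"
  obtains k where "k < length Cs" "e \<in> level n k (Cs ! k) {}"
  | "e \<in> return_edges n (length Cs)"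
  using assms unfolding diagram_alt by blast

lemma proper_crossings_diagram:
  assumes v: "valid_diagram n Cs"
  shows "proper_crossings (diagram n Cs)"
proof (rule proper_crossingsI)
  fix e e' assume e: "e \<in> diagram n Cs" "e' \<in> diagram n Cs" "e \<noteq> e'"
  show "meet_properly e e'" using e(1)
  proof (cases rule: diagram_cases)
    case (level k)
    note l1 = level
    show ?thesis using e(2)
    proof (cases rule: diagram_cases)
      case (level l)
      consider "k = l" | "k < l" | "l < k" by linarith
      then show ?thesis
        using level_meet_properly[OF valid_nth[OF v]] level_level_meet_properly[OF valid_nth[OF v] valid_nth[OF v]]
          l1 level e(3) meet_properly_sym by cases metis+
    next
      case return
      then show ?thesis using level_return_meet_properly[OF valid_nth[OF v]] l1 by blast
    qed
  next
    case return
    note r1 = return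
    show ?thesis using e(2)
    proof (cases rule: diagram_cases)
      case (level l)
      then show ?thesis using level_return_meet_properly[OF valid_nth[OF v]] r1 meet_properly_sym by blast
    next
      case return
      then show ?thesis using return_meet_properly r1 e(3) by blast
    qed
  qed
qed

text \<open>
  Injectivity of both end point maps says that no vertex has two outgoing or two incoming edges.
\<close>

lemma inj_on_level_ends:
  assumes v: "valid_level n C B"
  shows "inj_on fst (level n k C B)" "inj_on snd (level n k C B)"
proof -
  have r: "real_of_int a \<noteq> real_of_int b + 1" "real_of_int b + 1 \<noteq> real_of_int a" 
      "real_of_int a \<noteq> real_of_int b" if "2 \<le> \<bar>a - b\<bar>" for a b
    using that by linarith+
  have cc: "e = e'" if "s \<in> C" "s' \<in> C" "e \<in> letter_edges k s" "e' \<in> letter_edges k s'" "fst e = fst e' \<or> snd e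
    = snd e'"
    for s s' e e'
  proof (cases "s = s'")
    case True
    then show ?thesis using that by (auto simp: letter_edges_def crossing_def)
  next
    case False
    then have "2 \<le> \<bar>\<bar>s\<bar> - \<bar>s'\<bar>\<bar>" "2 \<le> \<bar>\<bar>s'\<bar> - \<bar>s\<bar>\<bar>" using v that(1,2) unfolding valid_level_def by fastforce+
    from r[OF this(1)] r[OF this(2)] show ?thesis using that(3-5) unfolding letter_edges_def crossing_def
      by (auto simp del: of_int_abs)
  qed
  have sc: False if "int j \<notin> occupied C" "s \<in> C" "e \<in> letter_edges k s"
     "fst (straight (real j) (real k)) = fst e \<or> snd (straight (real j) (real k)) = snd e" for j s e
  proof -
    have "real j = real_of_int \<bar>s\<bar> \<or> real j = real_of_int \<bar>s\<bar> + 1"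
      using that(3,4) by (auto simp: straight_def letter_edges_def crossing_def simp del: of_int_abs)
    then have "int j = \<bar>s\<bar> \<or> int j = \<bar>s\<bar> + 1" by linarith
    then show False using that(1,2) unfolding occupied_def by blast
  qed
  have *: "e = e'" if "e \<in> level n k C B" "e' \<in> level n k C B" "fst e = fst e' \<or> snd e = snd e'" for e e'
    using that(1)
  proof (cases rule: level_cases)
    case (straight j)
    note s1 = straight
    show ?thesis using that(2)
    proof (cases rule: level_cases)
      case (straight j')
      then show ?thesis using s1 that(3) by (auto simp: straight_def)
    next
      case (crossing s)
      then show ?thesis using sc s1 that(3) by blast
    qed
  next
    case (crossing s)
    note c1 = crossing
    show ?thesis using that(2)
    proof (cases rule: level_cases)
      case (straight j')
      then show ?thesis using sc[OF straight(2) c1(1,2)] that(3) by metis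
    next
      case (crossing s')
      then show ?thesis using cc c1 that(3) by metis
    qed
  qed
  show "inj_on fst (level n k C B)" "inj_on snd (level n k C B)"
    by (rule inj_onI, rule *, simp_all)+
qed

lemma level_end_heights:
  assumes e: "e \<in> level n k C B"
  shows "\<bar>fst e $ 3\<bar> \<le> 1/2" "\<bar>snd e $ 3\<bar> \<le> 1/2"
  using e half_sgn(2) by (cases rule: level_cases; force simp: straight_def letter_edges_def crossing_def)+

lemma inj_on_diagram_ends:
  assumes v: "valid_diagram n Cs"
  shows "inj_on fst (diagram n Cs)" "inj_on snd (diagram n Cs)"
proof -
  let ?m = "length Cs"
  have ll: "k = l" if "e \<in> level n k C {}" "e' \<in> level n l C' {}" "fst e = fst e' \<or> snd e = snd e'" for e e' k l C C'
    using level_ends[OF that(1)] level_ends[OF that(2)] that(3) by auto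
  have lr: False if "k < ?m" "e \<in> level n k C {}" "e' \<in> return_edges n ?m" "fst e = fst e' \<or> snd e = snd e'" for
    e e' k C
    using that(3)
  proof (cases rule: return_edges_cases)
    case (up j)
    then show ?thesis using level_ends[OF that(2)] level_end_heights[OF that(2)] that(1,4) by auto
  next
    case (over j)
    then show ?thesis using level_end_heights[OF that(2)] that(4) by auto
  next
    case (down j)
    then show ?thesis using level_ends[OF that(2)] level_end_heights[OF that(2)] that(1,4) by auto
  qed
  have rr: "e = e'" if "e \<in> return_edges n ?m" "e' \<in> return_edges n ?m" "fst e = fst e' \<or> snd e = snd e'" for e e'
    using that(1)
  proof (cases rule: return_edges_cases)
    case up
    then show ?thesis using that(2,3) by (auto elim!: return_edges_cases)
  next
    case over
    then show ?thesis using that(2,3) by (auto elim!: return_edges_cases)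
  next
    case down
    then show ?thesis using that(2,3) by (auto elim!: return_edges_cases)
  qed
  have *: "e = e'" if "e \<in> diagram n Cs" "e' \<in> diagram n Cs" "fst e = fst e' \<or> snd e = snd e'" for e e'
    using that(1)
  proof (cases rule: diagram_cases)
    case (level k)
    note l1 = level
    show ?thesis using that(2)
    proof (cases rule: diagram_cases)
      case (level l)
      then have "k = l" using ll l1 that(3) by blast
      then show ?thesis using inj_on_level_ends[OF valid_nth[OF v]] l1 level that(3) by (metis inj_onD)
    next
      case return
      then show ?thesis using lr l1 that(3) by blast
    qed
  next
    case return
    note r1 = return
    show ?thesis using that(2)
    proof (cases rule: diagram_cases)
      case (level l)
      then show ?thesis using lr[OF level r1] that(3) by metis
    next
      case return
      then show ?thesis using rr r1 that(3) by blast
    qed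
  qed
  show "inj_on fst (diagram n Cs)" "inj_on snd (diagram n Cs)"
    by (rule inj_onI, rule *, simp_all)+
qed

lemma level_Domain_Range:
  assumes v: "valid_level n C {}"
  shows "fst ` level n k C {} = (\<lambda>j. pt (real j) (real k) 0) ` {1..n} \<union>
      (\<lambda>s. pt (real_of_int \<bar>s\<bar> + 1/2) (real k + 1/2) (of_int (sgn s) / 2)) ` C" (is "_ = ?P k \<union> ?A")
    and "snd ` level n k C {} = (\<lambda>j. pt (real j) (real k + 1) 0) ` {1..n} \<union>
      (\<lambda>s. pt (real_of_int \<bar>s\<bar> + 1/2) (real k + 1/2) (of_int (sgn s) / 2)) ` C" (is "_ = ?P' k \<union> _")
proof -
  have s: "real_of_int \<bar>s\<bar> = real (nat \<bar>s\<bar>)" "real_of_int \<bar>s\<bar> + 1 = real (nat \<bar>s\<bar> + 1)"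
    "nat \<bar>s\<bar> \<in> {1..n}" "nat \<bar>s\<bar> + 1 \<in> {1..n}" if "s \<in> C" for s
    using v that unfolding valid_level_def by auto
  let ?S = "{straight (real j) (real k) |j. j \<in> {1..n} \<and> int j \<notin> occupied C}"
  have L: "level n k C {} = ?S \<union> (\<Union>s\<in>C. letter_edges k s)" unfolding level_def by simp
  have fS: "fst ` ?S = (\<lambda>j. pt (real j) (real k) 0) ` {j \<in> {1..n}. int j \<notin> occupied C}"
    and sS: "snd ` ?S = (\<lambda>j. pt (real j) (real k + 1) 0) ` {j \<in> {1..n}. int j \<notin> occupied C}"
    by (force simp: straight_def)+
  have fl: "fst ` letter_edges k s = {pt (real (nat \<bar>s\<bar>)) (real k) 0, pt (real (nat \<bar>s\<bar> + 1)) (real k) 0,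
      pt (real_of_int \<bar>s\<bar> + 1/2) (real k + 1/2) (of_int (sgn s) / 2)}"
    "snd ` letter_edges k s = {pt (real (nat \<bar>s\<bar>)) (real k + 1) 0, pt (real (nat \<bar>s\<bar> + 1)) (real k + 1) 0,
      pt (real_of_int \<bar>s\<bar> + 1/2) (real k + 1/2) (of_int (sgn s) / 2)}" if "s \<in> C" for s
    unfolding letter_edges_def crossing_def using s(1,2)[OF that] by auto
  have occ: "{1..n} = {j \<in> {1..n}. int j \<notin> occupied C} \<union> (\<Union>s\<in>C. {nat \<bar>s\<bar>, nat \<bar>s\<bar> + 1})"
  proof (intro equalityI subsetI)
    fix j assume j: "j \<in> {1..n}"
    have "j \<in> (\<Union>s\<in>C. {nat \<bar>s\<bar>, nat \<bar>s\<bar> + 1})" if o: "int j \<in> occupied C"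
    proof -
      obtain s where "s \<in> C" "int j \<in> {\<bar>s\<bar>, \<bar>s\<bar> + 1}" using o unfolding occupied_def by (rule UN_E)
      then have "j = nat \<bar>s\<bar> \<or> j = nat \<bar>s\<bar> + 1" by auto
      then show ?thesis using \<open>s \<in> C\<close> by blast
    qed
    then show "j \<in> {j \<in> {1..n}. int j \<notin> occupied C} \<union> (\<Union>s\<in>C. {nat \<bar>s\<bar>, nat \<bar>s\<bar> + 1})" using j by blast
  qed (use s(3,4) in blast)
  have P: "(\<lambda>j. pt (real j) y 0) ` {1..n} = (\<lambda>j. pt (real j) y 0) ` {j \<in> {1..n}. int j \<notin> occupied C} \<union>
     (\<Union>s\<in>C. {pt (real (nat \<bar>s\<bar>)) y 0, pt (real (nat \<bar>s\<bar> + 1)) y 0})" for y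
    by (subst occ) (simp only: image_Un image_UN image_insert image_empty)
  show "fst ` level n k C {} = ?P k \<union> ?A" "snd ` level n k C {} = ?P' k \<union> ?A"
    unfolding L image_Un image_UN fS sS P using fl by auto
qed

text \<open>
  Two edges of different levels can meet only at the height where the levels touch, where both of them
  have an end point. The return edges of different strands lie in different planes. In \<open>Domain = Range\<close>
  the end points of each level are the starting points of the next one, and the return edges close the
  cycle.
\<close>

lemma is_link_diagram:
  assumes n: "n \<ge> 1" and v: "valid_diagram n Cs"
  shows "is_link (diagram n Cs)"
proof -
  let ?m = "length Cs"
  have fin: "finite (level n k C {})" if "valid_level n C {}" for k C
  proof -
    have "C \<subseteq> {- int n..int n}"
    proof
      fix s assume "s \<in> C"
      then have "\<bar>s\<bar> < int n" using that unfolding valid_level_def by blast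
      then show "s \<in> {- int n..int n}" by auto
    qed
    then have "finite C" by (rule finite_subset) simp
    then show ?thesis unfolding level_def letter_edges_def crossing_def by simp
  qed
  have "finite (diagram n Cs)" unfolding diagram_alt return_edges_def
    using fin valid_nth[OF v] by auto
  moreover have "diagram n Cs \<noteq> {}" unfolding diagram_alt return_edges_def using n by auto
  moreover have "\<forall>(a, b)\<in>diagram n Cs. a \<noteq> b"
  proof (rule ballI, rule case_prodI2, rule notI)
    fix e a b assume e: "e \<in> diagram n Cs" "e = (a, b)" and "a = b"
    show False using e(1)[unfolded e(2)]
    proof (cases rule: diagram_cases)
      case (level k)
      show ?thesis using level(2) \<open>a = b\<close>
        by (cases rule: level_cases) (auto simp: straight_def letter_edges_def crossing_def)
    next
      case return
      show ?thesis using return \<open>a = b\<close> by (cases rule: return_edges_cases) auto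
    qed
  qed
  moreover have "Domain (diagram n Cs) = Range (diagram n Cs)"
  proof -
    define P where "P = (\<lambda>k. (\<lambda>j. pt (real j) (real k) 0) ` {1..n})"
    define A where "A = (\<lambda>k. (\<lambda>s. pt (real_of_int \<bar>s\<bar> + 1/2) (real k + 1/2) (of_int (sgn s) / 2)) ` (Cs ! k))"
    define Q where "Q = (\<lambda>j. pt (real j) (real ?m + 1) 1) ` {1..n} \<union> (\<lambda>j. pt (real j) (- 1) 1) ` {1..n}"
    have f: "fst ` level n k (Cs ! k) {} = P k \<union> A k" "snd ` level n k (Cs ! k) {} = P (Suc k) \<union> A k" if "k <
      ?m" for k
      using level_Domain_Range[OF valid_nth[OF v that]] unfolding P_def A_def by (auto simp: add.commute)
    have r: "fst ` return_edges n ?m = P ?m \<union> Q" "snd ` return_edges n ?m = P 0 \<union> Q"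
      unfolding return_edges_def P_def Q_def by (force simp: image_UN)+
    have P: "(\<Union>k<?m. P k) \<union> P ?m = P 0 \<union> (\<Union>k<?m. P (Suc k))"
    proof -
      have "(\<Union>k<?m. P k) \<union> P ?m = (\<Union>k\<in>{..<Suc ?m}. P k)" by (auto simp: less_Suc_eq)
      also have "\<dots> = P 0 \<union> (\<Union>k<?m. P (Suc k))" by (simp only: lessThan_Suc_eq_insert_0) auto
      finally show ?thesis .
    qed
    have D: "fst ` diagram n Cs = (\<Union>k<?m. P k) \<union> (\<Union>k<?m. A k) \<union> P ?m \<union> Q"
      unfolding diagram_alt image_Un image_UN r using f by auto
    have R: "snd ` diagram n Cs = (\<Union>k<?m. P (Suc k)) \<union> (\<Union>k<?m. A k) \<union> P 0 \<union> Q"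
      unfolding diagram_alt image_Un image_UN r using f by auto
    have "X \<union> M = N \<union> Y \<Longrightarrow> X \<union> Z \<union> M \<union> W = Y \<union> Z \<union> N \<union> W" for X Y Z W M N :: "(real^3) set"
      by blast
    from this[OF P] show ?thesis unfolding Domain_fst Range_snd D R .
  qed
  moreover have "single_valued (diagram n Cs)" "single_valued ((diagram n Cs)\<inverse>)"
    using inj_onD[OF inj_on_diagram_ends(1)[OF v]] inj_onD[OF inj_on_diagram_ends(2)[OF v]]
    unfolding single_valued_def converse_iff by (metis fst_conv snd_conv prod.inject)+
  ultimately show ?thesis unfolding is_link_iff using proper_crossings_diagram[OF v] by blast
qed

section \<open>Explicit moves in a block\<close>

text \<open>
  The conditions of a clean triangle, split in such a way that for points with numerical coordinates
  each of them is a statement of linear arithmetic.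
\<close>

definition bent :: "real^3 \<Rightarrow> real^3 \<Rightarrow> real^3 \<Rightarrow> bool" where
  "bent a c b \<longleftrightarrow> a \<noteq> b \<and> c \<noteq> a \<and> c \<noteq> b \<and> closed_segment a c \<inter> closed_segment c b \<subseteq> {c}"

definition avoids :: "real^3 \<Rightarrow> real^3 \<Rightarrow> real^3 \<Rightarrow> (real^3) \<times> (real^3) \<Rightarrow> bool" where
  "avoids a b c e \<longleftrightarrow> convex hull {a, b, c} \<inter> closed_segment (fst e) (snd e) \<subseteq> {a, b}"

lemma tangle_move:
  assumes T: "T = insert (a, b) R" "T' = insert (a, c) (insert (c, b) R)"
    and bent: "bent a c b" and avoids: "\<forall>e\<in>R. avoids a b c e"
    and F: "F \<subseteq> Domain T \<union> Range T" and K: "convex hull {a, b, c} \<subseteq> K"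
  shows "tangle_eq K F T T'"
proof -
  have hull: "convex hull {a, b, c} \<inter> points R \<subseteq> {a, b}"
    using avoids unfolding avoids_def points_def by fastforce
  have "F \<subseteq> {a, b} \<union> points R"
    using F Domain_in_points[of _ R] Range_in_points[of _ R] unfolding T by blast
  then have "clean_triangle a b c (points R \<union> F)"
    using bent hull unfolding bent_def clean_triangle_def by blast
  then show ?thesis unfolding T using K by (rule tangle_insert)
qed

text \<open>
  A common point is a convex combination of the vertices and also of the end points of the segment;
  the premise is a linear problem in the coefficients. It asks for a contradiction unless the point is
  \<open>a\<close> or \<open>b\<close>.
\<close>

lemma avoids_pt:
  assumes "\<And>u v w s. \<lbrakk>0 \<le> u; 0 \<le> v; 0 \<le> w; u + v + w = 1; 0 \<le> s; s \<le> 1;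
     u * ax + v * bx + w * cx = dx + s * (ex - dx); u * ay + v * by' + w * cy = dy + s * (ey - dy);
     u * az + v * bz + w * cz = dz + s * (ez - dz); u < 1; v < 1\<rbrakk> \<Longrightarrow> False"
  shows "avoids (pt ax ay az) (pt bx by' bz) (pt cx cy cz) (pt dx dy dz, pt ex ey ez)"
  unfolding avoids_def fst_conv snd_conv
proof
  fix p assume p: "p \<in> convex hull {pt ax ay az, pt bx by' bz, pt cx cy cz} \<inter> closed_segment (pt dx dy dz) (pt
    ex ey ez)"
  obtain u v w where u: "0 \<le> u" "0 \<le> v" "0 \<le> w" "u + v + w = 1"
    "p = u *\<^sub>R pt ax ay az + v *\<^sub>R pt bx by' bz + w *\<^sub>R pt cx cy cz"
    using IntD1[OF p] unfolding convex_hull_3 by blast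
  obtain s where s: "0 \<le> s" "s \<le> 1" "p = pt (dx + s * (ex - dx)) (dy + s * (ey - dy)) (dz + s * (ez - dz))"
    using IntD2[OF p] unfolding mem_segment_pt by blast
  have p': "p = pt (u * ax + v * bx + w * cx) (u * ay + v * by' + w * cy) (u * az + v * bz + w * cz)"
    unfolding u(5) pt_combo using pt_combo[of 1 "u * ax + v * bx" "u * ay + v * by'" "u * az + v * bz" w cx cy cz]
    by simp
  have "u = 1 \<or> v = 1"
  proof (rule ccontr)
    assume "\<not> (u = 1 \<or> v = 1)"
    then have "u < 1" "v < 1" using u by linarith+
    then show False using assms[OF u(1-4) s(1,2)] p' s(3) by simp
  qed
  then have "u = 1 \<and> v = 0 \<and> w = 0 \<or> v = 1 \<and> u = 0 \<and> w = 0" using u by linarith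
  then show "p \<in> {pt ax ay az, pt bx by' bz}" using u(5) by auto
qed

lemma bent_pt:
  assumes ne: "pt ax ay az \<noteq> pt bx by' bz" "pt cx cy cz \<noteq> pt ax ay az" "pt cx cy cz \<noteq> pt bx by' bz"
    and "\<And>s t. \<lbrakk>0 \<le> s; s < 1; 0 \<le> t; t \<le> 1; ax + s * (cx - ax) = cx + t * (bx - cx);
      ay + s * (cy - ay) = cy + t * (by' - cy); az + s * (cz - az) = cz + t * (bz - cz)\<rbrakk> \<Longrightarrow> False"
  shows "bent (pt ax ay az) (pt cx cy cz) (pt bx by' bz)"
  unfolding bent_def
proof (intro conjI ne subsetI)
  fix p assume "p \<in> closed_segment (pt ax ay az) (pt cx cy cz) \<inter> closed_segment (pt cx cy cz) (pt bx by' bz)"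
  then obtain s t where st: "0 \<le> s" "s \<le> 1" "p = pt (ax + s * (cx - ax)) (ay + s * (cy - ay)) (az + s * (cz - az))"
    "0 \<le> t" "t \<le> 1" "p = pt (cx + t * (bx - cx)) (cy + t * (by' - cy)) (cz + t * (bz - cz))"
    unfolding mem_segment_pt Int_iff by blast
  have "\<not> s < 1" using assms(4)[OF st(1) _ st(4,5)] st(3,6) by auto
  then have "s = 1" using st by simp
  then show "p \<in> {pt cx cy cz}" using st by simp
qed

text \<open>
  The bound \<open>3/4\<close> leaves room to lift strands above the crossings (of height \<open>1/2\<close>) while staying below
  the return edges (at height \<open>1\<close>).
\<close>

definition block :: "real \<Rightarrow> real \<Rightarrow> real \<Rightarrow> real \<Rightarrow> (real^3) set" where
  "block x x' y y' = {p. x \<le> p $ 1 \<and> p $ 1 \<le> x' \<and> y \<le> p $ 2 \<and> p $ 2 \<le> y' \<and> \<bar>p $ 3\<bar> \<le> 3/4}"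

lemma convex_block: "convex (block x x' y y')"
proof -
  have "block x x' y y' = {p. x \<le> p $ 1} \<inter> {p. p $ 1 \<le> x'} \<inter> {p. y \<le> p $ 2} \<inter> {p. p $ 2 \<le> y'} \<inter>
     {p. p $ 3 \<le> 3/4} \<inter> {p. - 3/4 \<le> p $ 3}"
    unfolding block_def by auto
  moreover have "convex {p :: real^3. p $ i \<le> r}" "convex {p :: real^3. r \<le> p $ i}" for i r
    using convex_halfspace_le[of "axis i 1 :: real^3" r] convex_halfspace_ge[of r "axis i 1 :: real^3"]
    by (simp_all add: inner_axis' inner_real_def)
  ultimately show ?thesis by (simp only: convex_Int)
qed

lemma pt_in_block: "pt a b c \<in> block x x' y y' \<longleftrightarrow> x \<le> a \<and> a \<le> x' \<and> y \<le> b \<and> b \<le> y' \<and> \<bar>c\<bar> \<le> 3/4"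
  by (simp add: block_def)

fun arc :: "(real^3) list \<Rightarrow> edges" where
  "arc (a # b # ps) = insert (a, b) (arc (b # ps))"
| "arc ps = {}"

lemma block_move:
  assumes T: "T = insert (a, b) R" "T' = insert (a, c) (insert (c, b) R)"
    and F: "F \<subseteq> Domain T \<union> Range T" and K: "a \<in> block x x' y y'" "b \<in> block x x' y y'" "c \<in> block x x' y y'"
    and "bent a c b" "\<forall>e\<in>R. avoids a b c e"
  shows "tangle_eq (block x x' y y') F T T'" "tangle_eq (block x x' y y') F T' T"
proof -
  have "convex hull {a, b, c} \<subseteq> block x x' y y'" using K convex_block by (intro hull_minimal) auto
  with assms show "tangle_eq (block x x' y y') F T T'" by (intro tangle_move)
  then show "tangle_eq (block x x' y y') F T' T" by (rule tangle_eq_sym)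
qed

lemmas block_add = block_move(1) and block_del = block_move(2)

text \<open>
  Except for the apex, all interior vertices of the overcrossing strand are removed, and the other
  strand is straightened; then the apex can be moved up, and the vertices are put back one level
  higher.
\<close>

lemma slide_crossing:
  "tangle_eq (block 0 1 0 2) {pt 0 0 0, pt 1 0 0, pt 0 2 0, pt 1 2 0}
    (crossing 0 0 (1/2) \<union> {straight 0 1, straight 1 1})
    ({straight 0 0, straight 1 0} \<union> crossing 0 1 (1/2))"
  (is "tangle_eq ?K ?F ?T ?T'")
proof -
  let ?A0 = "pt 0 0 0" and ?B0 = "pt 1 0 0" and ?A1 = "pt 0 1 0" and ?B1 = "pt 1 1 0"
    and ?A2 = "pt 0 2 0" and ?B2 = "pt 1 2 0" and ?P = "pt (1/2) (1/2) (1/2)"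
    and ?Q = "pt (1/2) (3/2) (1/2)"
  let ?S0 = "arc [?A0, ?P, ?B1, ?B2] \<union> arc [?B0, ?A1, ?A2]"
    and ?S1 = "arc [?A0, ?P, ?B2] \<union> arc [?B0, ?A1, ?A2]"
    and ?S2 = "arc [?A0, ?P, ?B2] \<union> arc [?B0, ?A2]"
    and ?S3 = "arc [?A0, ?P, ?Q, ?B2] \<union> arc [?B0, ?A2]"
    and ?S4 = "arc [?A0, ?Q, ?B2] \<union> arc [?B0, ?A2]"
    and ?S5 = "arc [?A0, ?A1, ?Q, ?B2] \<union> arc [?B0, ?A2]"
  have 0: "?T = ?S0"
    by (simp add: crossing_def straight_def insert_commute)
  have 1: "tangle_eq ?K ?F ?S0 ?S1"
    by (rule block_del[where a = ?P and b = ?B2 and c = ?B1 and R = "arc [?B0, ?A1, ?A2] \<union> arc [?A0, ?P]"];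
      (rule bent_pt | (simp only: arc.simps ball_Un ball_simps, intro conjI TrueI avoids_pt)
        | simp add: pt_in_block insert_commute straight_def crossing_def)?; (argo | linarith | simp))
  have 2: "tangle_eq ?K ?F ?S1 ?S2"
    by (rule block_del[where a = ?B0 and b = ?A2 and c = ?A1 and R = "arc [?A0, ?P, ?B2]"];
      (rule bent_pt | (simp only: arc.simps ball_Un ball_simps, intro conjI TrueI avoids_pt)
        | simp add: pt_in_block insert_commute straight_def crossing_def)?; (argo | linarith | simp))
  have 3: "tangle_eq ?K ?F ?S2 ?S3"
    by (rule block_add[where a = ?P and b = ?B2 and c = ?Q and R = "arc [?B0, ?A2] \<union> arc [?A0, ?P]"];
      (rule bent_pt | (simp only: arc.simps ball_Un ball_simps, intro conjI TrueI avoids_pt)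
        | simp add: pt_in_block insert_commute straight_def crossing_def)?; (argo | linarith | simp))
  have 4: "tangle_eq ?K ?F ?S3 ?S4"
    by (rule block_del[where a = ?A0 and b = ?Q and c = ?P and R = "arc [?B0, ?A2] \<union> arc [?Q, ?B2]"];
      (rule bent_pt | (simp only: arc.simps ball_Un ball_simps, intro conjI TrueI avoids_pt)
        | simp add: pt_in_block insert_commute straight_def crossing_def)?; (argo | linarith | simp))
  have 5: "tangle_eq ?K ?F ?S4 ?S5"
    by (rule block_add[where a = ?A0 and b = ?Q and c = ?A1 and R = "arc [?B0, ?A2] \<union> arc [?Q, ?B2]"];
      (rule bent_pt | (simp only: arc.simps ball_Un ball_simps, intro conjI TrueI avoids_pt)
        | simp add: pt_in_block insert_commute straight_def crossing_def)?; (argo | linarith | simp))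
  have 6: "tangle_eq ?K ?F ?S5 ?T'"
    by (rule block_add[where a = ?B0 and b = ?A2 and c = ?B1 and R = "arc [?A0, ?A1, ?Q, ?B2]"];
      (rule bent_pt | (simp only: arc.simps ball_Un ball_simps, intro conjI TrueI avoids_pt)
        | simp add: pt_in_block insert_commute straight_def crossing_def)?; (argo | linarith | simp))
  show ?thesis unfolding 0
    by (rule tangle_eq_trans[OF 1 tangle_eq_trans[OF 2 tangle_eq_trans[OF 3 tangle_eq_trans[OF 4
      tangle_eq_trans[OF 5 6]]]]])
qed

text \<open>
  The strand that starts on the left stays above the other one all the time, so both can be
  straightened. The two vertices in the plane of the endpoints have to go first, since they block the
  triangles.
\<close>

lemma cancel_crossings:
  "tangle_eq (block 0 1 0 2) {pt 0 0 0, pt 1 0 0, pt 0 2 0, pt 1 2 0}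
    (crossing 0 0 (1/2) \<union> crossing 0 1 (- 1/2))
    ({straight 0 0, straight 1 0} \<union> {straight 0 1, straight 1 1})"
  (is "tangle_eq ?K ?F ?T ?T'")
proof -
  let ?A0 = "pt 0 0 0" and ?B0 = "pt 1 0 0" and ?A1 = "pt 0 1 0" and ?B1 = "pt 1 1 0"
    and ?A2 = "pt 0 2 0" and ?B2 = "pt 1 2 0" and ?P = "pt (1/2) (1/2) (1/2)"
    and ?Q = "pt (1/2) (3/2) (- 1/2)"
  let ?S0 = "arc [?A0, ?P, ?B1, ?A2] \<union> arc [?B0, ?A1, ?Q, ?B2]"
    and ?S1 = "arc [?A0, ?P, ?A2] \<union> arc [?B0, ?A1, ?Q, ?B2]"
    and ?S2 = "arc [?A0, ?P, ?A2] \<union> arc [?B0, ?Q, ?B2]"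
    and ?S3 = "arc [?A0, ?P, ?A2] \<union> arc [?B0, ?B2]"
    and ?S4 = "arc [?A0, ?A2] \<union> arc [?B0, ?B2]"
    and ?S5 = "arc [?A0, ?A1, ?A2] \<union> arc [?B0, ?B2]"
  have 0: "?T = ?S0"
    by (simp add: crossing_def straight_def insert_commute)
  have 1: "tangle_eq ?K ?F ?S0 ?S1"
    by (rule block_del[where a = ?P and b = ?A2 and c = ?B1 and R = "arc [?B0, ?A1, ?Q, ?B2] \<union> arc [?A0, ?P]"];
      (rule bent_pt | (simp only: arc.simps ball_Un ball_simps, intro conjI TrueI avoids_pt)
        | simp add: pt_in_block insert_commute straight_def crossing_def)?; (argo | linarith | simp))
  have 2: "tangle_eq ?K ?F ?S1 ?S2"
    by (rule block_del[where a = ?B0 and b = ?Q and c = ?A1 and R = "arc [?A0, ?P, ?A2] \<union> arc [?Q, ?B2]"];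
      (rule bent_pt | (simp only: arc.simps ball_Un ball_simps, intro conjI TrueI avoids_pt)
        | simp add: pt_in_block insert_commute straight_def crossing_def)?; (argo | linarith | simp))
  have 3: "tangle_eq ?K ?F ?S2 ?S3"
    by (rule block_del[where a = ?B0 and b = ?B2 and c = ?Q and R = "arc [?A0, ?P, ?A2]"];
      (rule bent_pt | (simp only: arc.simps ball_Un ball_simps, intro conjI TrueI avoids_pt)
        | simp add: pt_in_block insert_commute straight_def crossing_def)?; (argo | linarith | simp))
  have 4: "tangle_eq ?K ?F ?S3 ?S4"
    by (rule block_del[where a = ?A0 and b = ?A2 and c = ?P and R = "arc [?B0, ?B2]"];
      (rule bent_pt | (simp only: arc.simps ball_Un ball_simps, intro conjI TrueI avoids_pt)
        | simp add: pt_in_block insert_commute straight_def crossing_def)?; (argo | linarith | simp))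
  have 5: "tangle_eq ?K ?F ?S4 ?S5"
    by (rule block_add[where a = ?A0 and b = ?A2 and c = ?A1 and R = "arc [?B0, ?B2]"];
      (rule bent_pt | (simp only: arc.simps ball_Un ball_simps, intro conjI TrueI avoids_pt)
        | simp add: pt_in_block insert_commute straight_def crossing_def)?; (argo | linarith | simp))
  have 6: "tangle_eq ?K ?F ?S5 ?T'"
    by (rule block_add[where a = ?B0 and b = ?B2 and c = ?B1 and R = "arc [?A0, ?A1, ?A2]"];
      (rule bent_pt | (simp only: arc.simps ball_Un ball_simps, intro conjI TrueI avoids_pt)
        | simp add: pt_in_block insert_commute straight_def crossing_def)?; (argo | linarith | simp))
  show ?thesis unfolding 0
    by (rule tangle_eq_trans[OF 1 tangle_eq_trans[OF 2 tangle_eq_trans[OF 3 tangle_eq_trans[OF 4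
      tangle_eq_trans[OF 5 6]]]]])
qed

text \<open>
  One half of the third Reidemeister move: the three strands lie in layers above each other, so that
  each of them can be straightened separately. The result is chosen to be symmetric under a half turn
  about the vertical axis through the centre of the block.
\<close>

lemma straighten_triple:
  "tangle_eq (block 0 2 0 3) {pt 0 0 0, pt 1 0 0, pt 2 0 0, pt 0 3 0, pt 1 3 0, pt 2 3 0}
    (crossing 0 0 (1/2) \<union> {straight 2 0} \<union> crossing 1 1 (1/2) \<union> {straight 0 1} \<union> crossing 0 2 (1/2) \<union> {straight 2 2})
    (arc [pt 0 0 0, pt 1 (3/2) (3/4), pt 2 3 0] \<union> arc [pt 1 0 0, pt 1 (3/2) (1/4), pt 1 3 0] \<union> arc [pt 2 0 0, pt
      0 3 0])"
  (is "tangle_eq ?K ?F ?T ?T'")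
proof -
  let ?A0 = "pt 0 0 0" and ?B0 = "pt 1 0 0" and ?C0 = "pt 2 0 0" and ?A1 = "pt 0 1 0"
    and ?B1 = "pt 1 1 0" and ?C1 = "pt 2 1 0" and ?A2 = "pt 0 2 0" and ?B2 = "pt 1 2 0"
    and ?C2 = "pt 2 2 0" and ?A3 = "pt 0 3 0" and ?B3 = "pt 1 3 0" and ?C3 = "pt 2 3 0"
    and ?P1 = "pt (1/2) (1/2) (1/2)" and ?P2 = "pt (3/2) (3/2) (1/2)" and ?P3 = "pt (1/2) (5/2) (1/2)"
    and ?H = "pt 1 (3/2) (3/4)" and ?M = "pt 1 (3/2) (1/4)"
  let ?S0 = "arc [?A0, ?P1, ?B1, ?P2, ?C2, ?C3] \<union> arc [?B0, ?A1, ?A2, ?P3, ?B3] \<union> arc [?C0, ?C1, ?B2, ?A3]"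
    and ?S1 = "arc [?A0, ?P1, ?P2, ?C2, ?C3] \<union> arc [?B0, ?A1, ?A2, ?P3, ?B3] \<union> arc [?C0, ?C1, ?B2, ?A3]"
    and ?S2 = "arc [?A0, ?P2, ?C2, ?C3] \<union> arc [?B0, ?A1, ?A2, ?P3, ?B3] \<union> arc [?C0, ?C1, ?B2, ?A3]"
    and ?S3 = "arc [?A0, ?P2, ?C3] \<union> arc [?B0, ?A1, ?A2, ?P3, ?B3] \<union> arc [?C0, ?C1, ?B2, ?A3]"
    and ?S4 = "arc [?A0, ?P2, ?C3] \<union> arc [?B0, ?A1, ?A2, ?P3, ?B3] \<union> arc [?C0, ?B2, ?A3]"
    and ?S5 = "arc [?A0, ?P2, ?C3] \<union> arc [?B0, ?A1, ?A2, ?P3, ?B3] \<union> arc [?C0, ?A3]"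
    and ?S6 = "arc [?A0, ?P2, ?C3] \<union> arc [?B0, ?A1, ?P3, ?B3] \<union> arc [?C0, ?A3]"
    and ?S7 = "arc [?A0, ?P2, ?C3] \<union> arc [?B0, ?P3, ?B3] \<union> arc [?C0, ?A3]"
    and ?S8 = "arc [?A0, ?P2, ?H, ?C3] \<union> arc [?B0, ?P3, ?B3] \<union> arc [?C0, ?A3]"
    and ?S9 = "arc [?A0, ?H, ?C3] \<union> arc [?B0, ?P3, ?B3] \<union> arc [?C0, ?A3]"
    and ?S10 = "arc [?A0, ?H, ?C3] \<union> arc [?B0, ?P3, ?M, ?B3] \<union> arc [?C0, ?A3]"
  have 0: "?T = ?S0"
    by (simp add: crossing_def straight_def insert_commute)
  have 1: "tangle_eq ?K ?F ?S0 ?S1"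
    by (rule block_del[where a = ?P1 and b = ?P2 and c = ?B1 and R = "arc [?B0, ?A1, ?A2, ?P3, ?B3] \<union> arc [?C0,
      ?C1, ?B2, ?A3] \<union> arc [?A0, ?P1] \<union> arc [?P2, ?C2, ?C3]"];
      (rule bent_pt | (simp only: arc.simps ball_Un ball_simps, intro conjI TrueI avoids_pt)
        | simp add: pt_in_block insert_commute straight_def crossing_def)?; (argo | linarith | simp))
  have 2: "tangle_eq ?K ?F ?S1 ?S2"
    by (rule block_del[where a = ?A0 and b = ?P2 and c = ?P1 and R = "arc [?B0, ?A1, ?A2, ?P3, ?B3] \<union> arc [?C0,
      ?C1, ?B2, ?A3] \<union> arc [?P2, ?C2, ?C3]"];
      (rule bent_pt | (simp only: arc.simps ball_Un ball_simps, intro conjI TrueI avoids_pt)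
        | simp add: pt_in_block insert_commute straight_def crossing_def)?; (argo | linarith | simp))
  have 3: "tangle_eq ?K ?F ?S2 ?S3"
    by (rule block_del[where a = ?P2 and b = ?C3 and c = ?C2 and R = "arc [?B0, ?A1, ?A2, ?P3, ?B3] \<union> arc [?C0,
      ?C1, ?B2, ?A3] \<union> arc [?A0, ?P2]"];
      (rule bent_pt | (simp only: arc.simps ball_Un ball_simps, intro conjI TrueI avoids_pt)
        | simp add: pt_in_block insert_commute straight_def crossing_def)?; (argo | linarith | simp))
  have 4: "tangle_eq ?K ?F ?S3 ?S4"
    by (rule block_del[where a = ?C0 and b = ?B2 and c = ?C1 and R = "arc [?A0, ?P2, ?C3] \<union> arc [?B0, ?A1, ?A2,
      ?P3, ?B3] \<union> arc [?B2, ?A3]"];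
      (rule bent_pt | (simp only: arc.simps ball_Un ball_simps, intro conjI TrueI avoids_pt)
        | simp add: pt_in_block insert_commute straight_def crossing_def)?; (argo | linarith | simp))
  have 5: "tangle_eq ?K ?F ?S4 ?S5"
    by (rule block_del[where a = ?C0 and b = ?A3 and c = ?B2 and R = "arc [?A0, ?P2, ?C3] \<union> arc [?B0, ?A1, ?A2,
      ?P3, ?B3]"];
      (rule bent_pt | (simp only: arc.simps ball_Un ball_simps, intro conjI TrueI avoids_pt)
        | simp add: pt_in_block insert_commute straight_def crossing_def)?; (argo | linarith | simp))
  have 6: "tangle_eq ?K ?F ?S5 ?S6"
    by (rule block_del[where a = ?A1 and b = ?P3 and c = ?A2 and R = "arc [?A0, ?P2, ?C3] \<union> arc [?C0, ?A3] \<union> arc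
      [?B0, ?A1] \<union> arc [?P3, ?B3]"];
      (rule bent_pt | (simp only: arc.simps ball_Un ball_simps, intro conjI TrueI avoids_pt)
        | simp add: pt_in_block insert_commute straight_def crossing_def)?; (argo | linarith | simp))
  have 7: "tangle_eq ?K ?F ?S6 ?S7"
    by (rule block_del[where a = ?B0 and b = ?P3 and c = ?A1 and R = "arc [?A0, ?P2, ?C3] \<union> arc [?C0, ?A3] \<union> arc
      [?P3, ?B3]"];
      (rule bent_pt | (simp only: arc.simps ball_Un ball_simps, intro conjI TrueI avoids_pt)
        | simp add: pt_in_block insert_commute straight_def crossing_def)?; (argo | linarith | simp))
  \<comment> \<open>The strands are as straight as possible; their middle vertices are moved to the axis of symmetry.\<close>
  have 8: "tangle_eq ?K ?F ?S7 ?S8"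
    by (rule block_add[where a = ?P2 and b = ?C3 and c = ?H and R = "arc [?B0, ?P3, ?B3] \<union> arc [?C0, ?A3] \<union> arc
      [?A0, ?P2]"];
      (rule bent_pt | (simp only: arc.simps ball_Un ball_simps, intro conjI TrueI avoids_pt)
        | simp add: pt_in_block insert_commute straight_def crossing_def)?; (argo | linarith | simp))
  have 9: "tangle_eq ?K ?F ?S8 ?S9"
    by (rule block_del[where a = ?A0 and b = ?H and c = ?P2 and R = "arc [?B0, ?P3, ?B3] \<union> arc [?C0, ?A3] \<union> arc
      [?H, ?C3]"];
      (rule bent_pt | (simp only: arc.simps ball_Un ball_simps, intro conjI TrueI avoids_pt)
        | simp add: pt_in_block insert_commute straight_def crossing_def)?; (argo | linarith | simp))
  have 10: "tangle_eq ?K ?F ?S9 ?S10"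
    by (rule block_add[where a = ?P3 and b = ?B3 and c = ?M and R = "arc [?A0, ?H, ?C3] \<union> arc [?C0, ?A3] \<union> arc
      [?B0, ?P3]"];
      (rule bent_pt | (simp only: arc.simps ball_Un ball_simps, intro conjI TrueI avoids_pt)
        | simp add: pt_in_block insert_commute straight_def crossing_def)?; (argo | linarith | simp))
  have 11: "tangle_eq ?K ?F ?S10 ?T'"
    by (rule block_del[where a = ?B0 and b = ?M and c = ?P3 and R = "arc [?A0, ?H, ?C3] \<union> arc [?C0, ?A3] \<union> arc
      [?M, ?B3]"];
      (rule bent_pt | (simp only: arc.simps ball_Un ball_simps, intro conjI TrueI avoids_pt)
        | simp add: pt_in_block insert_commute straight_def crossing_def)?; (argo | linarith | simp))
  show ?thesis unfolding 0
    by (rule tangle_eq_trans[OF 1 tangle_eq_trans[OF 2 tangle_eq_trans[OF 3 tangle_eq_trans[OF 4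
      tangle_eq_trans[OF 5 tangle_eq_trans[OF 6 tangle_eq_trans[OF 7 tangle_eq_trans[OF 8 tangle_eq_trans[OF 9
        tangle_eq_trans[OF 10 11]]]]]]]]]])
qed

section \<open>Isotopies of closed diagrams\<close>

lemma tangle_eq_mono:
  assumes "tangle_eq K F T T'" "K \<subseteq> K'" shows "tangle_eq K' F T T'"
proof -
  have *: "tangle_step K' F S S'" if "tangle_step K F S S'" for S S'
    using that unfolding tangle_step_def
    by (elim exE conjE) (intro exI conjI, assumption+, rule order_trans[OF _ assms(2)])
  show ?thesis using assms(1) unfolding tangle_eq_def
    by (induction rule: equivclp_induct) (auto intro: equivclp_into_equivclp dest: *)
qed

definition shift :: "real \<Rightarrow> real \<Rightarrow> real^3 \<Rightarrow> real^3" where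
  "shift x y p = pt x y 0 + p"

lemma pt_add: "pt a b c + pt x y z = pt (a + x) (b + y) (c + z)"
  using pt_combo[of 1 a b c 1 x y z] by simp

lemma shift_pt [simp]: "shift x y (pt a b c) = pt (x + a) (y + b) c"
  by (simp add: shift_def pt_add)

lemma shift_nth [simp]: "shift x y p $ 1 = x + p $ 1" "shift x y p $ 2 = y + p $ 2" "shift x y p $ 3 = p $ 3"
  by (simp_all add: shift_def)

lemma tangle_eq_shift:
  assumes "tangle_eq K F T T'"
  shows "tangle_eq (shift x y ` K) (shift x y ` F) (map_prod (shift x y) (shift x y) ` T) (map_prod (shift x y)
    (shift x y) ` T')"
proof -
  have "shift x y = (\<lambda>p. pt x y 0 + id p)" by (auto simp: shift_def)
  with tangle_eq_affine[OF assms, of id "shift x y"] show ?thesis by (simp add: linear_id)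
qed

lemma shift_straight: "map_prod (shift x y) (shift x y) (straight a b) = straight (x + a) (y + b)"
  by (simp add: straight_def algebra_simps)

lemma shift_crossing: "map_prod (shift x y) (shift x y) ` crossing a b h = crossing (x + a) (y + b) h"
  by (simp add: crossing_def algebra_simps)

lemma shift_block: "shift x y ` block 0 a 0 b \<subseteq> block x (x + a) y (y + b)"
  by (auto simp: block_def)

lemma tangle_eq_block_shift:
  assumes "tangle_eq (block 0 a 0 b) F T T'"
  shows "tangle_eq (block x (x + a) y (y + b)) (shift x y ` F)
    (map_prod (shift x y) (shift x y) ` T) (map_prod (shift x y) (shift x y) ` T')"
  using tangle_eq_mono[OF tangle_eq_shift[OF assms] shift_block] .

definition mirror :: "real^3 \<Rightarrow> real^3" where
  "mirror p = pt (p $ 1) (p $ 2) (- p $ 3)"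

text \<open>
  A half turn about the vertical axis through the centre of the block; it preserves over- and
  undercrossings.
\<close>

definition rotate_block :: "real \<Rightarrow> real \<Rightarrow> real^3 \<Rightarrow> real^3" where
  "rotate_block a b p = pt (a - p $ 1) (b - p $ 2) (p $ 3)"

lemma mirror_pt [simp]: "mirror (pt a b c) = pt a b (- c)"
  and rotate_pt [simp]: "rotate_block x y (pt a b c) = pt (x - a) (y - b) c"
  by (simp_all add: mirror_def rotate_block_def)

lemma tangle_eq_mirror:
  assumes "tangle_eq (block 0 a 0 b) F T T'"
  shows "tangle_eq (block 0 a 0 b) (mirror ` F) (map_prod mirror mirror ` T) (map_prod mirror mirror ` T')"
proof (rule tangle_eq_mono)
  have "linear mirror" unfolding mirror_def
    by (intro linearI) (simp_all add: vec_eq_iff forall_3)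
  moreover have "inj mirror" by (rule inj_on_inverseI[of _ mirror]) (simp add: mirror_def vec_eq_iff forall_3)
  moreover have "mirror = (\<lambda>p. 0 + mirror p)" by simp
  ultimately show "tangle_eq (mirror ` block 0 a 0 b) (mirror ` F) (map_prod mirror mirror ` T) (map_prod mirror
    mirror ` T')"
    using tangle_eq_affine[OF assms, of mirror mirror 0] by blast
  show "mirror ` block 0 a 0 b \<subseteq> block 0 a 0 b" by (auto simp: block_def mirror_def)
qed

lemma tangle_eq_rotate:
  assumes "tangle_eq (block 0 a 0 b) F T T'"
  shows "tangle_eq (block 0 a 0 b) (rotate_block a b ` F) ((map_prod (rotate_block a b) (rotate_block a b) ` T)\<inverse>)
    ((map_prod (rotate_block a b) (rotate_block a b) ` T')\<inverse>)"
proof (rule tangle_eq_converse, rule tangle_eq_mono)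
  let ?f = "\<lambda>p :: real^3. pt (- p $ 1) (- p $ 2) (p $ 3)"
  have "linear ?f" by (intro linearI) (simp_all add: vec_eq_iff forall_3)
  moreover have "inj ?f" by (rule inj_on_inverseI[of _ ?f]) (simp add: vec_eq_iff forall_3)
  moreover have "rotate_block a b = (\<lambda>p. pt a b 0 + ?f p)"
    by (auto simp: rotate_block_def vec_eq_iff forall_3)
  ultimately show "tangle_eq (rotate_block a b ` block 0 a 0 b) (rotate_block a b ` F)
     (map_prod (rotate_block a b) (rotate_block a b) ` T) (map_prod (rotate_block a b) (rotate_block a b) ` T')"
    using tangle_eq_affine[OF assms, of ?f "rotate_block a b" "pt a b 0"] by blast
  show "rotate_block a b ` block 0 a 0 b \<subseteq> block 0 a 0 b" by (auto simp: block_def rotate_block_def)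
qed

text \<open>
  The half turn, followed by a change of direction, turns \<open>\<sigma>\<^sub>1 \<sigma>\<^sub>2 \<sigma>\<^sub>1\<close> into \<open>\<sigma>\<^sub>2 \<sigma>\<^sub>1 \<sigma>\<^sub>2\<close> and fixes the
  straightened tangle, so both sides are equivalent to it.
\<close>

lemma braid_relation_triple:
  "tangle_eq (block 0 2 0 3) {pt 0 0 0, pt 1 0 0, pt 2 0 0, pt 0 3 0, pt 1 3 0, pt 2 3 0}
     (crossing 0 0 (1/2) \<union> {straight 2 0} \<union> crossing 1 1 (1/2) \<union> {straight 0 1} \<union> crossing 0 2 (1/2) \<union> {straight 2 2})
     (crossing 1 0 (1/2) \<union> {straight 0 0} \<union> crossing 0 1 (1/2) \<union> {straight 2 1} \<union> crossing 1 2 (1/2) \<union> {straight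
       0 2})"
  (is "tangle_eq ?K ?F ?T ?T'")
proof -
  let ?N = "arc [pt 0 0 0, pt 1 (3/2) (3/4), pt 2 3 0] \<union> arc [pt 1 0 0, pt 1 (3/2) (1/4), pt 1 3 0] \<union> arc [pt 2
    0 0, pt 0 3 0]"
  let ?r = "map_prod (rotate_block 2 3) (rotate_block 2 3)"
  have F: "rotate_block 2 3 ` ?F = ?F" by (simp add: insert_commute)
  have T: "(?r ` ?T)\<inverse> = ?T'"
    by (simp add: crossing_def straight_def image_Un converse_insert insert_commute)
  have N: "(?r ` ?N)\<inverse> = ?N"
    by (simp add: converse_insert insert_commute)
  have "tangle_eq ?K ?F ?T' ?N"
    using tangle_eq_rotate[OF straighten_triple] unfolding F T N .
  then show ?thesis using tangle_eq_trans[OF straighten_triple] tangle_eq_sym by blast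
qed

definition fill_level :: "int set \<Rightarrow> nat \<Rightarrow> int set \<Rightarrow> edges" where
  "fill_level B k S = (\<Union>s\<in>S. letter_edges k s) \<union> (\<lambda>j. straight (real_of_int j) (real k)) ` (B - occupied S)"

text \<open>
  The tangles that fit into a hole: levels with crossings among the strands in \<open>B\<close> alone.
\<close>

fun fill :: "int set \<Rightarrow> nat \<Rightarrow> int set list \<Rightarrow> edges" where
  "fill B k [] = {}"
| "fill B k (S # Ss) = fill_level B k S \<union> fill B (Suc k) Ss"

fun levels :: "nat \<Rightarrow> nat \<Rightarrow> (int set \<times> int set) list \<Rightarrow> edges" where
  "levels n k [] = {}"
| "levels n k (CB # D) = level n k (fst CB) (snd CB) \<union> levels n (Suc k) D"

lemma levels_append: "levels n k (D @ D') = levels n k D \<union> levels n (k + length D) D'"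
  by (induction D arbitrary: k) (auto simp: Un_assoc)

lemma levels_UN: "levels n k D = (\<Union>l<length D. level n (k + l) (fst (D ! l)) (snd (D ! l)))"
proof (induction D arbitrary: k)
  case (Cons CB D)
  have "{..<length (CB # D)} = insert 0 (Suc ` {..<length D})" by (simp add: lessThan_Suc_eq_insert_0)
  then show ?case by (simp add: Cons)
qed simp

lemma frame_levels: "frame n D = levels n 0 D \<union> return_edges n (length D)"
  by (simp add: frame_def levels_UN)

lemma level_split:
  assumes occ: "occupied S \<subseteq> B" "occupied C \<inter> B = {}" and B: "B \<subseteq> {1..int n}"
  shows "level n k (C \<union> S) {} = level n k C B \<union> fill_level B k S"
proof -
  have "{straight (real j) (real k) |j. j \<in> {1..n} \<and> int j \<notin> occupied (C \<union> S) \<union> {}} =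
    {straight (real j) (real k) |j. j \<in> {1..n} \<and> int j \<notin> occupied C \<union> B} \<union>
    (\<lambda>j. straight (real_of_int j) (real k)) ` (B - occupied S)" (is "?X = ?Y \<union> ?Z")
  proof (intro equalityI subsetI)
    fix e assume "e \<in> ?X"
    then obtain j where j: "j \<in> {1..n}" "int j \<notin> occupied C" "int j \<notin> occupied S" "e = straight (real j) (real k)"
      by (auto simp: occupied_def)
    show "e \<in> ?Y \<union> ?Z"
    proof (cases "int j \<in> B")
      case True
      have "e = straight (real_of_int (int j)) (real k)" using j by simp
      then show ?thesis using True j by blast
    next
      case False
      then show ?thesis using j by blast
    qed
  next
    fix e assume "e \<in> ?Y \<union> ?Z"
    then show "e \<in> ?X"
    proof
      assume "e \<in> ?Y"
      then show ?thesis using occ by (auto simp: occupied_def)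
    next
      assume "e \<in> ?Z"
      then obtain j where j: "j \<in> B" "j \<notin> occupied S" "e = straight (real_of_int j) (real k)" by blast
      then have "1 \<le> j" "j \<le> int n" "j \<notin> occupied C" using B occ by auto
      then have "nat j \<in> {1..n}" "int (nat j) \<notin> occupied (C \<union> S)" "e = straight (real (nat j)) (real k)"
        using j by (auto simp: occupied_def)
      then show ?thesis by blast
    qed
  qed
  then show ?thesis unfolding level_def fill_level_def by (simp only: Un_ac UN_Un)
qed

lemma levels_fill:
  assumes "list_all2 (\<lambda>C S. occupied S \<subseteq> B \<and> occupied C \<inter> B = {}) Cs Ss" and B: "B \<subseteq> {1..int n}"
  shows "levels n k (map2 (\<lambda>C S. (C \<union> S, {})) Cs Ss) = levels n k (map (\<lambda>C. (C, B)) Cs) \<union> fill B k Ss"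
  using assms(1)
proof (induction Cs Ss arbitrary: k rule: list_all2_induct)
  case (Cons C Cs S Ss)
  then show ?case using level_split[OF _ _ B, of S C k] by auto
qed simp

lemma diagram_fill:
  assumes "list_all2 (\<lambda>C S. occupied S \<subseteq> B \<and> occupied C \<inter> B = {}) Cs Ss" and B: "B \<subseteq> {1..int n}"
  shows "diagram n (u @ map2 (\<union>) Cs Ss @ v) =
    frame n (map (\<lambda>C. (C, {})) u @ map (\<lambda>C. (C, B)) Cs @ map (\<lambda>C. (C, {})) v) \<union> fill B (length u) Ss"
proof -
  have len: "length Cs = length Ss" using assms(1) by (rule list_all2_lengthD)
  have m: "map (\<lambda>C. (C, {})) (map2 (\<union>) Cs Ss) = map2 (\<lambda>C S. (C \<union> S, {})) Cs Ss" by auto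
  show ?thesis
    unfolding diagram_def frame_levels map_append m levels_append levels_fill[OF assms]
    by (simp add: len Un_ac)
qed

lemma valid_level_hole:
  assumes v: "valid_level n (C \<union> S) {}" and B: "occupied C \<inter> B = {}"
  shows "valid_level n C B"
proof -
  have "\<bar>s\<bar> \<notin> B \<and> \<bar>s\<bar> + 1 \<notin> B" if "s \<in> C" for s using B that unfolding occupied_def by blast
  then show ?thesis using v unfolding valid_level_def by simp
qed

text \<open>
  A local equivalence of tangles may be applied anywhere in a diagram; \<open>Cs\<close> lists the crossings of the
  affected levels that lie outside of the hole.
\<close>

lemma diagram_replace:
  assumes len: "length Cs = r" and
    fill: "list_all2 (\<lambda>C S. occupied S \<subseteq> {i..i + d} \<and> occupied C \<inter> {i..i + d} = {}) Cs Ss"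
      "list_all2 (\<lambda>C S. occupied S \<subseteq> {i..i + d} \<and> occupied C \<inter> {i..i + d} = {}) Cs Ss'"
    and B: "1 \<le> i" "i + d \<le> int n" "0 \<le> d"
    and valid: "valid_diagram n (u @ map2 (\<union>) Cs Ss @ v)"
    and eq: "tangle_eq (block (real_of_int i) (real_of_int (i + d)) (real (length u)) (real (length u + r))) F
       (fill {i..i + d} (length u) Ss) (fill {i..i + d} (length u) Ss')"
    and F: "\<And>j. j \<in> {i..i + d} \<Longrightarrow> pt (real_of_int j) (real (length u)) 0 \<in> F"
      "\<And>j. j \<in> {i..i + d} \<Longrightarrow> pt (real_of_int j) (real (length u + r)) 0 \<in> F"
  shows "isotopic (diagram n (u @ map2 (\<union>) Cs Ss @ v)) (diagram n (u @ map2 (\<union>) Cs Ss' @ v))"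
proof -
  let ?D = "map (\<lambda>C. (C, {})) u @ map (\<lambda>C. (C, {i..i + d})) Cs @ map (\<lambda>C. (C, {})) v"
  have lS: "length Ss = r" using list_all2_lengthD[OF fill(1)] len by simp
  have B': "{i..i + d} \<subseteq> {1..int n}" using B by auto
  have n: "n \<ge> 1" using B by auto
  note eq1 = diagram_fill[OF fill(1) B', of u v] and eq2 = diagram_fill[OF fill(2) B', of u v]
  have "valid_level n (fst x) (snd x)" if "x \<in> set ?D" for x
  proof -
    have vuv: "valid_level n C {}" if "C \<in> set u \<union> set v \<union> set (map2 (\<union>) Cs Ss)" for C
      using valid that unfolding valid_diagram_def by auto
    have "valid_level n C {i..i + d}" if C: "C \<in> set Cs" for C
    proof -
      obtain l where l: "l < r" "C = Cs ! l" using C len unfolding in_set_conv_nth by blast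
      have "map2 (\<union>) Cs Ss ! l = Cs ! l \<union> Ss ! l" "l < length (map2 (\<union>) Cs Ss)"
        using l(1) len lS by simp_all
      then have "Cs ! l \<union> Ss ! l \<in> set (map2 (\<union>) Cs Ss)" by (metis nth_mem)
      then show ?thesis using valid_level_hole[OF vuv, of "Cs ! l" "Ss ! l" "{i..i + d}"] l list_all2_nthD[OF
        fill(1), of l] len
        by simp
    qed
    then show ?thesis using that vuv by auto
  qed
  then have vf: "valid_frame n ?D" unfolding valid_frame_def by auto
  have "points (frame n ?D) \<inter> block (real_of_int i) (real_of_int (i + d)) (real (length u)) (real (length u + r)) \<subseteq> F"
  proof
    fix p assume p: "p \<in> points (frame n ?D) \<inter> block (real_of_int i) (real_of_int (i + d)) (real (length u))
      (real (length u + r))"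
    have "\<exists>j\<in>{i..i + d}. p = pt (real_of_int j) (real (length u)) 0 \<or> p = pt (real_of_int j) (real (length u + r)) 0"
    proof (rule frame_box[OF vf])
      show "{i..i + d} \<subseteq> snd (?D ! l)" if "length u \<le> l" "l < length u + r" for l
        using that len by (simp add: nth_append)
    qed (use p len B in \<open>auto simp: block_def\<close>)
    then show "p \<in> F" using F by blast
  qed
  from tangle_eq_isotopic[OF eq this] is_link_diagram[OF n valid]
  show ?thesis unfolding eq1 eq2 by blast
qed

lemma occupied_simps [simp]: "occupied {} = {}" "occupied {s} = {\<bar>s\<bar>, \<bar>s\<bar> + 1}"
  by (auto simp: occupied_def)

lemma valid_diagram_append [simp]: "valid_diagram n (u @ v) \<longleftrightarrow> valid_diagram n u \<and> valid_diagram n v"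
  and valid_diagram_Cons [simp]: "valid_diagram n (C # v) \<longleftrightarrow> valid_level n C {} \<and> valid_diagram n v"
  and valid_diagram_Nil [simp]: "valid_diagram n []"
  by (auto simp: valid_diagram_def)

lemma valid_level_empty [simp]: "valid_level n {} B"
  by (simp add: valid_level_def)

lemma far_from_letter:
  assumes "valid_level n (insert s C) {}" "s \<notin> C"
  shows "occupied C \<inter> {\<bar>s\<bar>..\<bar>s\<bar> + 1} = {}"
proof -
  have "2 \<le> \<bar>\<bar>s\<bar> - \<bar>s'\<bar>\<bar>" if "s' \<in> C" for s' using assms that unfolding valid_level_def by (metis insert_iff)
  then show ?thesis unfolding occupied_def by force
qed

lemma interval2: "{i..i + 1} = {i, i + 1 :: int}" and interval3: "{i..i + 2} = {i, i + 1, i + 2 :: int}"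
  by auto

lemma slide_tangle:
  assumes "s \<noteq> 0"
  shows "tangle_eq (block (real_of_int \<bar>s\<bar>) (real_of_int (\<bar>s\<bar> + 1)) (real k) (real (k + 2)))
     (shift (real_of_int \<bar>s\<bar>) (real k) ` {pt 0 0 0, pt 1 0 0, pt 0 2 0, pt 1 2 0})
     (fill {\<bar>s\<bar>..\<bar>s\<bar> + 1} k [{s}, {}]) (fill {\<bar>s\<bar>..\<bar>s\<bar> + 1} k [{}, {s}])"
proof -
  let ?F = "{pt 0 0 0, pt 1 0 0, pt 0 2 0, pt 1 2 0}"
  let ?x = "real_of_int \<bar>s\<bar>" and ?y = "real k" and ?h = "of_int (sgn s) / 2 :: real"
  have m: "mirror ` ?F = ?F" by simp
  have "tangle_eq (block 0 1 0 2) ?F (crossing 0 0 (- (1/2)) \<union> {straight 0 1, straight 1 1})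
     ({straight 0 0, straight 1 0} \<union> crossing 0 1 (- (1/2)))"
    using tangle_eq_mirror[OF slide_crossing] unfolding m image_Un
    by (simp add: crossing_def straight_def)
  then have "tangle_eq (block 0 1 0 2) ?F (crossing 0 0 ?h \<union> {straight 0 1, straight 1 1})
     ({straight 0 0, straight 1 0} \<union> crossing 0 1 ?h)"
    using slide_crossing assms by (cases "s > 0") auto
  from tangle_eq_block_shift[OF this, of ?x ?y]
  show ?thesis unfolding interval2
    by (simp add: image_Un shift_crossing shift_straight fill_level_def letter_edges_def add.commute
      Un_commute insert_commute)
qed

text \<open>
  With \<open>D\<close> empty this moves a level without crossings down past a crossing; with \<open>D\<close> a single letter it
  brings two far crossings to the same height.
\<close>

lemma slide_isotopic:
  assumes v: "valid_diagram n u" "valid_diagram n v" and s: "s \<notin> C" "s \<notin> D"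
    and C: "valid_level n (insert s C) {}" and D: "valid_level n (insert s D) {}"
  shows "isotopic (diagram n (u @ [insert s C, D] @ v)) (diagram n (u @ [C, insert s D] @ v))"
proof -
  have ss: "1 \<le> \<bar>s\<bar>" "\<bar>s\<bar> < int n" using C unfolding valid_level_def by auto
  have D': "valid_level n D {}" using D unfolding valid_level_def by auto
  note far = far_from_letter[OF C s(1)] far_from_letter[OF D s(2)]
  have "isotopic (diagram n (u @ map2 (\<union>) [C, D] [{s}, {}] @ v)) (diagram n (u @ map2 (\<union>) [C, D] [{}, {s}] @ v))"
  proof (rule diagram_replace[where i = "\<bar>s\<bar>" and d = 1 and r = 2 and
        F = "shift (real_of_int \<bar>s\<bar>) (real (length u)) ` {pt 0 0 0, pt 1 0 0, pt 0 2 0, pt 1 2 0}"])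
    show "tangle_eq (block (real_of_int \<bar>s\<bar>) (real_of_int (\<bar>s\<bar> + 1)) (real (length u)) (real (length u + 2)))
       (shift (real_of_int \<bar>s\<bar>) (real (length u)) ` {pt 0 0 0, pt 1 0 0, pt 0 2 0, pt 1 2 0})
       (fill {\<bar>s\<bar>..\<bar>s\<bar> + 1} (length u) [{s}, {}]) (fill {\<bar>s\<bar>..\<bar>s\<bar> + 1} (length u) [{}, {s}])"
      using slide_tangle ss by auto
  qed (use far ss v C D' in \<open>auto simp: interval2\<close>)
  then show ?thesis by simp
qed

lemma cancel_isotopic:
  assumes v: "valid_diagram n u" "valid_diagram n v" and s: "1 \<le> \<bar>s\<bar>" "\<bar>s\<bar> < int n"
  shows "isotopic (diagram n (u @ [{s}, {- s}] @ v)) (diagram n (u @ [{}, {}] @ v))"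
proof -
  let ?F = "{pt 0 0 0, pt 1 0 0, pt 0 2 0, pt 1 2 0}"
  let ?x = "real_of_int \<bar>s\<bar>" and ?y = "real (length u)" and ?h = "of_int (sgn s) / 2 :: real"
  have m: "mirror ` ?F = ?F" by simp
  have "tangle_eq (block 0 1 0 2) ?F (crossing 0 0 (- (1/2)) \<union> crossing 0 1 (1/2))
     ({straight 0 0, straight 1 0} \<union> {straight 0 1, straight 1 1})"
    using tangle_eq_mirror[OF cancel_crossings] unfolding m image_Un
    by (simp add: crossing_def straight_def)
  then have "tangle_eq (block 0 1 0 2) ?F (crossing 0 0 ?h \<union> crossing 0 1 (- ?h))
     ({straight 0 0, straight 1 0} \<union> {straight 0 1, straight 1 1})"
    using cancel_crossings s by (cases "s > 0") auto
  from tangle_eq_block_shift[OF this, of ?x ?y]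
  have eq: "tangle_eq (block ?x (real_of_int (\<bar>s\<bar> + 1)) ?y (real (length u + 2)))
     (shift ?x ?y ` ?F) (fill {\<bar>s\<bar>..\<bar>s\<bar> + 1} (length u) [{s}, {- s}]) (fill {\<bar>s\<bar>..\<bar>s\<bar> + 1} (length u) [{}, {}])"
    unfolding interval2
    by (simp add: image_Un shift_crossing shift_straight fill_level_def letter_edges_def add.commute sgn_minus
      Un_commute insert_commute)
  have "isotopic (diagram n (u @ map2 (\<union>) [{}, {}] [{s}, {- s}] @ v)) (diagram n (u @ map2 (\<union>) [{}, {}] [{}, {}]
    @ v))"
    by (rule diagram_replace[OF _ _ _ _ _ _ _ eq])
      (use s v in \<open>auto simp: interval2 valid_level_def\<close>)
  then show ?thesis by simp
qed

lemma braid_isotopic: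
  assumes v: "valid_diagram n u" "valid_diagram n v" and i: "1 \<le> i" "i + 2 \<le> int n"
  shows "isotopic (diagram n (u @ [{i}, {i + 1}, {i}] @ v)) (diagram n (u @ [{i + 1}, {i}, {i + 1}] @ v))"
proof -
  let ?F = "{pt 0 0 0, pt 1 0 0, pt 2 0 0, pt 0 3 0, pt 1 3 0, pt 2 3 0}"
  let ?x = "real_of_int i" and ?y = "real (length u)"
  have abs: "\<bar>i\<bar> = i" "\<bar>i + 1\<bar> = i + 1" "sgn i = 1" "sgn (i + 1) = 1" using i by auto
  have diff: "{i, i + 1, i + 2} - {i, i + 1} = {i + 2}" "{i, i + 1, i + 2} - {i + 1, i + 1 + 1} = {i}" by auto
  have fl: "fill_level {i, i + 1, i + 2} k {i} = crossing ?x (real k) (1/2) \<union> {straight (?x + 2) (real k)}"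
    "fill_level {i, i + 1, i + 2} k {i + 1} = crossing (?x + 1) (real k) (1/2) \<union> {straight ?x (real k)}" for k
    unfolding fill_level_def occupied_simps letter_edges_def abs diff using i by (simp_all add: abs)
  from tangle_eq_block_shift[OF braid_relation_triple, of ?x ?y]
  have eq: "tangle_eq (block ?x (real_of_int (i + 2)) ?y (real (length u + 3)))
     (shift ?x ?y ` ?F) (fill {i..i + 2} (length u) [{i}, {i + 1}, {i}]) (fill {i..i + 2} (length u) [{i + 1},
       {i}, {i + 1}])"
    unfolding interval3 fill.simps fl
    by (simp add: image_Un shift_crossing shift_straight add.commute Un_ac insert_commute)
  have "isotopic (diagram n (u @ map2 (\<union>) [{}, {}, {}] [{i}, {i + 1}, {i}] @ v))
      (diagram n (u @ map2 (\<union>) [{}, {}, {}] [{i + 1}, {i}, {i + 1}] @ v))"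
    by (rule diagram_replace[OF _ _ _ _ _ _ _ eq])
      (use i v in \<open>auto simp: interval3 valid_level_def abs\<close>)
  then show ?thesis by simp
qed

text \<open>
  Both words can be slid into the diagram that has the two crossings at the same height.
\<close>

lemma far_isotopic:
  assumes v: "valid_diagram n u" "valid_diagram n v" and ij: "1 \<le> i" "i + 2 \<le> j" "j < int n"
  shows "isotopic (diagram n (u @ [{i}, {j}] @ v)) (diagram n (u @ [{j}, {i}] @ v))"
proof -
  have "valid_level n {i, j} {}" "valid_level n {j, i} {}" "valid_level n {i} {}" "valid_level n {j} {}"
    using ij by (auto simp: valid_level_def)
  moreover have "i \<noteq> j" using ij by simp
  ultimately have 1: "isotopic (diagram n (u @ [{i}, {j}] @ v)) (diagram n (u @ [{}, {i, j}] @ v))"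
    and 2: "isotopic (diagram n (u @ [{j}, {i}] @ v)) (diagram n (u @ [{}, {j, i}] @ v))"
    using slide_isotopic[OF v, of i "{}" "{j}"] slide_isotopic[OF v, of j "{}" "{i}"] by auto
  have "{j, i} = {i, j}" by auto
  from isotopic_trans[OF 1 isotopic_sym[OF 2[unfolded this]]] show ?thesis .
qed

lemma skein_triple_diagram:
  assumes v: "valid_diagram n u" "valid_diagram n v" and i: "1 \<le> i" "i < int n"
  shows "skein_triple (diagram n (u @ [{i}] @ v)) (diagram n (u @ [{- i}] @ v)) (diagram n (u @ [{}] @ v))"
proof -
  let ?x = "real_of_int i" and ?y = "real (length u)"
  let ?E = "frame n (map (\<lambda>C. (C, {})) u @ map (\<lambda>C. (C, {i..i + 1})) [{}] @ map (\<lambda>C. (C, {})) v)"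
  have n: "n \<ge> 1" using i by auto
  have B: "{i..i + 1} \<subseteq> {1..int n}" using i by auto
  have fillD: "diagram n (u @ [S] @ v) = ?E \<union> fill_level {i..i + 1} (length u) S" if "occupied S \<subseteq> {i..i + 1}" for S
    using diagram_fill[OF _ B, of "[{}]" "[S]" u v] that by simp
  \<comment> \<open>The octahedron of the skein triple: its equator is the unit square of the crossing, its poles are the two apices.\<close>
  define c where "c = pt (?x + 1/2) (?y + 1/2) 0"
  define e1 e2 e3 where "e1 = pt (1/2) 0 0" and "e2 = pt 0 (1/2) 0" and "e3 = pt 0 0 (1/2)"
  have pts: "c - e1 - e2 = pt ?x ?y 0" "c + e1 - e2 = pt (?x + 1) ?y 0" "c + e1 + e2 = pt (?x + 1) (?y + 1) 0"
    "c - e1 + e2 = pt ?x (?y + 1) 0" "c + e3 = pt (?x + 1/2) (?y + 1/2) (1/2)"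
    "c - e3 = pt (?x + 1/2) (?y + 1/2) (- (1/2))"
    unfolding c_def e1_def e2_def e3_def by (auto simp: vec_eq_iff forall_3)
  have vf: "valid_frame n (map (\<lambda>C. (C, {})) u @ map (\<lambda>C. (C, {i..i + 1})) [{}] @ map (\<lambda>C. (C, {})) v)"
    using v unfolding valid_frame_def valid_diagram_def by auto
  show ?thesis unfolding skein_triple_def
  proof (intro conjI exI)
    show "is_link (diagram n (u @ [{i}] @ v))" "is_link (diagram n (u @ [{- i}] @ v))" "is_link (diagram n (u @
      [{}] @ v))"
      using v i by (auto intro!: is_link_diagram[OF n] simp: valid_level_def)
    show "inner (cross3 e1 e2) e3 > 0"
      unfolding e1_def e2_def e3_def by (simp add: cross3_def inner_vec_def sum_3)
    have "convex hull {pt ?x ?y 0, pt (?x + 1) ?y 0, pt (?x + 1) (?y + 1) 0, pt ?x (?y + 1) 0, c + e3, c - e3}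
       \<subseteq> block ?x (?x + 1) ?y (?y + 1)"
      unfolding pts by (rule hull_minimal) (auto simp: pt_in_block convex_block)
    moreover have "points ?E \<inter> block ?x (?x + 1) ?y (?y + 1) \<subseteq> {pt ?x ?y 0, pt (?x + 1) ?y 0, pt (?x + 1) (?y +
      1) 0, pt ?x (?y + 1) 0}"
    proof
      fix p assume p: "p \<in> points ?E \<inter> block ?x (?x + 1) ?y (?y + 1)"
      have "\<exists>j\<in>{i..i + 1}. p = pt (real_of_int j) (real (length u)) 0 \<or> p = pt (real_of_int j) (real (length u +
        1)) 0"
      proof (rule frame_box[OF vf])
        fix l assume "length u \<le> l" "l < length u + 1"
        then have "l = length u" by simp
        then show "{i..i + 1} \<subseteq> snd ((map (\<lambda>C. (C, {})) u @ map (\<lambda>C. (C, {i..i + 1})) [{}] @ map (\<lambda>C. (C, {}))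
          v) ! l)"
          by (simp add: nth_append)
      qed (use p in \<open>auto simp: block_def\<close>)
      then show "p \<in> {pt ?x ?y 0, pt (?x + 1) ?y 0, pt (?x + 1) (?y + 1) 0, pt ?x (?y + 1) 0}"
        unfolding interval2 by (auto simp: add.commute)
    qed
    ultimately show "convex hull {pt ?x ?y 0, pt (?x + 1) ?y 0, pt (?x + 1) (?y + 1) 0, pt ?x (?y + 1) 0, c +
      e3, c - e3}
       \<inter> points ?E \<subseteq> {pt ?x ?y 0, pt (?x + 1) ?y 0, pt (?x + 1) (?y + 1) 0, pt ?x (?y + 1) 0}" by blast
    have s: "\<bar>i\<bar> = i" "\<bar>- i\<bar> = i" "sgn i = 1" "sgn (- i) = - 1" using i by auto
    show "diagram n (u @ [{i}] @ v) = ?E \<union> {(pt ?x ?y 0, c + e3), (c + e3, pt (?x + 1) (?y + 1) 0), (pt (?x + 1)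
      ?y 0, pt ?x (?y + 1) 0)}"
      by (subst fillD) (auto simp: fill_level_def letter_edges_def crossing_def s interval2 pts)
    show "diagram n (u @ [{- i}] @ v) = ?E \<union> {(pt ?x ?y 0, c - e3), (c - e3, pt (?x + 1) (?y + 1) 0), (pt (?x +
      1) ?y 0, pt ?x (?y + 1) 0)}"
      by (subst fillD) (use s in \<open>auto simp: fill_level_def letter_edges_def crossing_def interval2 pts\<close>)
    show "diagram n (u @ [{}] @ v) = ?E \<union> {(pt ?x ?y 0, pt ?x (?y + 1) 0), (pt (?x + 1) ?y 0, pt (?x + 1) (?y +
      1) 0)}"
      by (subst fillD) (auto simp: fill_level_def straight_def interval2 pts)
  qed (use pts in simp_all)
qed

section \<open>Removing trivial levels, and stabilisation\<close>

text \<open>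
  The symbolic heights in the following moves are out of reach of linear arithmetic. Instead, a linear
  functional separates the triangle from the other edges and attains its minimum only in a vertex.
\<close>

lemma hull_vertex:
  fixes f :: "real^3 \<Rightarrow> real"
  assumes f: "linear f" and p: "p \<in> convex hull {a, b, c}" and r: "r \<le> f a" "r < f b" "r < f c" "f p \<le> r"
  shows "p = a"
proof -
  obtain u v w where u: "0 \<le> u" "0 \<le> v" "0 \<le> w" "u + v + w = 1" "p = u *\<^sub>R a + v *\<^sub>R b + w *\<^sub>R c"
    using p unfolding convex_hull_3 by blast
  have "f p = u * f a + v * f b + w * f c"
    unfolding u(5) by (simp add: linear_add[OF f] linear_cmul[OF f])
  moreover have "r = u * r + v * r + w * r" using u(4) by (metis distrib_right mult_1)
  ultimately have "u * (f a - r) + v * (f b - r) + w * (f c - r) \<le> 0" using r(4) by (simp add: algebra_simps)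
  moreover have "0 \<le> u * (f a - r)" "0 \<le> v * (f b - r)" "0 \<le> w * (f c - r)" using u r by simp_all
  ultimately have "v * (f b - r) = 0" "w * (f c - r) = 0" by linarith+
  then have "v = 0" "w = 0" using r by simp_all
  then show ?thesis using u by simp
qed

lemma hull_ge:
  fixes f :: "real^3 \<Rightarrow> real"
  assumes f: "linear f" and p: "p \<in> convex hull {a, b, c}" and r: "r \<le> f a" "r \<le> f b" "r \<le> f c"
  shows "r \<le> f p"
proof -
  have "convex {x. r \<le> f x}" unfolding convex_def
  proof clarify
    fix x y u v assume *: "r \<le> f x" "r \<le> f y" "(0::real) \<le> u" "0 \<le> v" "u + v = 1"
    have "r = u * r + v * r" using *(5) by (metis distrib_right mult_1)
    also have "\<dots> \<le> u * f x + v * f y" using * by (intro add_mono mult_left_mono)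
    finally show "r \<le> f (u *\<^sub>R x + v *\<^sub>R y)" by (simp add: linear_add[OF f] linear_cmul[OF f])
  qed
  then have "convex hull {a, b, c} \<subseteq> {x. r \<le> f x}" using r by (intro hull_minimal) auto
  then show ?thesis using p by blast
qed

lemma linear_coordinates: "linear (\<lambda>p :: real^3. p $ i)" "linear (\<lambda>p :: real^3. - p $ i)"
  "linear (\<lambda>p :: real^3. p $ 2 + r * p $ 3)"
  by (intro linearI; simp add: algebra_simps)+

lemma hull_plane:
  assumes "p \<in> convex hull {pt x a a', pt x b b', pt x c c'}" shows "p $ 1 = x"
  using hull_ge[OF linear_coordinates(1)[of 1] assms, of x] hull_ge[OF linear_coordinates(2)[of 1] assms, of "- x"]
  by simp

lemma avoidsI:
  assumes "\<And>p. p \<in> convex hull {a, b, c} \<Longrightarrow> p \<in> closed_segment (fst e) (snd e) \<Longrightarrow> p = a \<or> p = b"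
  shows "avoids a b c e"
  using assms unfolding avoids_def by blast

text \<open>
  All of this happens in the plane of one strand: remove the vertex at the end of the trivial level,
  and move the corner of the return path down by one.
\<close>

lemma drop_last_strand:
  fixes j m :: real
  assumes m: "0 \<le> m"
  defines "K \<equiv> {p. p $ 1 = j \<and> (m \<le> p $ 2 \<and> 0 \<le> p $ 3 \<or> p $ 3 = 1)}"
  shows "tangle_eq K {pt j m 0, pt j (- 1) 1}
    (arc [pt j m 0, pt j (m + 1) 0, pt j (m + 2) 1, pt j (- 1) 1]) (arc [pt j m 0, pt j (m + 1) 1, pt j (- 1) 1])"
    (is "tangle_eq K ?F _ _")
proof -
  let ?a = "pt j m 0" and ?b = "pt j (m + 1) 0" and ?c = "pt j (m + 2) 1" and ?d = "pt j (- 1) 1" and ?e = "pt j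
    (m + 1) 1"
  have hullK: "convex hull {pt j x x', pt j y y', pt j z z'} \<subseteq> K"
    if "m \<le> x" "m \<le> y" "m \<le> z" "0 \<le> x'" "0 \<le> y'" "0 \<le> z'" for x y z x' y' z'
  proof
    fix p assume p: "p \<in> convex hull {pt j x x', pt j y y', pt j z z'}"
    then show "p \<in> K" unfolding K_def using hull_plane[OF p] that
        hull_ge[OF linear_coordinates(1)[of 2] p, of m] hull_ge[OF linear_coordinates(1)[of 3] p, of 0] by simp
  qed
  have 1: "tangle_eq K ?F (arc [?a, ?c, ?d]) (arc [?a, ?b, ?c, ?d])"
  proof (rule tangle_move[where a = ?a and b = ?c and c = ?b and R = "arc [?c, ?d]"])
    show "bent ?a ?b ?c" unfolding bent_def by (auto simp: mem_segment_pt)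
    have "avoids ?a ?c ?b (?c, ?d)"
    proof (rule avoidsI)
      fix p assume p: "p \<in> convex hull {?a, ?c, ?b}" "p \<in> closed_segment (fst (?c, ?d)) (snd (?c, ?d))"
      then have "p $ 3 = 1" by (auto simp: mem_segment_pt)
      moreover have "p \<in> convex hull {?c, ?a, ?b}" using p(1) by (simp add: insert_commute)
      ultimately show "p = ?a \<or> p = ?c"
        using hull_vertex[OF linear_coordinates(2)[of 3], of p ?c ?a ?b "- 1"] by simp
    qed
    then show "\<forall>e\<in>arc [?c, ?d]. avoids ?a ?c ?b e" by simp
  qed (use hullK in auto)
  have 2: "tangle_eq K ?F (arc [?a, ?c, ?d]) (arc [?a, ?c, ?e, ?d])"
  proof (rule tangle_move[where a = ?c and b = ?d and c = ?e and R = "arc [?a, ?c]"])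
    have "t = 0" if "s \<le> 1" "0 \<le> t" "1 - s = t * (- 2 - m)" for s t :: real
    proof -
      have "t * (2 + m) = - (1 - s)" using that(3) by (simp add: algebra_simps)
      then have "t * (2 + m) \<le> 0" using that(1) by linarith
      then show ?thesis using that(2) m by (simp add: mult_le_0_iff)
    qed
    then show "bent ?c ?e ?d" unfolding bent_def using m by (auto simp: mem_segment_pt)
    have "avoids ?c ?d ?e (?a, ?c)"
    proof (rule avoidsI)
      fix p assume p: "p \<in> convex hull {?c, ?d, ?e}" "p \<in> closed_segment (fst (?a, ?c)) (snd (?a, ?c))"
      have "1 \<le> p $ 3" using hull_ge[OF linear_coordinates(1)[of 3] p(1), of 1] by simp
      then show "p = ?c \<or> p = ?d" using p(2) by (auto simp: mem_segment_pt)
    qed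
    then show "\<forall>e\<in>arc [?a, ?c]. avoids ?c ?d ?e e" by simp
    show "convex hull {?c, ?d, ?e} \<subseteq> K"
    proof
      fix p assume p: "p \<in> convex hull {?c, ?d, ?e}"
      show "p \<in> K" unfolding K_def using hull_plane[OF p] hull_ge[OF linear_coordinates(1)[of 3] p, of 1]
         hull_ge[OF linear_coordinates(2)[of 3] p, of "- 1"] by simp
    qed
  qed auto
  have 3: "tangle_eq K ?F (arc [?a, ?e, ?d]) (arc [?a, ?c, ?e, ?d])"
  proof (rule tangle_move[where a = ?a and b = ?e and c = ?c and R = "arc [?e, ?d]"])
    show "bent ?a ?c ?e" unfolding bent_def by (auto simp: mem_segment_pt)
    have "avoids ?a ?e ?c (?e, ?d)"
    proof (rule avoidsI)
      fix p assume p: "p \<in> convex hull {?a, ?e, ?c}" "p \<in> closed_segment (fst (?e, ?d)) (snd (?e, ?d))"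
      then obtain u where "0 \<le> u" "p = pt j (m + 1 + u * (- 2 - m)) 1" by (auto simp: mem_segment_pt)
      moreover from this m have "0 \<le> u * (2 + m)" by simp
      \<comment> \<open>The functional \<open>y - 2 z\<close> has its minimum over the triangle at \<open>?e\<close> only, since \<open>?c\<close> is to the right of \<open>?e\<close>.\<close>
      ultimately have "p $ 2 + (- 2) * p $ 3 \<le> m - 1" by (simp add: algebra_simps)
      moreover have "p \<in> convex hull {?e, ?a, ?c}" using p(1) by (simp add: insert_commute)
      ultimately show "p = ?a \<or> p = ?e"
        using hull_vertex[OF linear_coordinates(3)[of "- 2"], of p ?e ?a ?c "m - 1"] by simp
    qed
    then show "\<forall>e\<in>arc [?e, ?d]. avoids ?a ?e ?c e" by simp
  qed (use hullK in auto)
  show ?thesis by (rule tangle_eq_trans[OF tangle_eq_sym[OF 1] tangle_eq_trans[OF 2 tangle_eq_sym[OF 3]]])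
qed

lemma levels_diagram: "diagram n u = levels n 0 (map (\<lambda>C. (C, {})) u) \<union> return_edges n (length u)"
  unfolding diagram_def frame_levels by simp

lemma in_levels:
  assumes "e \<in> levels n k (map (\<lambda>C. (C, {})) u)"
  obtains l where "l < length u" "e \<in> level n (k + l) (u ! l) {}"
  using assms unfolding levels_UN by auto

lemma drop_last_level:
  assumes n: "n \<ge> 1" and v: "valid_diagram n u"
  shows "isotopic (diagram n (u @ [{}])) (diagram n u)"
proof -
  let ?m = "length u"
  let ?T = "\<lambda>j. arc [pt (real j) (real ?m) 0, pt (real j) (real ?m + 1) 0, pt (real j) (real ?m + 2) 1, pt (real
    j) (- 1) 1]"
  let ?T' = "\<lambda>j. arc [pt (real j) (real ?m) 0, pt (real j) (real ?m + 1) 1, pt (real j) (- 1) 1]"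
  let ?K = "\<lambda>j. {p. p $ 1 = real j \<and> (real ?m \<le> p $ 2 \<and> 0 \<le> p $ 3 \<or> p $ 3 = 1)}"
  let ?F = "\<lambda>j. {pt (real j) (real ?m) 0, pt (real j) (- 1) 1}"
  let ?E = "levels n 0 (map (\<lambda>C. (C, {})) u) \<union> (\<lambda>j. (pt (real j) (- 1) 1, pt (real j) 0 0)) ` {1..n}"
  have L1: "diagram n (u @ [{}]) = ?E \<union> (\<Union>j\<in>{1..n}. ?T j)"
    unfolding levels_diagram map_append levels_append return_edges_def
    by (auto simp: level_def straight_def add.commute)
  have L2: "diagram n u = ?E \<union> (\<Union>j\<in>{1..n}. ?T' j)"
    unfolding levels_diagram return_edges_def by auto
  have "isotopic (?E \<union> (\<Union>j\<in>{1..n}. ?T j)) (?E \<union> (\<Union>j\<in>{1..n}. ?T' j))"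
  proof (rule conjunct2[OF parallel_tangles_isotopic[where K = ?K and F = ?F]])
    show "tangle_eq (?K j) (?F j) (?T j) (?T' j)" for j
      using drop_last_strand[of "real ?m" "real j"] by simp
    show "points ?E \<inter> ?K j \<subseteq> ?F j" if "j \<in> {1..n}" for j
    proof
      fix p assume "p \<in> points ?E \<inter> ?K j"
      then obtain e where e: "e \<in> ?E" "p \<in> closed_segment (fst e) (snd e)" and K: "p \<in> ?K j"
        unfolding points_def by force
      from e(1) show "p \<in> ?F j"
      proof
        assume "e \<in> levels n 0 (map (\<lambda>C. (C, {})) u)"
        then obtain l where l: "l < ?m" "e \<in> level n l (u ! l) {}" by (elim in_levels) auto
        note lp = level_point[OF l(2) valid_nth[OF v l(1)] e(2)]
        have "p $ 3 \<noteq> 1" using lp by auto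
        then have y: "real ?m \<le> p $ 2" using K by auto
        have "real l + 1 \<le> real ?m" using l(1) by linarith
        then have "p $ 2 = real l + 1" "real ?m = real l + 1" using lp y by linarith+
        then obtain i where "p = pt (real i) (real ?m) 0" using lp by auto
        then show ?thesis using K by auto
      next
        assume "e \<in> (\<lambda>j. (pt (real j) (- 1) 1, pt (real j) 0 0)) ` {1..n}"
        then obtain i where "e = (pt (real i) (- 1) 1, pt (real i) 0 0)" by blast
        then obtain w where w: "0 \<le> w" "w \<le> 1" "p = pt (real i) (- 1 + w) (1 - w)"
          using e(2) by (auto simp: mem_segment_pt)
        from K have "w = 0 \<or> real ?m \<le> w - 1" unfolding w(3) by auto
        then have "w = 0 \<or> (w = 1 \<and> real ?m = 0)" using w(1,2) of_nat_0_le_iff[of ?m, where 'a = real] by linarith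
        then show ?thesis using w(3) K by auto
      qed
    qed
    show "points (?T i \<union> ?T' i) \<inter> ?K j \<subseteq> ?F j" if "i \<noteq> j" for i j
      using that by (auto simp: mem_segment_pt)
    show "is_link (?E \<union> (\<Union>j\<in>{1..n}. ?T j))" using is_link_diagram[OF n, of "u @ [{}]"] v L1 by simp
  qed simp
  then show ?thesis using L1 L2 by simp
qed

text \<open>
  Levels above the trivial one would have to be shifted if it were removed on the spot. Sliding the
  crossings above it down, one at a time, brings it to the top, where it can be absorbed into the
  return edges.
\<close>

lemma drop_level:
  assumes n: "n \<ge> 1" and u: "valid_diagram n u" and v: "valid_diagram n (map (\<lambda>s. {s}) v)"
  shows "isotopic (diagram n (u @ [{}] @ map (\<lambda>s. {s}) v)) (diagram n (u @ map (\<lambda>s. {s}) v))"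
  using u v
proof (induction v arbitrary: u)
  case Nil
  then show ?case using drop_last_level[OF n] by simp
next
  case (Cons s v)
  have s: "valid_level n {s} {}" using Cons.prems(2) by simp
  have "isotopic (diagram n (u @ [insert s {}, {}] @ map (\<lambda>s. {s}) v)) (diagram n (u @ [{}, insert s {}] @ map
    (\<lambda>s. {s}) v))"
    by (rule slide_isotopic) (use Cons.prems s in auto)
  then have 1: "isotopic (diagram n (u @ [{}] @ map (\<lambda>s. {s}) (s # v))) (diagram n ((u @ [{s}]) @ [{}] @ map
    (\<lambda>s. {s}) v))"
    by (simp add: isotopic_sym)
  have 2: "isotopic (diagram n ((u @ [{s}]) @ [{}] @ map (\<lambda>s. {s}) v)) (diagram n ((u @ [{s}]) @ map (\<lambda>s. {s}) v))"
    by (rule Cons.IH) (use Cons.prems s in auto)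
  from isotopic_trans[OF 1 2] show ?case by simp
qed

text \<open>
  The last strand of a stabilised braid runs alone in the plane \<open>x = 1\<close> (in local coordinates). From the
  crossing upwards its vertices are removed one by one; in the plane, the remaining edges lie below
  the crossing, or at the height of the return edges.
\<close>

lemma loop_up:
  assumes M: "real q + 1 < M" and F: "F \<subseteq> Domain R \<union> Range R"
    and K: "{p. p $ 1 = 1} \<subseteq> K"
    and R: "\<And>e p. e \<in> R \<Longrightarrow> p \<in> closed_segment (fst e) (snd e) \<Longrightarrow> p $ 1 < 1 \<or> p $ 2 \<le> 1 \<or> 1 \<le> p $ 3"
  shows "tangle_eq K F ((\<lambda>l. straight 1 (1 + real l)) ` {..<q} \<union> {(pt 1 (1 + real q) 0, pt 1 M 1)} \<union> R)
     ({(pt 1 1 0, pt 1 M 1)} \<union> R)"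
  using M
proof (induction q)
  case 0
  then show ?case by (simp add: tangle_eq_refl)
next
  case (Suc q)
  let ?S = "(\<lambda>l. straight 1 (1 + real l)) ` {..<q}"
  let ?a = "pt 1 (1 + real q) 0" and ?c = "pt 1 (2 + real q) 0" and ?b = "pt 1 M 1"
  have "tangle_eq K F (?S \<union> {(?a, ?b)} \<union> R) ((\<lambda>l. straight 1 (1 + real l)) ` {..<Suc q} \<union> {(pt 1 (1 + real (Suc
    q)) 0, ?b)} \<union> R)"
  proof (rule tangle_move[where a = ?a and b = ?b and c = ?c and R = "?S \<union> R"])
    show "bent ?a ?c ?b" unfolding bent_def by (auto simp: mem_segment_pt)
    show "\<forall>e\<in>?S \<union> R. avoids ?a ?b ?c e"
    proof (intro ballI avoidsI)
      fix e p assume e: "e \<in> ?S \<union> R" and p: "p \<in> convex hull {?a, ?b, ?c}" "p \<in> closed_segment (fst e) (snd e)"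
      have "p $ 1 < 1 \<or> p $ 2 \<le> 1 + real q \<or> 1 \<le> p $ 3"
        using e
      proof
        assume "e \<in> ?S"
        then obtain l where l: "l < q" "e = straight 1 (1 + real l)" by blast
        then have "real l + 1 \<le> real q" by linarith
        then show ?thesis using straight_point[OF p(2)[unfolded l(2)]] by simp
      next
        assume "e \<in> R"
        then show ?thesis using R[OF _ p(2)] by force
      qed
      moreover have "p $ 1 = 1" using hull_plane[OF p(1)] .
      moreover have "p = ?a" if "p $ 2 \<le> 1 + real q"
        using hull_vertex[OF linear_coordinates(1)[of 2] p(1), of "1 + real q"] that Suc.prems by simp
      moreover have "p = ?b" if "1 \<le> p $ 3"
        using hull_vertex[OF linear_coordinates(2)[of 3], of p ?b ?a ?c "- 1"] p(1) that by (simp add: insert_commute)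
      ultimately show "p = ?a \<or> p = ?b" by auto
    qed
    show "convex hull {?a, ?b, ?c} \<subseteq> K" using hull_plane K by blast
    show "(\<lambda>l. straight 1 (1 + real l)) ` {..<Suc q} \<union> {(pt 1 (1 + real (Suc q)) 0, ?b)} \<union> R =
       insert (?a, ?c) (insert (?c, ?b) (?S \<union> R))"
      by (simp add: lessThan_Suc straight_def insert_commute)
  qed (use F in auto)
  from tangle_eq_trans[OF tangle_eq_sym[OF this] Suc.IH] Suc.prems show ?case by simp
qed

lemma loop_down:
  assumes Q: "real q < Q" and F: "F \<subseteq> Domain R \<union> Range R"
    and K: "{p. p $ 1 = 1} \<subseteq> K"
    and R: "\<And>e p. e \<in> R \<Longrightarrow> p \<in> closed_segment (fst e) (snd e) \<Longrightarrow> p $ 1 < 1 \<or> 0 \<le> p $ 2 \<or> 1 \<le> p $ 3"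
  shows "tangle_eq K F ((\<lambda>l. straight 1 (- 1 - real l)) ` {..<q} \<union> {(pt 1 (- Q) 1, pt 1 (- real q) 0)} \<union> R)
     ({(pt 1 (- Q) 1, pt 1 0 0)} \<union> R)"
  using Q
proof (induction q)
  case 0
  then show ?case by (simp add: tangle_eq_refl)
next
  case (Suc q)
  let ?S = "(\<lambda>l. straight 1 (- 1 - real l)) ` {..<q}"
  let ?a = "pt 1 (- Q) 1" and ?c = "pt 1 (- 1 - real q) 0" and ?b = "pt 1 (- real q) 0"
  have "tangle_eq K F (?S \<union> {(?a, ?b)} \<union> R) ((\<lambda>l. straight 1 (- 1 - real l)) ` {..<Suc q} \<union> {(?a, pt 1 (- real
    (Suc q)) 0)} \<union> R)"
  proof (rule tangle_move[where a = ?a and b = ?b and c = ?c and R = "?S \<union> R"])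
    show "bent ?a ?c ?b" unfolding bent_def by (auto simp: mem_segment_pt)
    show "\<forall>e\<in>?S \<union> R. avoids ?a ?b ?c e"
    proof (intro ballI avoidsI)
      fix e p assume e: "e \<in> ?S \<union> R" and p: "p \<in> convex hull {?a, ?b, ?c}" "p \<in> closed_segment (fst e) (snd e)"
      have "p $ 1 < 1 \<or> - real q \<le> p $ 2 \<or> 1 \<le> p $ 3"
        using e
      proof
        assume "e \<in> ?S"
        then obtain l where l: "l < q" "e = straight 1 (- 1 - real l)" by blast
        then have "real l + 1 \<le> real q" by linarith
        then show ?thesis using straight_point[OF p(2)[unfolded l(2)]] by simp
      next
        assume "e \<in> R"
        then show ?thesis using R[OF _ p(2)] by force
      qed
      moreover have "p $ 1 = 1" using hull_plane[OF p(1)] .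
      moreover have "p = ?b" if "- real q \<le> p $ 2"
        using hull_vertex[OF linear_coordinates(2)[of 2], of p ?b ?a ?c "real q"] p(1) that Suc.prems
        by (simp add: insert_commute)
      moreover have "p = ?a" if "1 \<le> p $ 3"
        using hull_vertex[OF linear_coordinates(2)[of 3] p(1), of "- 1"] that by simp
      ultimately show "p = ?a \<or> p = ?b" by auto
    qed
    show "convex hull {?a, ?b, ?c} \<subseteq> K" using hull_plane K by blast
    show "(\<lambda>l. straight 1 (- 1 - real l)) ` {..<Suc q} \<union> {(?a, pt 1 (- real (Suc q)) 0)} \<union> R =
       insert (?a, ?c) (insert (?c, ?b) (?S \<union> R))"
      by (simp add: lessThan_Suc straight_def insert_commute)
  qed (use F in auto)
  from tangle_eq_trans[OF tangle_eq_sym[OF this] Suc.IH] Suc.prems show ?case by simp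
qed

lemma unkink_positive:
  "tangle_eq (block 0 1 0 1) {pt 0 0 0, pt 0 1 0}
    (insert (pt 1 1 0, pt 1 0 0) (crossing 0 0 (1/2)))
    ({straight 0 0})"
  (is "tangle_eq ?K ?F ?T ?T'")
proof -
  let ?A0 = "pt 0 0 0" and ?B0 = "pt 1 0 0" and ?A1 = "pt 0 1 0" and ?B1 = "pt 1 1 0"
    and ?P = "pt (1/2) (1/2) (1/2)"
  let ?S0 = "arc [?A0, ?P, ?B1, ?B0, ?A1]"
    and ?S1 = "arc [?A0, ?P, ?B1, ?A1]"
    and ?S2 = "arc [?A0, ?P, ?A1]"
  have 0: "?T = ?S0"
    by (simp add: crossing_def straight_def insert_commute)
  have 1: "tangle_eq ?K ?F ?S0 ?S1"
    by (rule block_del[where a = ?B1 and b = ?A1 and c = ?B0 and R = "arc [?A0, ?P, ?B1]"];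
      (rule bent_pt | (simp only: arc.simps ball_Un ball_simps, intro conjI TrueI avoids_pt)
        | simp add: pt_in_block insert_commute straight_def crossing_def)?; (argo | linarith | simp))
  have 2: "tangle_eq ?K ?F ?S1 ?S2"
    by (rule block_del[where a = ?P and b = ?A1 and c = ?B1 and R = "arc [?A0, ?P]"];
      (rule bent_pt | (simp only: arc.simps ball_Un ball_simps, intro conjI TrueI avoids_pt)
        | simp add: pt_in_block insert_commute straight_def crossing_def)?; (argo | linarith | simp))
  have 3: "tangle_eq ?K ?F ?S2 ?T'"
    by (rule block_del[where a = ?A0 and b = ?A1 and c = ?P and R = "{}"];
      (rule bent_pt | (simp only: arc.simps ball_Un ball_simps, intro conjI TrueI avoids_pt)
        | simp add: pt_in_block insert_commute straight_def crossing_def)?; (argo | linarith | simp))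
  show ?thesis unfolding 0
    by (rule tangle_eq_trans[OF 1 tangle_eq_trans[OF 2 3]])
qed

lemma unkink:
  assumes h: "\<bar>h\<bar> = 1/2"
  shows "tangle_eq (block 0 1 0 1) {pt 0 0 0, pt 0 1 0} (insert (pt 1 1 0, pt 1 0 0) (crossing 0 0 h)) {straight 0 0}"
proof -
  have "tangle_eq (block 0 1 0 1) {pt 0 0 0, pt 0 1 0} (insert (pt 1 1 0, pt 1 0 0) (crossing 0 0 (- (1/2))))
    {straight 0 0}"
    using tangle_eq_mirror[OF unkink_positive] by (simp add: crossing_def straight_def)
  moreover have "h = 1/2 \<or> h = - (1/2)" using h by linarith
  ultimately show ?thesis using unkink_positive by metis
qed

text \<open>
  The loop of the last strand collapses: first the vertical edges, then the two corners of the return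
  path, and finally the kink that is left at the crossing. The region \<open>K\<close> is everything to the right of
  the other strands, and the block of the crossing.
\<close>

lemma stabilisation_tangle:
  assumes h: "\<bar>h\<bar> = 1/2"
  defines "K \<equiv> {p. 0 < p $ 1} \<union> block 0 1 0 1" and "F \<equiv> {pt 0 0 0, pt 0 1 0}"
  shows "tangle_eq K F (crossing 0 0 h \<union> (\<lambda>l. straight 1 (1 + real l)) ` {..<q} \<union> (\<lambda>l. straight 1 (- 1 - real
    l)) ` {..<p} \<union>
     {(pt 1 (1 + real q) 0, pt 1 (2 + real q) 1), (pt 1 (2 + real q) 1, pt 1 (- 1 - real p) 1), (pt 1 (- 1 -
       real p) 1, pt 1 (- real p) 0)})
     {straight 0 0}"
proof -
  let ?S = "(\<lambda>l. straight 1 (1 + real l)) ` {..<q}" and ?S' = "(\<lambda>l. straight 1 (- 1 - real l)) ` {..<p}"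
  let ?M = "pt 1 (2 + real q) 1" and ?Q = "pt 1 (- (1 + real p)) 1" and ?B0 = "pt 1 0 0" and ?B1 = "pt 1 1 0"
  have FD0: "F \<subseteq> Domain (crossing 0 0 h) \<union> Range (crossing 0 0 h)" unfolding F_def crossing_def by auto
  have FD: "F \<subseteq> Domain (crossing 0 0 h \<union> R) \<union> Range (crossing 0 0 h \<union> R)" for R
    unfolding F_def crossing_def by auto
  have K1: "{p. p $ 1 = 1} \<subseteq> K" unfolding K_def by auto
  have cr: "p = ?B0 \<or> p = ?B1 \<or> p $ 1 < 1" if "e \<in> crossing 0 0 h" "p \<in> closed_segment (fst e) (snd e)" for e p
    using that unfolding crossing_def by (auto simp: mem_segment_pt)
  have 1: "tangle_eq K F (?S \<union> {(pt 1 (1 + real q) 0, ?M)} \<union> (crossing 0 0 h \<union> (?S' \<union> {(?M, ?Q), (?Q, pt 1 (-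
    real p) 0)})))
     ({(?B1, ?M)} \<union> (crossing 0 0 h \<union> (?S' \<union> {(?M, ?Q), (?Q, pt 1 (- real p) 0)})))"
  proof (rule loop_up[OF _ FD K1])
    fix e p' assume e: "e \<in> crossing 0 0 h \<union> (?S' \<union> {(?M, ?Q), (?Q, pt 1 (- real p) 0)})"
      and p: "p' \<in> closed_segment (fst e) (snd e)"
    show "p' $ 1 < 1 \<or> p' $ 2 \<le> 1 \<or> 1 \<le> p' $ 3"
    proof -
      consider "e \<in> crossing 0 0 h" | "e \<in> ?S'" | "e = (?M, ?Q)" | "e = (?Q, pt 1 (- real p) 0)" using e by blast
      then show ?thesis
      proof cases
        case 1 then show ?thesis using cr[OF _ p] by auto
      next
        case 2
        then obtain l where "e = straight 1 (- 1 - real l)" by blast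
        then show ?thesis using straight_point[of p' 1 "- 1 - real l"] p by auto
      next
        case 3 then show ?thesis using p by (auto simp: mem_segment_pt)
      next
        case 4 then show ?thesis using p by (auto simp: mem_segment_pt)
      qed
    qed
  qed simp
  have 2: "tangle_eq K F (?S' \<union> {(?Q, pt 1 (- real p) 0)} \<union> (crossing 0 0 h \<union> {(?B1, ?M), (?M, ?Q)}))
     ({(?Q, ?B0)} \<union> (crossing 0 0 h \<union> {(?B1, ?M), (?M, ?Q)}))"
  proof (rule loop_down[OF _ FD K1])
    fix e p' assume e: "e \<in> crossing 0 0 h \<union> {(?B1, ?M), (?M, ?Q)}"
      and p: "p' \<in> closed_segment (fst e) (snd e)"
    show "p' $ 1 < 1 \<or> 0 \<le> p' $ 2 \<or> 1 \<le> p' $ 3"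
    proof -
      consider "e \<in> crossing 0 0 h" | "e = (?B1, ?M)" | "e = (?M, ?Q)" using e by blast
      then show ?thesis
      proof cases
        case 1 then show ?thesis using cr[OF _ p] by auto
      next
        case 2 then show ?thesis using p by (auto simp: mem_segment_pt)
      next
        case 3 then show ?thesis using p by (auto simp: mem_segment_pt)
      qed
    qed
  qed simp
  have 3: "tangle_eq K F (insert (?B1, ?Q) (crossing 0 0 h \<union> {(?Q, ?B0)}))
    (insert (?B1, ?M) (insert (?M, ?Q) (crossing 0 0 h \<union> {(?Q, ?B0)})))"
  proof (rule tangle_move[where a = ?B1 and b = ?Q and c = ?M and R = "crossing 0 0 h \<union> {(?Q, ?B0)}", OF refl refl])
    show "bent ?B1 ?M ?Q" unfolding bent_def by (auto simp: mem_segment_pt)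
    show "\<forall>e\<in>crossing 0 0 h \<union> {(?Q, ?B0)}. avoids ?B1 ?Q ?M e"
    proof (intro ballI avoidsI)
      fix e p' assume e: "e \<in> crossing 0 0 h \<union> {(?Q, ?B0)}" and p: "p' \<in> convex hull {?B1, ?Q, ?M}" "p' \<in>
        closed_segment (fst e) (snd e)"
      from e show "p' = ?B1 \<or> p' = ?Q"
      proof
        assume "e \<in> crossing 0 0 h"
        then have "p' $ 1 < 1 \<or> p' $ 3 \<le> 0" using cr[OF _ p(2)] by auto
        then have "p' $ 3 \<le> 0" using hull_plane[OF p(1)] by simp
        then show ?thesis using hull_vertex[OF linear_coordinates(1)[of 3] p(1), of 0] by simp
      next
        assume "e \<in> {(?Q, ?B0)}"
        then obtain w where w: "0 \<le> w" "w \<le> 1" "p' = pt 1 (- (1 + real p) + w * (1 + real p)) (1 - w)"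
          using p(2) by (auto simp: mem_segment_pt algebra_simps)
        \<comment> \<open>This functional is constant on the side from \<open>?B1\<close> to \<open>?Q\<close>, beyond which the edge to \<open>?B0\<close> lies.\<close>
        have "1 \<le> p' $ 2 + (2 + real p) * p' $ 3" using hull_ge[OF linear_coordinates(3) p(1), of 1 "2 + real
          p"] by simp
        then have "w \<le> 0" unfolding w(3) by (simp add: algebra_simps)
        then show ?thesis using w by simp
      qed
    qed
    show "convex hull {?B1, ?Q, ?M} \<subseteq> K" using hull_plane K1 by blast
  qed (use FD0 in auto)
  have 4: "tangle_eq K F (insert (?B1, ?B0) (crossing 0 0 h)) (insert (?B1, ?Q) (insert (?Q, ?B0) (crossing 0 0 h)))"
  proof (rule tangle_move[where a = ?B1 and b = ?B0 and c = ?Q and R = "crossing 0 0 h", OF refl refl])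
    show "bent ?B1 ?Q ?B0" unfolding bent_def
    proof (intro conjI subsetI)
      fix p' assume "p' \<in> closed_segment ?B1 ?Q \<inter> closed_segment ?Q ?B0"
      then obtain s t where s: "0 \<le> s" "s \<le> 1" "p' = pt 1 (1 + s * (- (1 + real p) - 1)) s"
        and t: "0 \<le> t" "t \<le> 1" "p' = pt 1 (- (1 + real p) + t * (1 + real p)) (1 - t)"
        by (auto simp: mem_segment_pt)
      have st: "s = 1 - t" "1 + s * (- (1 + real p) - 1) = - (1 + real p) + t * (1 + real p)" using s(3) t(3) by
        simp_all
      have "t = 0" using st(2) unfolding st(1) by (simp add: algebra_simps)
      then show "p' \<in> {?Q}" using t(3) by simp
    qed auto
    show "\<forall>e\<in>crossing 0 0 h. avoids ?B1 ?B0 ?Q e"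
      using cr hull_plane by (intro ballI avoidsI) fastforce
    show "convex hull {?B1, ?B0, ?Q} \<subseteq> K" using hull_plane K1 by blast
  qed (use FD0 in auto)
  have 5: "tangle_eq K F (insert (?B1, ?B0) (crossing 0 0 h)) {straight 0 0}"
    using tangle_eq_mono[OF unkink[OF h], of K] unfolding K_def F_def by blast
  have e1: "crossing 0 0 h \<union> ?S \<union> ?S' \<union> {(pt 1 (1 + real q) 0, pt 1 (2 + real q) 1), (pt 1 (2 + real q) 1, pt 1
    (- 1 - real p) 1), (pt 1 (- 1 - real p) 1, pt 1 (- real p) 0)}
     = ?S \<union> {(pt 1 (1 + real q) 0, ?M)} \<union> (crossing 0 0 h \<union> (?S' \<union> {(?M, ?Q), (?Q, pt 1 (- real p) 0)}))" by auto
  have e2: "{(?B1, ?M)} \<union> (crossing 0 0 h \<union> (?S' \<union> {(?M, ?Q), (?Q, pt 1 (- real p) 0)})) =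
    ?S' \<union> {(?Q, pt 1 (- real p) 0)} \<union> (crossing 0 0 h \<union> {(?B1, ?M), (?M, ?Q)})" by auto
  have e3: "{(?Q, ?B0)} \<union> (crossing 0 0 h \<union> {(?B1, ?M), (?M, ?Q)}) = insert (?B1, ?M) (insert (?M, ?Q) (crossing
    0 0 h \<union> {(?Q, ?B0)}))" by auto
  have e4: "insert (?B1, ?Q) (crossing 0 0 h \<union> {(?Q, ?B0)}) = insert (?B1, ?Q) (insert (?Q, ?B0) (crossing 0 0
    h))" by auto
  show ?thesis unfolding e1
    by (rule tangle_eq_trans[OF 1[unfolded e2] tangle_eq_trans[OF 2[unfolded e3] tangle_eq_trans[OF
      tangle_eq_sym[OF 3[unfolded e4]]
          tangle_eq_trans[OF tangle_eq_sym[OF 4] 5]]]])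
qed

lemma frame_right:
  assumes v: "valid_frame n D" and p: "p \<in> points (frame n D)"
  shows "p $ 1 \<le> real n"
proof -
  obtain e where e: "e \<in> frame n D" and pe: "p \<in> closed_segment (fst e) (snd e)"
    using p unfolding points_def by force
  from e show ?thesis
  proof (cases rule: frame_cases)
    case (level l)
    have vl: "valid_level n (fst (D ! l)) (snd (D ! l))"
      using v level(1) unfolding valid_frame_def by (metis case_prodE fst_conv nth_mem snd_conv)
    from level(2) show ?thesis
    proof (cases rule: level_cases)
      case (straight j)
      then show ?thesis using straight_point[of p "real j" "real l"] pe by auto
    next
      case (crossing s)
      have "p $ 1 \<le> real_of_int \<bar>s\<bar> + 1" using crossing_point[OF crossing(2)[unfolded letter_edges_def] pe] by blast
      moreover have "\<bar>s\<bar> + 1 \<le> int n" using vl crossing(1) unfolding valid_level_def by force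
      ultimately show ?thesis by linarith
    qed
  next
    case return
    then show ?thesis using pe by (cases rule: return_edges_cases) (auto simp: mem_segment_pt)
  qed
qed

lemma level_Suc:
  assumes v: "valid_level n C {}"
  shows "level (Suc n) k C {} = level n k C {} \<union> {straight (real n + 1) (real k)}"
proof -
  have "int (Suc n) \<notin> occupied C" using v unfolding valid_level_def occupied_def by force
  then have "{j. j \<in> {1..Suc n} \<and> int j \<notin> occupied C} = insert (Suc n) {j. j \<in> {1..n} \<and> int j \<notin> occupied C}"
    by (auto simp: le_Suc_eq simp del: of_nat_Suc)
  then have "{straight (real j) (real k) |j. j \<in> {1..Suc n} \<and> int j \<notin> occupied C} =
     {straight (real j) (real k) |j. j \<in> {1..n} \<and> int j \<notin> occupied C} \<union> {straight (real (Suc n)) (real k)}"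
    unfolding setcompr_eq_image by simp
  then show ?thesis unfolding level_def by (auto simp: add.commute)
qed

lemma levels_Suc:
  assumes "valid_diagram n u"
  shows "levels (Suc n) k (map (\<lambda>C. (C, {})) u) =
    levels n k (map (\<lambda>C. (C, {})) u) \<union> (\<lambda>l. straight (real n + 1) (real k + real l)) ` {..<length u}"
  using assms
proof (induction u arbitrary: k)
  case (Cons C u)
  have "{..<length (C # u)} = insert 0 (Suc ` {..<length u})" by (simp add: lessThan_Suc_eq_insert_0)
  then have "(\<lambda>l. straight (real n + 1) (real k + real l)) ` {..<length (C # u)} =
     {straight (real n + 1) (real k)} \<union> (\<lambda>l. straight (real n + 1) (real (Suc k) + real l)) ` {..<length u}"
    by (simp add: image_image add_ac)
  then show ?case using Cons level_Suc[of n C k] by auto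
qed simp

lemma stabilisation_isotopic:
  assumes n: "n \<ge> 1" and u: "valid_diagram n u" and v: "valid_diagram n v" and s: "\<bar>s\<bar> = int n"
  shows "isotopic (diagram (Suc n) (u @ [{s}] @ v)) (diagram n (u @ [{}] @ v))"
proof -
  let ?k = "length u" and ?q = "length v" and ?h = "of_int (sgn s) / 2 :: real"
  let ?D = "map (\<lambda>C. (C, {})) u @ map (\<lambda>C. (C, {int n..int n + 0})) [{}] @ map (\<lambda>C. (C, {})) v"
  let ?g = "shift (real n) (real ?k)"
  let ?K = "{p. 0 < p $ 1} \<union> block 0 1 0 1" and ?F = "{pt 0 0 0, pt 0 1 0}"
  let ?T = "crossing 0 0 ?h \<union> (\<lambda>l. straight 1 (1 + real l)) ` {..<?q} \<union> (\<lambda>l. straight 1 (- 1 - real l)) ` {..<?k} \<union>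
     {(pt 1 (1 + real ?q) 0, pt 1 (2 + real ?q) 1), (pt 1 (2 + real ?q) 1, pt 1 (- 1 - real ?k) 1), (pt 1 (- 1 -
       real ?k) 1, pt 1 (- real ?k) 0)}"
  have s0: "s \<noteq> 0" using s n by auto
  have h: "\<bar>?h\<bar> = 1/2" using half_sgn(1)[OF s0] .
  have eq: "tangle_eq (?g ` ?K) (?g ` ?F) (map_prod ?g ?g ` ?T) (map_prod ?g ?g ` {straight 0 0})"
    by (rule tangle_eq_shift[OF stabilisation_tangle[OF h]])
  have T': "map_prod ?g ?g ` {straight 0 0} = fill {int n..int n + 0} ?k [{}]"
    by (simp add: shift_straight fill_level_def)
  have L2: "diagram n (u @ [{}] @ v) = frame n ?D \<union> map_prod ?g ?g ` {straight 0 0}"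
    unfolding T' using diagram_fill[of "{int n..int n + 0}" "[{}]" "[{}]" n u v] n by simp
  have lk: "level (Suc n) ?k {s} {} = level n ?k {} {int n..int n + 0} \<union> letter_edges ?k s"
  proof -
    have "{straight (real j) (real ?k) |j. j \<in> {1..Suc n} \<and> int j \<notin> {int n, int n + 1}} =
      {straight (real j) (real ?k) |j. j \<in> {1..n} \<and> int j \<noteq> int n}" by (auto simp: le_Suc_eq)
    then show ?thesis unfolding level_def by (simp add: s)
  qed
  have img: "(\<lambda>l. straight (real n + 1) (real ?k + (- 1 - real l))) ` {..<?k} = (\<lambda>l. straight (real n + 1) (real
    l)) ` {..<?k}"
  proof -
    have "(\<lambda>l. straight (real n + 1) (real ?k + (- 1 - real l))) ` {..<?k} =
      (\<lambda>l. straight (real n + 1) (real l)) ` (\<lambda>l. ?k - 1 - l) ` {..<?k}"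
      unfolding image_image by (intro image_cong) (auto simp: of_nat_diff algebra_simps)
    also have "(\<lambda>l. ?k - 1 - l) ` {..<?k} = {..<?k}"
    proof (intro equalityI subsetI)
      fix x assume "x \<in> {..<?k}"
      then show "x \<in> (\<lambda>l. ?k - 1 - l) ` {..<?k}" by (intro image_eqI[of _ _ "?k - 1 - x"]) auto
    qed auto
    finally show ?thesis .
  qed
  have gT: "map_prod ?g ?g ` ?T = letter_edges ?k s \<union> (\<lambda>l. straight (real n + 1) (real (Suc ?k) + real l)) ` {..<?q} \<union>
      (\<lambda>l. straight (real n + 1) (real l)) ` {..<?k} \<union>
      {(pt (real n + 1) (real (Suc ?k + ?q)) 0, pt (real n + 1) (real (Suc ?k + ?q) + 1) 1),
       (pt (real n + 1) (real (Suc ?k + ?q) + 1) 1, pt (real n + 1) (- 1) 1), (pt (real n + 1) (- 1) 1, pt (real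
         n + 1) 0 0)}"
    unfolding image_Un image_image shift_straight shift_crossing img
    by (simp add: letter_edges_def s add_ac)
  have r: "return_edges (Suc n) m = return_edges n m \<union>
      {(pt (real n + 1) (real m) 0, pt (real n + 1) (real m + 1) 1),
       (pt (real n + 1) (real m + 1) 1, pt (real n + 1) (- 1) 1), (pt (real n + 1) (- 1) 1, pt (real n + 1) 0
         0)}" for m
    unfolding return_edges_def by (simp add: atLeastAtMostSuc_conv add.commute Un_ac)
  have len: "length (u @ [{s}] @ v) = Suc ?k + ?q" "length ?D = Suc ?k + ?q" by simp_all
  have L1: "diagram (Suc n) (u @ [{s}] @ v) = frame n ?D \<union> map_prod ?g ?g ` ?T"
    unfolding levels_diagram frame_levels len r gT map_append levels_append levels_Suc[OF u]
    by (simp add: levels_Suc[OF v] lk Un_ac insert_commute)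
  have vf: "valid_frame n ?D" using u v unfolding valid_frame_def valid_diagram_def by auto
  have "points (frame n ?D) \<inter> ?g ` ?K \<subseteq> ?g ` ?F"
  proof
    fix p assume p: "p \<in> points (frame n ?D) \<inter> ?g ` ?K"
    then obtain p' where p': "p = ?g p'" "p' \<in> ?K" by blast
    have pn: "p $ 1 \<le> real n" using frame_right[OF vf] p by blast
    then have "p' \<in> block 0 1 0 1" using p' by auto
    then have b: "real_of_int (int n) \<le> p $ 1" "real ?k \<le> p $ 2" "p $ 2 \<le> real (?k + 1)" "p $ 3 \<le> 3/4"
      unfolding p'(1) by (auto simp: block_def)
    have "\<exists>j\<in>{int n..int n + 0}. p = pt (real_of_int j) (real ?k) 0 \<or> p = pt (real_of_int j) (real (?k + 1)) 0"
    proof (rule frame_box[OF vf])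
      fix l assume "?k \<le> l" "l < ?k + 1"
      then have "l = ?k" by simp
      then show "{int n..int n + 0} \<subseteq> snd (?D ! l)" by (simp add: nth_append)
    qed (use b p pn in auto)
    then show "p \<in> ?g ` ?F" by (auto simp: add.commute)
  qed
  moreover have "is_link (frame n ?D \<union> map_prod ?g ?g ` ?T)"
    unfolding L1[symmetric]
  proof (rule is_link_diagram)
    have V: "valid_level n C {} \<Longrightarrow> valid_level (Suc n) C {}" for C unfolding valid_level_def by auto
    have "valid_diagram (Suc n) w" if "valid_diagram n w" for w
      using that V unfolding valid_diagram_def by blast
    moreover have "valid_level (Suc n) {s} {}" using s n unfolding valid_level_def by simp
    ultimately show "valid_diagram (Suc n) (u @ [{s}] @ v)" using u v by simp
  qed simp
  ultimately show ?thesis unfolding L1 L2 using tangle_eq_isotopic[OF eq] by blast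
qed

section \<open>A representation of the braid groups\<close>

type_synonym state = "nat \<Rightarrow> bool"

text \<open>
  The action of a positive generator, a rescaled \<open>R\<close>-matrix of quantum \<open>sl\<^sub>2\<close>: for \<open>q = t\<^sup>1\<^sup>/\<^sup>2\<close> it is the
  identity on \<open>00\<close> and \<open>11\<close>, and the symmetric matrix with rows \<open>(1 - t, q)\<close> and \<open>(q, 0)\<close> on \<open>10\<close> and \<open>01\<close>. Its
  eigenvalues are \<open>1\<close> and \<open>-t\<close>. The symmetric form makes cups slide past strands with a factor that does
  not depend on the state.
\<close>

definition hop :: "'a::comm_ring_1 \<Rightarrow> nat \<Rightarrow> (state \<Rightarrow> 'a) \<Rightarrow> state \<Rightarrow> 'a" where
  "hop q i f s = (if s i = s (Suc i) then f s
     else if s i then (1 - q * q) * f s + q * f (s(i := False, Suc i := True))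
     else q * f (s(i := True, Suc i := False)))"

text \<open>
  Normal form for states near three adjacent sites; in terms of it, identities between operators on
  these sites are checked case by case.
\<close>

definition set3 :: "state \<Rightarrow> nat \<Rightarrow> bool \<Rightarrow> bool \<Rightarrow> bool \<Rightarrow> state" where
  "set3 s i a b c = s(i := a, Suc i := b, Suc (Suc i) := c)"

lemma set3_simps [simp]:
  "set3 s i a b c i = a" "set3 s i a b c (Suc i) = b" "set3 s i a b c (Suc (Suc i)) = c"
  "(set3 s i a b c)(i := x, Suc i := y) = set3 s i x y c"
  "(set3 s i a b c)(Suc i := x, Suc (Suc i) := y) = set3 s i a x y"
  by (auto simp: set3_def fun_eq_iff)

lemma set3_eq: "set3 s i (s i) (s (Suc i)) (s (Suc (Suc i))) = s"
  by (simp add: set3_def)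

lemma hop_braid: "hop q i (hop q (Suc i) (hop q i f)) = hop q (Suc i) (hop q i (hop q (Suc i) f))"
proof
  fix s
  have "hop q i (hop q (Suc i) (hop q i f)) (set3 s i a b c) = hop q (Suc i) (hop q i (hop q (Suc i) f)) (set3 s
    i a b c)" for a b c
    by (cases a; cases b; cases c; simp add: hop_def algebra_simps)
  from this[of "s i" "s (Suc i)" "s (Suc (Suc i))"]
  show "hop q i (hop q (Suc i) (hop q i f)) s = hop q (Suc i) (hop q i (hop q (Suc i) f)) s"
    unfolding set3_eq .
qed

lemma hop_far:
  assumes "i + 2 \<le> j" shows "hop q i (hop q j f) = hop q j (hop q i f)"
proof
  fix s :: state
  have tw: "s(j := c, Suc j := d, i := a, Suc i := b) = s(i := a, Suc i := b, j := c, Suc j := d)" for a b c d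
    using assms by (auto simp: fun_eq_iff)
  show "hop q i (hop q j f) s = hop q j (hop q i f) s"
    using assms by (cases "s i"; cases "s (Suc i)"; cases "s j"; cases "s (Suc j)"; simp add: hop_def tw
      algebra_simps)
qed

text \<open>
  The Hecke relation \<open>(\<sigma> - 1)(\<sigma> + t) = 0\<close>.
\<close>

lemma hop_quadratic: "hop q i (hop q i f) = (\<lambda>s. (1 - q * q) * hop q i f s + q * q * f s)"
proof
  fix s :: state
  have tw: "s(i := a, Suc i := b, i := c, Suc i := d) = s(i := c, Suc i := d)" for a b c d
    by (auto simp: fun_eq_iff)
  have id: "s i = a \<Longrightarrow> s (Suc i) = b \<Longrightarrow> s(i := a, Suc i := b) = s" for a b by (auto simp: fun_eq_iff)
  show "hop q i (hop q i f) s = (1 - q * q) * hop q i f s + q * q * f s"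
    by (cases "s i"; cases "s (Suc i)"; simp add: hop_def tw id algebra_simps)
qed

lemma hop_linear: "hop q i (\<lambda>s. a * f s + b * g s) = (\<lambda>s. a * hop q i f s + b * hop q i g s)"
  by (auto simp: hop_def fun_eq_iff algebra_simps)

lemma hop_scale: "hop q i (\<lambda>s. a * f s) = (\<lambda>s. a * hop q i f s)"
  using hop_linear[of q i a f 0 f] by simp

definition remove2 :: "nat \<Rightarrow> state \<Rightarrow> state" where
  "remove2 i s = (\<lambda>j. if j < i then s j else s (Suc (Suc j)))"

definition insert2 :: "nat \<Rightarrow> bool \<Rightarrow> bool \<Rightarrow> state \<Rightarrow> state" where
  "insert2 i a b s = (\<lambda>j. if j < i then s j else if j = i then a else if j = Suc i then b else s (j - 2))"

text \<open>
  Creates a pair of strands in the eigenvector \<open>q [10] - [01]\<close> of \<open>hop\<close> for the eigenvalue \<open>-t\<close>; \<open>cap\<close> is its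
  transpose.
\<close>

definition cup :: "'a::comm_ring_1 \<Rightarrow> nat \<Rightarrow> (state \<Rightarrow> 'a) \<Rightarrow> state \<Rightarrow> 'a" where
  "cup q i g s = (if s i = s (Suc i) then 0 else if s i then q * g (remove2 i s) else - g (remove2 i s))"

definition cap :: "'a::comm_ring_1 \<Rightarrow> nat \<Rightarrow> (state \<Rightarrow> 'a) \<Rightarrow> state \<Rightarrow> 'a" where
  "cap q i f s = q * f (insert2 i True False s) - f (insert2 i False True s)"

lemma insert2_remove2: "insert2 i a b (remove2 i s) = s(i := a, Suc i := b)"
  by (auto simp: insert2_def remove2_def fun_eq_iff Suc_diff_Suc numeral_2_eq_2)

text \<open>
  On two sites \<open>1 - hop\<close> has rank one: up to a factor it is a generator of the Temperley--Lieb algebra.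
\<close>

lemma cup_cap: "f s - hop q i f s = cup q i (cap q i f) s"
proof -
  have id: "s i = a \<Longrightarrow> s (Suc i) = b \<Longrightarrow> s(i := a, Suc i := b) = s" for a b by (auto simp: fun_eq_iff)
  show ?thesis
    by (cases "s i"; cases "s (Suc i)"; simp add: hop_def cup_def cap_def insert2_remove2 id algebra_simps)
qed

lemma hop_cup: "hop q i (cup q i g) = (\<lambda>s. - (q * q) * cup q i g s)"
proof
  fix s
  have r: "remove2 i (s(i := a, Suc i := b)) = remove2 i s" for a b
    by (auto simp: remove2_def fun_eq_iff)
  show "hop q i (cup q i g) s = - (q * q) * cup q i g s"
    by (cases "s i"; cases "s (Suc i)"; simp add: hop_def cup_def r algebra_simps)
qed

lemma hop_cup_left:
  assumes "k + 2 \<le> i" shows "hop q k (cup q i g) = cup q i (hop q k g)"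
proof
  fix s
  have r: "remove2 i (s(k := a, Suc k := b)) = (remove2 i s)(k := a, Suc k := b)" for a b
    using assms by (auto simp: remove2_def fun_eq_iff)
  have r': "remove2 i s k = s k" "remove2 i s (Suc k) = s (Suc k)" using assms by (auto simp: remove2_def)
  show "hop q k (cup q i g) s = cup q i (hop q k g) s"
    using assms by (cases "s i"; cases "s (Suc i)"; cases "s k"; cases "s (Suc k)"; simp add: hop_def cup_def r
      r' algebra_simps)
qed

lemma hop_cup_right:
  assumes "i \<le> k" shows "hop q (k + 2) (cup q i g) = cup q i (hop q k g)"
proof
  fix s
  have r: "remove2 i (s(k + 2 := a, Suc (k + 2) := b)) = (remove2 i s)(k := a, Suc k := b)" for a b
    using assms by (auto simp: remove2_def fun_eq_iff)
  have r': "remove2 i s k = s (k + 2)" "remove2 i s (Suc k) = s (Suc (k + 2))" using assms by (auto simp: remove2_def)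
  have ne: "k + 2 \<noteq> i" "k + 2 \<noteq> Suc i" "Suc (k + 2) \<noteq> i" "Suc (k + 2) \<noteq> Suc i" using assms by auto
  show "hop q (k + 2) (cup q i g) s = cup q i (hop q k g) s"
    unfolding hop_def cup_def r r' using ne
    by (cases "s i"; cases "s (Suc i)"; cases "s (k + 2)"; cases "s (Suc (k + 2))"; simp add: r algebra_simps
      del: add_2_eq_Suc')
qed

lemma remove2_set3: "remove2 i (set3 s i a b c) = (remove2 i s)(i := c)"
  "remove2 (Suc i) (set3 s i a b c) = (remove2 i s)(i := a)"
  by (auto simp: remove2_def set3_def fun_eq_iff less_Suc_eq)

text \<open>
  A strand that crosses both legs of a cup can be pulled off it, with a factor \<open>q\<close>.
\<close>

lemma hop_hop_cup: "hop q i (hop q (Suc i) (cup q i g)) = (\<lambda>s. q * cup q (Suc i) g s)"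
proof
  fix s
  have "hop q i (hop q (Suc i) (cup q i g)) (set3 s i a b c) = q * cup q (Suc i) g (set3 s i a b c)" for a b c
    by (cases a; cases b; cases c; simp add: hop_def cup_def remove2_set3 algebra_simps)
  from this[of "s i" "s (Suc i)" "s (Suc (Suc i))"]
  show "hop q i (hop q (Suc i) (cup q i g)) s = q * cup q (Suc i) g s" unfolding set3_eq .
qed

lemma hop_hop_cup': "hop q (Suc i) (hop q i (cup q (Suc i) g)) = (\<lambda>s. q * cup q i g s)"
proof
  fix s
  have "hop q (Suc i) (hop q i (cup q (Suc i) g)) (set3 s i a b c) = q * cup q i g (set3 s i a b c)" for a b c
    by (cases a; cases b; cases c; simp add: hop_def cup_def remove2_set3 algebra_simps)
  from this[of "s i" "s (Suc i)" "s (Suc (Suc i))"]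
  show "hop q (Suc i) (hop q i (cup q (Suc i) g)) s = q * cup q i g s" unfolding set3_eq .
qed

section \<open>The full twist\<close>

abbreviation hops :: "'a::comm_ring_1 \<Rightarrow> nat list \<Rightarrow> (state \<Rightarrow> 'a) \<Rightarrow> state \<Rightarrow> 'a" where
  "hops q ks f \<equiv> foldr (hop q) ks f"

text \<open>
  The action of \<open>\<sigma>\<^sub>1 \<dots> \<sigma>\<^sub>n\<^sub>-\<^sub>1\<close>, the \<open>n\<close>-th root of the full twist.
\<close>

definition cycle :: "'a::comm_ring_1 \<Rightarrow> nat \<Rightarrow> (state \<Rightarrow> 'a) \<Rightarrow> state \<Rightarrow> 'a" where
  "cycle q n f = hops q [1..<n] f"

lemma hops_scale: "hops q ks (\<lambda>s. a * f s) = (\<lambda>s. a * hops q ks f s)"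
  by (induction ks) (simp_all add: hop_scale)

lemma hops_far:
  assumes "\<And>k. k \<in> set ks \<Longrightarrow> k + 2 \<le> i \<or> i + 2 \<le> k"
  shows "hop q i (hops q ks f) = hops q ks (hop q i f)"
  using assms
proof (induction ks)
  case (Cons k ks)
  have "hop q i (hop q k g) = hop q k (hop q i g)" for g
    using Cons.prems[of k] hop_far[of k i q g] hop_far[of i k q g] by auto
  then show ?case using Cons by simp
qed simp

lemma hops_cup_left:
  assumes "\<And>k. k \<in> set ks \<Longrightarrow> k + 2 \<le> i" shows "hops q ks (cup q i g) = cup q i (hops q ks g)"
  using assms by (induction ks) (simp_all add: hop_cup_left)

lemma hops_cup_right:
  assumes "\<And>k. k \<in> set ks \<Longrightarrow> i \<le> k" shows "hops q (map (\<lambda>k. k + 2) ks) (cup q i g) = cup q i (hops q ks g)"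
  using assms
proof (induction ks)
  case (Cons k ks)
  then show ?case using hop_cup_right[of i k q] by simp
qed simp

lemma upt_split2:
  assumes "1 \<le> i" "i + 2 \<le> n"
  shows "[1..<n] = [1..<i] @ [i, Suc i] @ [i + 2..<n]"
proof -
  have "[1..<n] = [1..<i] @ [i..<n]" using assms upt_add_eq_append[of 1 i "n - i"] by simp
  also have "[i..<n] = i # Suc i # [i + 2..<n]" using assms by (simp add: upt_conv_Cons)
  finally show ?thesis by simp
qed

lemma cycle_scale: "cycle q n (\<lambda>s. a * f s) = (\<lambda>s. a * cycle q n f s)"
  unfolding cycle_def by (rule hops_scale)

text \<open>
  Conjugation by \<open>\<sigma>\<^sub>1 \<dots> \<sigma>\<^sub>n\<^sub>-\<^sub>1\<close> shifts the generators.
\<close>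

lemma cycle_hop:
  assumes i: "1 \<le> i" "i + 2 \<le> n"
  shows "cycle q n (hop q i f) = hop q (Suc i) (cycle q n f)"
proof -
  have "cycle q n (hop q i f) = hops q [1..<i] (hop q i (hop q (Suc i) (hops q [i + 2..<n] (hop q i f))))"
    unfolding cycle_def upt_split2[OF i] by simp
  also have "hops q [i + 2..<n] (hop q i f) = hop q i (hops q [i + 2..<n] f)"
    by (rule hops_far[symmetric]) simp
  also have "hop q i (hop q (Suc i) (hop q i (hops q [i + 2..<n] f))) =
    hop q (Suc i) (hop q i (hop q (Suc i) (hops q [i + 2..<n] f)))" by (rule hop_braid)
  also have "hops q [1..<i] (hop q (Suc i) (hop q i (hop q (Suc i) (hops q [i + 2..<n] f)))) =
     hop q (Suc i) (hops q [1..<i] (hop q i (hop q (Suc i) (hops q [i + 2..<n] f))))"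
    by (rule hops_far[symmetric]) auto
  also have "\<dots> = hop q (Suc i) (cycle q n f)" unfolding cycle_def upt_split2[OF i] by simp
  finally show ?thesis .
qed

lemma cycle_hops:
  assumes "\<And>k. k \<in> set ks \<Longrightarrow> 1 \<le> k \<and> k + 2 \<le> n"
  shows "cycle q n (hops q ks f) = hops q (map Suc ks) (cycle q n f)"
  using assms by (induction ks) (simp_all add: cycle_hop)

lemma cycle_last:
  assumes "2 \<le> n" shows "cycle q n f = hops q [1..<n - 1] (hop q (n - 1) f)"
proof -
  have "[1..<n] = [1..<n - 1] @ [n - 1]" using assms upt_Suc_append[of 1 "n - 1"] by simp
  then show ?thesis unfolding cycle_def by simp
qed

text \<open>
  Two more steps take the last generator back to the first one.
\<close>

lemma cycle_cycle_hop:
  assumes n: "2 \<le> n"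
  shows "cycle q n (cycle q n (hop q (n - 1) f)) = hop q 1 (cycle q n (cycle q n f))"
proof -
  have "[1..<n] = 1 # map Suc [1..<n - 1]" using n by (simp add: map_Suc_upt upt_conv_Cons numeral_2_eq_2)
  then have c: "cycle q n g = hop q 1 (hops q (map Suc [1..<n - 1]) g)" for g unfolding cycle_def by simp
  have "cycle q n (cycle q n f) = cycle q n (hops q [1..<n - 1] (hop q (n - 1) f))"
    unfolding cycle_last[OF n, of q f] ..
  also have "\<dots> = hops q (map Suc [1..<n - 1]) (cycle q n (hop q (n - 1) f))"
    by (rule cycle_hops) auto
  finally show ?thesis using c by simp
qed

definition twist :: "'a::comm_ring_1 \<Rightarrow> nat \<Rightarrow> (state \<Rightarrow> 'a) \<Rightarrow> state \<Rightarrow> 'a" where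
  "twist q n = cycle q n ^^ n"

lemma cycles_hop:
  assumes "1 \<le> i" "i + k + 1 \<le> n"
  shows "(cycle q n ^^ k) (hop q i f) = hop q (i + k) ((cycle q n ^^ k) f)"
  using assms
proof (induction k)
  case (Suc k)
  then have "(cycle q n ^^ Suc k) (hop q i f) = cycle q n (hop q (i + k) ((cycle q n ^^ k) f))" by simp
  also have "\<dots> = hop q (Suc (i + k)) (cycle q n ((cycle q n ^^ k) f))" by (rule cycle_hop) (use Suc.prems in auto)
  finally show ?case by simp
qed simp

text \<open>
  The full twist is central: \<open>\<sigma>\<^sub>i\<close> is shifted up to \<open>\<sigma>\<^sub>n\<^sub>-\<^sub>1\<close>, in two steps to \<open>\<sigma>\<^sub>1\<close>, and then back to \<open>\<sigma>\<^sub>i\<close>,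
  which takes \<open>n\<close> factors altogether.
\<close>

lemma twist_hop:
  assumes i: "1 \<le> i" "i < n"
  shows "twist q n (hop q i f) = hop q i (twist q n f)"
proof -
  let ?c = "cycle q n" and ?j = "n - 1 - i"
  have n: "n = (i - 1) + Suc (Suc ?j)" "2 \<le> n" using i by auto
  have split: "twist q n g = (?c ^^ (i - 1)) (?c (?c ((?c ^^ ?j) g)))" for g
    using arg_cong[OF n(1), of "\<lambda>k. (?c ^^ k) g"] unfolding twist_def funpow_add funpow.simps comp_apply .
  have "twist q n (hop q i f) = (?c ^^ (i - 1)) (?c (?c (hop q (i + ?j) ((?c ^^ ?j) f))))"
    unfolding split by (subst cycles_hop) (use i in auto)
  also have "i + ?j = n - 1" using i by auto
  also have "?c (?c (hop q (n - 1) ((?c ^^ ?j) f))) = hop q 1 (?c (?c ((?c ^^ ?j) f)))"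
    by (rule cycle_cycle_hop[OF n(2)])
  also have "(?c ^^ (i - 1)) \<dots> = hop q (1 + (i - 1)) ((?c ^^ (i - 1)) (?c (?c ((?c ^^ ?j) f))))"
    by (rule cycles_hop) (use i in auto)
  finally show ?thesis unfolding split using i by simp
qed

text \<open>
  A cup is shifted in the same way as a generator. Exactly one of the strands passes both of its legs,
  and the other strands are permuted as in the cyclic braid on \<open>n - 2\<close> strands.
\<close>

lemma cycle_cup:
  assumes i: "1 \<le> i" "i + 2 \<le> n"
  shows "cycle q n (cup q i g) = (\<lambda>s. q * cup q (Suc i) (cycle q (n - 2) g) s)"
proof -
  have m: "map (\<lambda>k. k + 2) [i..<n - 2] = [i + 2..<n]" by (rule nth_equalityI) auto
  have "cycle q n (cup q i g) = hops q [1..<i] (hop q i (hop q (Suc i) (hops q [i + 2..<n] (cup q i g))))"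
    unfolding cycle_def upt_split2[OF i] by simp
  also have "hops q [i + 2..<n] (cup q i g) = cup q i (hops q [i..<n - 2] g)"
    unfolding m[symmetric] by (rule hops_cup_right) simp
  also have "hop q i (hop q (Suc i) (cup q i (hops q [i..<n - 2] g))) = (\<lambda>s. q * cup q (Suc i) (hops q [i..<n -
    2] g) s)"
    by (rule hop_hop_cup)
  also have "hops q [1..<i] (\<lambda>s. q * cup q (Suc i) (hops q [i..<n - 2] g) s) =
    (\<lambda>s. q * cup q (Suc i) (hops q [1..<i] (hops q [i..<n - 2] g)) s)"
    unfolding hops_scale by (subst hops_cup_left) auto
  also have "hops q [1..<i] (hops q [i..<n - 2] g) = cycle q (n - 2) g"
  proof -
    have "[1..<n - 2] = [1..<i] @ [i..<n - 2]" using i upt_add_eq_append[of 1 i "n - 2 - i"] by simp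
    then show ?thesis unfolding cycle_def by simp
  qed
  finally show ?thesis .
qed

lemma cycles_cup:
  assumes "1 \<le> i" "i + k + 1 \<le> n"
  shows "(cycle q n ^^ k) (cup q i g) = (\<lambda>s. q ^ k * cup q (i + k) ((cycle q (n - 2) ^^ k) g) s)"
  using assms
proof (induction k)
  case (Suc k)
  then have "(cycle q n ^^ Suc k) (cup q i g) = cycle q n (\<lambda>s. q ^ k * cup q (i + k) ((cycle q (n - 2) ^^ k) g)
    s)" by simp
  also have "\<dots> = (\<lambda>s. q ^ k * cycle q n (cup q (i + k) ((cycle q (n - 2) ^^ k) g)) s)" by (rule cycle_scale)
  also have "cycle q n (cup q (i + k) ((cycle q (n - 2) ^^ k) g)) =
     (\<lambda>s. q * cup q (Suc (i + k)) (cycle q (n - 2) ((cycle q (n - 2) ^^ k) g)) s)"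
    by (rule cycle_cup) (use Suc.prems in auto)
  finally show ?case by (simp add: mult_ac)
qed simp

lemma hops_hops_cup:
  assumes "2 \<le> n"
  shows "hops q [2..<n] (hops q [1..<n - 1] (cup q (n - 1) g)) = (\<lambda>s. q ^ (n - 2) * cup q 1 g s)"
  using assms
proof (induction n rule: nat_induct_at_least)
  case base
  then show ?case by simp
next
  case (Suc n)
  have u: "[2..<Suc n] = [2..<n] @ [n]" "[1..<n] = [1..<n - 1] @ [n - 1]"
    using Suc.hyps upt_Suc_append[of 1 "n - 1"] by simp_all
  have "hops q [2..<Suc n] (hops q [1..<Suc n - 1] (cup q (Suc n - 1) g)) =
     hops q [2..<n] (hop q n (hops q [1..<n - 1] (hop q (n - 1) (cup q n g))))"
    using u by simp
  also have "hop q n (hops q [1..<n - 1] (hop q (n - 1) (cup q n g))) =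
     hops q [1..<n - 1] (hop q n (hop q (n - 1) (cup q n g)))" by (rule hops_far) auto
  also have "hop q n (hop q (n - 1) (cup q n g)) = (\<lambda>s. q * cup q (n - 1) g s)"
    using hop_hop_cup'[of q "n - 1" g] Suc.hyps by simp
  finally have "hops q [2..<Suc n] (hops q [1..<Suc n - 1] (cup q (Suc n - 1) g)) = (\<lambda>s. q * (q ^ (n - 2) * cup
    q 1 g s))"
    by (simp only: hops_scale Suc.IH)
  moreover have "Suc n - 2 = Suc (n - 2)" using Suc.hyps by simp
  ultimately show ?case by (simp add: mult_ac)
qed

text \<open>
  Going around, the cup is twisted by a full turn, which contributes \<open>(-t)\<^sup>2 = q\<^sup>4\<close>, and each of the
  \<open>n - 2\<close> other strands passes it once.
\<close>

lemma cycle_cycle_cup: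
  assumes n: "2 \<le> n"
  shows "cycle q n (cycle q n (cup q (n - 1) g)) = (\<lambda>s. q ^ (n + 2) * cup q 1 g s)"
proof -
  have c: "cycle q n (cup q (n - 1) g) = (\<lambda>s. - (q * q) * hops q [1..<n - 1] (cup q (n - 1) g) s)"
    unfolding cycle_last[OF n] hop_cup hops_scale ..
  have "cycle q n (cycle q n (cup q (n - 1) g)) = (\<lambda>s. - (q * q) * cycle q n (hops q [1..<n - 1] (cup q (n - 1)
    g)) s)"
    unfolding c cycle_scale ..
  also have "cycle q n (hops q [1..<n - 1] (cup q (n - 1) g)) = hops q (map Suc [1..<n - 1]) (cycle q n (cup q
    (n - 1) g))"
    by (rule cycle_hops) auto
  also have "map Suc [1..<n - 1] = [2..<n]" using n by (simp add: map_Suc_upt numeral_2_eq_2)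
  also have "hops q [2..<n] (cycle q n (cup q (n - 1) g)) = (\<lambda>s. - (q * q) * (q ^ (n - 2) * cup q 1 g s))"
    unfolding c hops_scale hops_hops_cup[OF n] ..
  finally have "cycle q n (cycle q n (cup q (n - 1) g)) = (\<lambda>s. q ^ 4 * q ^ (n - 2) * cup q 1 g s)"
    by (simp add: power4_eq_xxxx mult_ac)
  moreover have "q ^ 4 * q ^ (n - 2) = q ^ (n + 2)" unfolding power_add[symmetric] using n by simp
  ultimately show ?thesis by simp
qed

text \<open>
  The central fact: a full twist passes through a cup and becomes a full twist on \<open>n - 2\<close> strands, with
  the factor \<open>q\<^sup>2\<^sup>n = t\<^sup>n\<close>. As for the generators, the cup goes once around; the exponents of \<open>q\<close>
  collected on the way are \<open>n - 1 - i\<close>, \<open>n + 2\<close> and \<open>i - 1\<close>.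
\<close>

lemma twist_cup:
  assumes i: "1 \<le> i" "i < n"
  shows "twist q n (cup q i g) = (\<lambda>s. q ^ (2 * n) * cup q i ((cycle q (n - 2) ^^ (n - 2)) g) s)"
proof -
  let ?c = "cycle q n" and ?d = "cycle q (n - 2)" and ?j = "n - 1 - i"
  have n: "n = (i - 1) + Suc (Suc ?j)" "2 \<le> n" using i by auto
  have sc: "(?c ^^ k) (\<lambda>s. a * f s) = (\<lambda>s. a * (?c ^^ k) f s)" for k a f
    by (induction k) (simp_all add: cycle_scale)
  have "twist q n (cup q i g) = (?c ^^ (i - 1)) (?c (?c ((?c ^^ ?j) (cup q i g))))"
    using arg_cong[OF n(1), of "\<lambda>k. (?c ^^ k) (cup q i g)"] unfolding twist_def funpow_add funpow.simps comp_apply .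
  also have "(?c ^^ ?j) (cup q i g) = (\<lambda>s. q ^ ?j * cup q (n - 1) ((?d ^^ ?j) g) s)"
    using cycles_cup[of i ?j n q g] i by simp
  also have "?c (?c (\<lambda>s. q ^ ?j * cup q (n - 1) ((?d ^^ ?j) g) s)) = (\<lambda>s. q ^ ?j * (q ^ (n + 2) * cup q 1 ((?d
    ^^ ?j) g) s))"
    unfolding cycle_scale cycle_cycle_cup[OF n(2)] ..
  also have "(?c ^^ (i - 1)) (\<lambda>s. q ^ ?j * (q ^ (n + 2) * cup q 1 ((?d ^^ ?j) g) s)) =
     (\<lambda>s. q ^ ?j * (q ^ (n + 2) * (q ^ (i - 1) * cup q i ((?d ^^ (i - 1)) ((?d ^^ ?j) g)) s)))"
    unfolding sc using cycles_cup[of 1 "i - 1" n q "(?d ^^ ?j) g"] i by simp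
  also have "(?d ^^ (i - 1)) ((?d ^^ ?j) g) = (?d ^^ (n - 2)) g"
  proof -
    have "n - 2 = (i - 1) + ?j" using i by auto
    then show ?thesis by (simp add: funpow_add)
  qed
  also have "(\<lambda>s. q ^ ?j * (q ^ (n + 2) * (q ^ (i - 1) * cup q i ((?d ^^ (n - 2)) g) s))) =
     (\<lambda>s. q ^ (2 * n) * cup q i ((?d ^^ (n - 2)) g) s)"
  proof -
    have "q ^ ?j * (q ^ (n + 2) * q ^ (i - 1)) = q ^ (2 * n)"
      unfolding power_add[symmetric] using i by (intro arg_cong[where f = "\<lambda>k. q ^ k"]) auto
    then show ?thesis by (simp add: mult.assoc[symmetric])
  qed
  finally show ?thesis .
qed

section \<open>Braids with a full twist act without negative powers\<close>

lemma t_half_add: "t_half a * t_half b = t_half (a + b)"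
  by (simp add: t_half_def mult_single)

lemma t_half_0: "t_half 0 = 1"
  by (simp add: t_half_def)

lemma t_half_power: "t_half a ^ k = t_half (int k * a)"
  by (induction k) (simp_all add: t_half_0 t_half_add algebra_simps)

definition no_poles :: "half_laurent set" where
  "no_poles = {p. \<forall>k\<in>Poly_Mapping.keys p. 0 \<le> k}"

lemma no_poles_add: "p \<in> no_poles \<Longrightarrow> r \<in> no_poles \<Longrightarrow> p + r \<in> no_poles"
  unfolding no_poles_def using Poly_Mapping.keys_add[of p r] by auto

lemma no_poles_uminus: "p \<in> no_poles \<Longrightarrow> - p \<in> no_poles"
  unfolding no_poles_def by (simp add: in_keys_iff)

lemma no_poles_diff: "p \<in> no_poles \<Longrightarrow> r \<in> no_poles \<Longrightarrow> p - r \<in> no_poles"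
  using no_poles_add[of p "- r"] no_poles_uminus[of r] by simp

lemma no_poles_mult: "p \<in> no_poles \<Longrightarrow> r \<in> no_poles \<Longrightarrow> p * r \<in> no_poles"
  unfolding no_poles_def using Poly_Mapping.keys_mult[of p r] by fastforce

lemma no_poles_t_half: "0 \<le> k \<Longrightarrow> t_half k \<in> no_poles"
  unfolding no_poles_def t_half_def by simp

lemma no_poles_01: "0 \<in> no_poles" "1 \<in> no_poles"
  using no_poles_t_half[of 0] by (simp_all add: t_half_0) (simp add: no_poles_def)

lemma no_poles_sum: "(\<And>x. x \<in> A \<Longrightarrow> f x \<in> no_poles) \<Longrightarrow> sum f A \<in> no_poles"
  by (induction A rule: infinite_finite_induct) (auto intro: no_poles_add simp: no_poles_01)

lemmas no_poles_intros = no_poles_add no_poles_uminus no_poles_diff no_poles_mult no_poles_t_half no_poles_01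

definition regular :: "(state \<Rightarrow> half_laurent) \<Rightarrow> bool" where
  "regular f \<longleftrightarrow> (\<forall>s. f s \<in> no_poles)"

abbreviation q_half :: half_laurent where "q_half \<equiv> t_half 1"

lemma q_square: "q_half * q_half = t_half 2" by (simp add: t_half_add)

lemma regular_hop: "regular f \<Longrightarrow> regular (hop q_half i f)"
  unfolding regular_def hop_def by (auto intro!: no_poles_intros)

lemma regular_cup: "regular f \<Longrightarrow> regular (cup q_half i f)"
  unfolding regular_def cup_def by (auto intro!: no_poles_intros)

lemma regular_cap: "regular f \<Longrightarrow> regular (cap q_half i f)"
  unfolding regular_def cap_def by (auto intro!: no_poles_intros)

lemma regular_cycles: "regular f \<Longrightarrow> regular ((cycle q_half n ^^ k) f)"
proof (induction k)
  case (Suc k)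
  have "regular (hops q_half ks g)" if "regular g" for ks g using that by (induction ks) (auto intro: regular_hop)
  then show ?case using Suc unfolding cycle_def by simp
qed simp

text \<open>
  The inverse of \<open>hop\<close>, in the form \<open>1 - t\<^sup>-\<^sup>1 (1 - \<sigma>)\<close> that shows where its negative power of \<open>t\<close> comes
  from.
\<close>

definition unhop :: "nat \<Rightarrow> (state \<Rightarrow> half_laurent) \<Rightarrow> state \<Rightarrow> half_laurent" where
  "unhop i f s = f s - t_half (- 2) * (f s - hop q_half i f s)"

definition act1 :: "int \<Rightarrow> (state \<Rightarrow> half_laurent) \<Rightarrow> state \<Rightarrow> half_laurent" where
  "act1 s = (if s > 0 then hop q_half (nat s) else unhop (nat (- s)))"

definition act :: "int list \<Rightarrow> (state \<Rightarrow> half_laurent) \<Rightarrow> state \<Rightarrow> half_laurent" where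
  "act w f = foldr act1 w f"

lemma act_simps [simp]: "act [] f = f" "act (s # w) f = act1 s (act w f)" "act (u @ v) f = act u (act v f)"
  by (simp_all add: act_def)

lemma t_inverse: "t_half (- 2) * t_half 2 = 1" by (simp add: t_half_add t_half_0)

lemma hop_unhop: "hop q_half i (unhop i f) = f" and unhop_hop: "unhop i (hop q_half i f) = f"
proof -
  have u: "unhop i g = (\<lambda>s. (1 - t_half (- 2)) * g s + t_half (- 2) * hop q_half i g s)" for g
    by (auto simp: unhop_def fun_eq_iff algebra_simps)
  have t: "t_half 2 * (t_half (- 2) * x) = x" "x * (t_half 2 * t_half (- 2)) = x" for x
    unfolding mult.assoc[symmetric] t_half_add by (simp_all add: mult.assoc t_half_add t_half_0)
  show "hop q_half i (unhop i f) = f" unfolding u hop_linear hop_quadratic q_square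
    by (auto simp: fun_eq_iff algebra_simps t)
  show "unhop i (hop q_half i f) = f" unfolding u hop_quadratic q_square
    by (auto simp: fun_eq_iff algebra_simps t)
qed

lemma hop_skein: "hop q_half i f s = t_half 2 * unhop i f s + (1 - t_half 2) * f s"
proof -
  define x where "x = t_half (- 2) * (f s - hop q_half i f s)"
  have "t_half 2 * x = f s - hop q_half i f s"
    unfolding x_def mult.assoc[symmetric] t_half_add by (simp add: t_half_0)
  then show ?thesis unfolding unhop_def x_def[symmetric] by (simp add: algebra_simps)
qed

lemma act1_linear: "act1 s (\<lambda>x. a * f x + b * g x) = (\<lambda>x. a * act1 s f x + b * act1 s g x)"
  unfolding act1_def unhop_def by (auto simp: hop_linear fun_eq_iff algebra_simps)

lemma act_linear: "act w (\<lambda>x. a * f x + b * g x) = (\<lambda>x. a * act w f x + b * act w g x)"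
  by (induction w) (simp_all add: act1_linear)

lemma act_braid_step:
  assumes "braid_step n x y" shows "act x f = act y f"
  using assms
proof cases
  case (cancel u s v)
  have "s \<noteq> 0" using cancel(3) unfolding braid_word_def by auto
  then have "act1 s (act1 (- s) g) = g" for g
    unfolding act1_def using hop_unhop unhop_hop by auto
  then show ?thesis using cancel by simp
next
  case (far u i j v)
  have "nat i + 2 \<le> nat j" "0 < i" "0 < j" using far by auto
  then show ?thesis using far hop_far[of "nat i" "nat j" q_half] by (simp add: act1_def)
next
  case (braid u i v)
  have "nat (i + 1) = Suc (nat i)" "0 < i" using braid by auto
  then show ?thesis using braid hop_braid[of q_half "nat i"] by (simp add: act1_def)
qed

lemma act_skein:
  assumes "1 \<le> i"
  shows "act (u @ [i] @ v) f s = t_half 2 * act (u @ [- i] @ v) f s + (1 - t_half 2) * act (u @ v) f s"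
proof -
  have "act1 i g = (\<lambda>s. t_half 2 * act1 (- i) g s + (1 - t_half 2) * g s)" for g
    unfolding act1_def using assms hop_skein by (auto simp: fun_eq_iff)
  then show ?thesis by (simp add: act_linear)
qed

lemma act_full_twist: "act (full_twist n) f = twist q_half n f"
proof -
  have "map nat [1..int n - 1] = [1..<n]" for n
    by (rule nth_equalityI) (auto simp: nth_upto)
  moreover have "act w f = hops q_half (map nat w) f" if "\<forall>s\<in>set w. 0 < s" for w f
    using that by (induction w) (simp_all add: act1_def)
  ultimately have c: "act [1..int n - 1] f = cycle q_half n f" for f
    unfolding cycle_def by simp
  have "act (concat (replicate k [1..int n - 1])) f = (cycle q_half n ^^ k) f" for k
    by (induction k) (simp_all add: c)
  then show ?thesis unfolding full_twist_def twist_def .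
qed

lemma twist_linear: "twist q_half n (\<lambda>x. a * f x + b * g x) = (\<lambda>x. a * twist q_half n f x + b * twist q_half n g x)"
  unfolding act_full_twist[symmetric] by (rule act_linear)

text \<open>
  The functions that may be divided by \<open>t\<close> for each of up to \<open>n\<close> negative crossings, because a full twist
  makes up for it.
\<close>

definition twist_divisible :: "nat \<Rightarrow> (state \<Rightarrow> half_laurent) \<Rightarrow> bool" where
  "twist_divisible n f \<longleftrightarrow> regular f \<and> regular (\<lambda>s. t_half (- 2 * int n) * twist q_half n f s)"

lemma twist_divisible_linear:
  assumes "twist_divisible n f" "twist_divisible n g" "a \<in> no_poles" "b \<in> no_poles"
  shows "twist_divisible n (\<lambda>s. a * f s + b * g s)"
proof -
  have eq: "t_half (- 2 * int n) * twist q_half n (\<lambda>s. a * f s + b * g s) s =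
     a * (t_half (- 2 * int n) * twist q_half n f s) + b * (t_half (- 2 * int n) * twist q_half n g s)" for s
    unfolding twist_linear by (simp add: algebra_simps)
  show ?thesis unfolding twist_divisible_def regular_def eq
    using assms(1,2) unfolding twist_divisible_def regular_def 
    by (intro conjI allI; intro no_poles_add[OF no_poles_mult[OF assms(3)] no_poles_mult[OF assms(4)]]; blast)
qed

lemma twist_divisible_hop:
  assumes "twist_divisible n f" "1 \<le> i" "i < n" shows "twist_divisible n (hop q_half i f)"
  using assms regular_hop[of "\<lambda>s. t_half (- 2 * int n) * twist q_half n f s" i] regular_hop[of f i]
  unfolding twist_divisible_def hop_scale twist_hop[OF assms(2,3)] by simp

lemma twist_divisible_cup_cap:
  assumes f: "regular f" and i: "1 \<le> i" "i < n"
  shows "twist_divisible n (\<lambda>s. f s - hop q_half i f s)"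
proof -
  let ?g = "cup q_half i ((cycle q_half (n - 2) ^^ (n - 2)) (cap q_half i f))"
  have eq: "(\<lambda>s. f s - hop q_half i f s) = cup q_half i (cap q_half i f)" by (simp add: cup_cap)
  have c: "t_half (- 2 * int n) * (q_half ^ (2 * n) * x) = x" for x
    unfolding t_half_power mult.assoc[symmetric] t_half_add by (simp add: t_half_0)
  have "(\<lambda>s. t_half (- 2 * int n) * twist q_half n (cup q_half i (cap q_half i f)) s) = ?g"
    unfolding twist_cup[OF i] c ..
  then show ?thesis unfolding twist_divisible_def eq using f
    by (simp add: regular_cup regular_cap regular_cycles)
qed

lemma num_neg_simps [simp]: "num_neg [] = 0" "num_neg (s # w) = (if s < 0 then Suc (num_neg w) else num_neg w)"
  by (simp_all add: num_neg_def)

text \<open>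
  Expanding \<open>\<sigma>\<^sup>-\<^sup>1 = 1 - t\<^sup>-\<^sup>1 (1 - \<sigma>)\<close> for all negative letters, each term with a negative power of \<open>t\<close>
  contains a factor \<open>1 - \<sigma>\<^sub>i\<close>, whose image is divisible after a full twist. The other letters preserve
  this divisibility because the full twist is central.
\<close>

lemma act_decomposition:
  assumes f: "regular f" and w: "braid_word n w"
  shows "\<exists>P Z. act w f = (\<lambda>s. P s + t_half (- 2 * int (num_neg w)) * Z s) \<and> regular P \<and> twist_divisible n Z"
  using w
proof (induction w)
  case Nil
  have "twist_divisible n (\<lambda>s. 0 * f s + 0 * f s)"
    unfolding twist_divisible_def twist_linear by (simp add: regular_def no_poles_01)
  then have "twist_divisible n (\<lambda>_. 0)" by simp
  then show ?case using f by (intro exI[of _ f] exI[of _ "\<lambda>_. 0"]) simp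
next
  case (Cons s w)
  have s: "1 \<le> \<bar>s\<bar>" "\<bar>s\<bar> < int n" "braid_word n w" using Cons.prems unfolding braid_word_def by auto
  obtain P Z where PZ: "act w f = (\<lambda>s. P s + t_half (- 2 * int (num_neg w)) * Z s)" "regular P" "twist_divisible n Z"
    using Cons.IH[OF s(3)] by blast
  let ?e = "t_half (- 2 * int (num_neg w))"
  have lin: "hop q_half i (\<lambda>s. P s + ?e * Z s) = (\<lambda>s. hop q_half i P s + ?e * hop q_half i Z s)" for i
    using hop_linear[of q_half i 1 P ?e Z] by simp
  show ?case
  proof (cases "s > 0")
    case True
    then have i: "1 \<le> nat s" "nat s < n" using s by auto
    have "act (s # w) f = (\<lambda>x. hop q_half (nat s) P x + ?e * hop q_half (nat s) Z x)"
      using True PZ(1) lin by (simp add: act1_def)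
    then show ?thesis using True regular_hop[OF PZ(2)] twist_divisible_hop[OF PZ(3) i]
      by (intro exI[of _ "hop q_half (nat s) P"] exI[of _ "hop q_half (nat s) Z"]) simp
  next
    case False
    then have i: "1 \<le> nat (- s)" "nat (- s) < n" "s < 0" using s by auto
    let ?i = "nat (- s)" and ?e' = "t_half (- 2 * int (num_neg (s # w)))" and ?d = "t_half (2 * int (num_neg w))"
    let ?UP = "\<lambda>x. P x - hop q_half ?i P x" and ?UZ = "\<lambda>x. Z x - hop q_half ?i Z x"
    \<comment> \<open>\<open>\<sigma>\<^sup>-\<^sup>1 = 1 - t\<^sup>-\<^sup>1 (1 - \<sigma>)\<close>, with all terms except \<open>P\<close> put over the new denominator.\<close>
    define Z' where "Z' = (\<lambda>x. 1 * (t_half 2 * Z x + (- ?d) * ?UP x) + (- 1) * ?UZ x)"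
    have rZ: "regular Z" using PZ(3) unfolding twist_divisible_def by blast
    have d: "?d \<in> no_poles" "t_half 2 \<in> no_poles" by (auto intro: no_poles_t_half)
    have "twist_divisible n Z'" unfolding Z'_def
      by (intro twist_divisible_linear PZ twist_divisible_cup_cap rZ i no_poles_uminus d no_poles_01)
    moreover have "act (s # w) f = (\<lambda>x. P x + ?e' * Z' x)"
    proof
      fix x
      have e: "?e' * t_half 2 = ?e" "?e' * ?d = t_half (- 2)" "t_half (- 2) * ?e = ?e'"
        using i by (simp_all add: t_half_add)
      have "act (s # w) f x = P x + ?e * Z x - t_half (- 2) * (?UP x + ?e * ?UZ x)"
        using False PZ(1) lin by (simp add: act1_def unhop_def algebra_simps)
      also have "\<dots> = P x + ?e * Z x - t_half (- 2) * ?UP x - (t_half (- 2) * ?e) * ?UZ x" by (simp add: algebra_simps)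
      also have "\<dots> = P x + (?e' * t_half 2) * Z x - (?e' * ?d) * ?UP x - ?e' * ?UZ x" unfolding e ..
      also have "\<dots> = P x + ?e' * Z' x" unfolding Z'_def by (simp add: algebra_simps)
      finally show "act (s # w) f x = P x + ?e' * Z' x" .
    qed
    ultimately show ?thesis using PZ(2) by blast
  qed
qed

lemma regular_twisted:
  assumes f: "regular f" and w: "braid_word n w" "num_neg w \<le> n"
  shows "regular (act (full_twist n @ w) f)"
proof -
  obtain P Z where PZ: "act w f = (\<lambda>s. P s + t_half (- 2 * int (num_neg w)) * Z s)" "regular P" "twist_divisible n Z"
    using act_decomposition[OF f w(1)] by blast
  let ?e = "t_half (- 2 * int (num_neg w))" and ?d = "t_half (2 * (int n - int (num_neg w)))"
  have "act (full_twist n @ w) f = (\<lambda>s. twist q_half n P s + ?e * twist q_half n Z s)"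
    using twist_linear[of n 1 P ?e Z] PZ(1) by (simp add: act_full_twist)
  also have "\<dots> = (\<lambda>s. twist q_half n P s + ?d * (t_half (- 2 * int n) * twist q_half n Z s))"
    unfolding mult.assoc[symmetric] t_half_add by (simp add: algebra_simps)
  finally have eq: "act (full_twist n @ w) f = (\<lambda>s. twist q_half n P s + ?d * (t_half (- 2 * int n) * twist
    q_half n Z s))" .
  have "regular (twist q_half n P)" unfolding twist_def using regular_cycles[OF PZ(2)] .
  moreover have "?d \<in> no_poles" using w(2) by (intro no_poles_t_half) simp
  ultimately show ?thesis using PZ(3) unfolding eq twist_divisible_def regular_def
    by (intro allI, intro no_poles_add[OF _ no_poles_mult]; blast)
qed

section \<open>The Markov trace of the representation\<close>

text \<open>
  The basis function of \<open>S\<close>, but constant in all sites outside \<open>{1..n}\<close>: then restricting it to a fixed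
  value in site \<open>n + 1\<close> yields basis functions for \<open>n\<close> strands.
\<close>

definition agrees :: "nat \<Rightarrow> nat set \<Rightarrow> state \<Rightarrow> half_laurent" where
  "agrees n S s = (if \<forall>j\<in>{1..n}. s j \<longleftrightarrow> j \<in> S then 1 else 0)"

definition weighted_trace :: "nat \<Rightarrow> int list \<Rightarrow> half_laurent" where
  "weighted_trace n w = (\<Sum>S\<in>Pow {1..n}. t_half (2 * int (card S)) * act w (agrees n S) (\<lambda>j. j \<in> S))"

lemma weighted_trace_braid_step: "braid_step n x y \<Longrightarrow> weighted_trace m x = weighted_trace m y"
  unfolding weighted_trace_def using act_braid_step[of n x y] by simp

lemma weighted_trace_skein:
  assumes "1 \<le> i"
  shows "weighted_trace n (u @ [i] @ v) = t_half 2 * weighted_trace n (u @ [- i] @ v) + (1 - t_half 2) *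
    weighted_trace n (u @ v)"
  unfolding weighted_trace_def act_skein[OF assms]
  by (simp add: sum_distrib_left sum.distrib[symmetric] algebra_simps del: append.simps act_simps)

lemma act_vacuum: "act w f (\<lambda>_. False) = f (\<lambda>_. False)"
  by (induction w) (simp_all add: act1_def unhop_def hop_def)

text \<open>
  The state without ones is fixed by all operators, which gives the constant term \<open>1\<close>.
\<close>

lemma weighted_trace_twisted:
  assumes "braid_word n w" "num_neg w \<le> n"
  shows "\<exists>p\<in>no_poles. weighted_trace n (full_twist n @ w) = 1 + t_half 2 * p"
proof -
  let ?f = "\<lambda>S. act (full_twist n @ w) (agrees n S) (\<lambda>j. j \<in> S)"
  have reg: "?f S \<in> no_poles" for S
  proof -
    have "regular (agrees n S)" unfolding regular_def agrees_def by (simp add: no_poles_01)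
    then show ?thesis using regular_twisted[OF _ assms] unfolding regular_def by blast
  qed
  have e: "?f {} = 1" using act_vacuum[of "full_twist n @ w" "agrees n {}"] by (simp add: agrees_def)
  \<comment> \<open>All states but the empty one, whose term is \<open>1\<close>, have a weight divisible by \<open>t\<close>.\<close>
  define p where "p = (\<Sum>S\<in>Pow {1..n} - {{}}. t_half (2 * (int (card S) - 1)) * ?f S)"
  have "p \<in> no_poles" unfolding p_def
  proof (rule no_poles_sum)
    fix S assume S: "S \<in> Pow {1..n} - {{}}"
    then have "finite S" by (auto intro: finite_subset)
    then have "card S \<noteq> 0" using S by auto
    then show "t_half (2 * (int (card S) - 1)) * ?f S \<in> no_poles" by (intro no_poles_mult no_poles_t_half reg) simp
  qed
  moreover have "weighted_trace n (full_twist n @ w) = 1 + t_half 2 * p"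
  proof -
    have "weighted_trace n (full_twist n @ w) = t_half (2 * int (card ({}::nat set))) * ?f {} + (\<Sum>S\<in>Pow {1..n} -
      {{}}. t_half (2 * int (card S)) * ?f S)"
      unfolding weighted_trace_def by (rule sum.remove) auto
    also have "(\<Sum>S\<in>Pow {1..n} - {{}}. t_half (2 * int (card S)) * ?f S) = t_half 2 * p"
      unfolding p_def sum_distrib_left mult.assoc[symmetric] t_half_add by (simp add: algebra_simps)
    finally show ?thesis using e by (simp add: t_half_0)
  qed
  ultimately show ?thesis by blast
qed

text \<open>
  Words on \<open>n\<close> strands act on functions in which the site \<open>n + 1\<close> is frozen.
\<close>

lemma act_slice:
  assumes "braid_word n w"
  shows "act w f (s(Suc n := b)) = act w (\<lambda>s. f (s(Suc n := b))) s"
  using assms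
proof (induction w arbitrary: s)
  case (Cons a w)
  have a: "1 \<le> \<bar>a\<bar>" "\<bar>a\<bar> < int n" "braid_word n w" using Cons.prems unfolding braid_word_def by auto
  have h: "hop q_half i g (s(Suc n := b)) = hop q_half i (\<lambda>s. g (s(Suc n := b))) s" if "i < n" for i g
  proof -
    have tw: "s(Suc n := b, i := x, Suc i := y) = s(i := x, Suc i := y, Suc n := b)" for x y
      using that by (auto simp: fun_eq_iff)
    show ?thesis using that by (simp add: hop_def tw)
  qed
  have h': "act1 a g (s(Suc n := b)) = act1 a (\<lambda>s. g (s(Suc n := b))) s" for g
    using h[of "nat a"] h[of "nat (- a)"] a unfolding act1_def unhop_def by auto
  show ?case by (simp only: act_simps h' Cons.IH[OF a(3)])
qed simp

lemma agrees_slice: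
  assumes "S \<subseteq> {1..n}"
  shows "agrees (Suc n) S (s(Suc n := b)) = (if b then 0 else agrees n S s)"
    "agrees (Suc n) (insert (Suc n) S) (s(Suc n := b)) = (if b then agrees n S s else 0)"
proof -
  have "Suc n \<notin> S" using assms by auto
  moreover have "{1..Suc n} = insert (Suc n) {1..n}" by auto
  ultimately show "agrees (Suc n) S (s(Suc n := b)) = (if b then 0 else agrees n S s)"
    "agrees (Suc n) (insert (Suc n) S) (s(Suc n := b)) = (if b then agrees n S s else 0)"
    unfolding agrees_def by auto
qed

lemma sum_Pow_Suc:
  "(\<Sum>S\<in>Pow {1..Suc n}. f S) = (\<Sum>S\<in>Pow {1..n}. f S + f (insert (Suc n) S))" for f :: "nat set \<Rightarrow> half_laurent"
proof -
  have P: "Pow {1..Suc n} = Pow {1..n} \<union> insert (Suc n) ` Pow {1..n}"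
  proof -
    have "{1..Suc n} = insert (Suc n) {1..n}" by auto
    then show ?thesis by (simp only: Pow_insert)
  qed
  have inj: "inj_on (insert (Suc n)) (Pow {1..n})"
    by (rule inj_onI) (auto simp: set_eq_iff; metis Suc_n_not_le_n atLeastAtMost_iff subsetD)
  have "Pow {1..n} \<inter> insert (Suc n) ` Pow {1..n} = {}" by auto
  then have "(\<Sum>S\<in>Pow {1..Suc n}. f S) = sum f (Pow {1..n}) + sum f (insert (Suc n) ` Pow {1..n})"
    unfolding P by (intro sum.union_disjoint) auto
  also have "sum f (insert (Suc n) ` Pow {1..n}) = (\<Sum>S\<in>Pow {1..n}. f (insert (Suc n) S))"
    using sum.reindex[OF inj, of f] by simp
  finally show ?thesis by (simp add: sum.distrib)
qed

lemma state_of_insert: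
  assumes "S \<subseteq> {1..n}"
  shows "(\<lambda>j. j \<in> S) = (\<lambda>j. j \<in> S)(Suc n := False)" "(\<lambda>j. j \<in> insert (Suc n) S) = (\<lambda>j. j \<in> S)(Suc n := True)"
  using assms by (auto simp: fun_eq_iff)

lemma card_insert_Suc: "S \<subseteq> {1..n} \<Longrightarrow> card (insert (Suc n) S) = Suc (card S)"
  by (subst card_insert_disjoint) (auto intro: finite_subset)

text \<open>
  The additional site contributes \<open>1\<close> if it is empty and \<open>t\<close> if it is occupied.
\<close>

lemma weighted_trace_Suc:
  assumes "braid_word n a"
  shows "weighted_trace (Suc n) a = (1 + t_half 2) * weighted_trace n a"
proof -
  have "t_half (2 * int (card S)) * act a (agrees (Suc n) S) (\<lambda>j. j \<in> S) +
     t_half (2 * int (card (insert (Suc n) S))) * act a (agrees (Suc n) (insert (Suc n) S)) (\<lambda>j. j \<in> insert (Suc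
       n) S) =
     (1 + t_half 2) * (t_half (2 * int (card S)) * act a (agrees n S) (\<lambda>j. j \<in> S))" if "S \<in> Pow {1..n}" for S
  proof -
    have S: "S \<subseteq> {1..n}" using that by simp
    have "act a (agrees (Suc n) S) (\<lambda>j. j \<in> S) = act a (agrees n S) (\<lambda>j. j \<in> S)"
      by (subst state_of_insert(1)[OF S], subst act_slice[OF assms]) (simp add: agrees_slice[OF S])
    moreover have "act a (agrees (Suc n) (insert (Suc n) S)) (\<lambda>j. j \<in> insert (Suc n) S) = act a (agrees n S)
      (\<lambda>j. j \<in> S)"
      by (subst state_of_insert(2)[OF S], subst act_slice[OF assms]) (simp add: agrees_slice[OF S])
    moreover have "t_half (2 * int (card (insert (Suc n) S))) = t_half 2 * t_half (2 * int (card S))"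
      unfolding card_insert_Suc[OF S] t_half_add by simp
    ultimately show ?thesis by (simp add: algebra_simps)
  qed
  then show ?thesis unfolding weighted_trace_def sum_Pow_Suc sum_distrib_left by (rule sum.cong[OF refl])
qed

text \<open>
  The weighted partial trace of \<open>hop\<close> over its second site is the identity: on \<open>0\<close> it is \<open>1 + t \<cdot> 0\<close>, and on
  \<open>1\<close> it is \<open>(1 - t) + t \<cdot> 1\<close>. This fixes the weights.
\<close>

lemma weighted_trace_stabilise:
  assumes n: "n \<ge> 1" and a: "braid_word n a" and b: "braid_word n b"
  shows "weighted_trace (Suc n) (a @ [int n] @ b) = weighted_trace n (a @ b)"
proof -
  have "t_half (2 * int (card S)) * act (a @ [int n] @ b) (agrees (Suc n) S) (\<lambda>j. j \<in> S) +
     t_half (2 * int (card (insert (Suc n) S))) * act (a @ [int n] @ b) (agrees (Suc n) (insert (Suc n) S)) (\<lambda>j.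
       j \<in> insert (Suc n) S) =
     t_half (2 * int (card S)) * act (a @ b) (agrees n S) (\<lambda>j. j \<in> S)" if "S \<in> Pow {1..n}" for S
  proof -
    have S: "S \<subseteq> {1..n}" using that by simp
    let ?k = "act b (agrees n S)" and ?x = "\<lambda>j. j \<in> S"
    let ?g0 = "act b (agrees (Suc n) S)" and ?g1 = "act b (agrees (Suc n) (insert (Suc n) S))"
    have zero: "act w (\<lambda>_. 0) = (\<lambda>_. 0)" for w
      using act_linear[of w 0 "\<lambda>_. 0" 0 "\<lambda>_. 0"] by simp
    have g: "?g0 (s(Suc n := c)) = (if c then 0 else ?k s)" "?g1 (s(Suc n := c)) = (if c then ?k s else 0)" for s c
      unfolding act_slice[OF b] agrees_slice[OF S] by (simp_all add: zero)
    let ?h0 = "\<lambda>s. hop q_half n ?g0 (s(Suc n := False))" and ?h1 = "\<lambda>s. hop q_half n ?g1 (s(Suc n := True))"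
    have tw: "s(Suc n := z, n := x, Suc n := y) = (s(n := x))(Suc n := y)" for s :: state and x y z
      by (auto simp: fun_eq_iff)
    have h: "1 * ?h0 s + t_half 2 * ?h1 s = ?k s" for s
      by (simp add: hop_def q_square tw g algebra_simps)
    have an: "act1 (int n) = hop q_half n" using n by (simp add: act1_def)
    have "act (a @ [int n] @ b) (agrees (Suc n) S) ?x = act a ?h0 ?x"
    proof -
      have "act (a @ [int n] @ b) (agrees (Suc n) S) (?x(Suc n := False)) = act a ?h0 ?x"
        unfolding act_simps act_slice[OF a] an ..
      then show ?thesis by (simp only: state_of_insert(1)[OF S, symmetric])
    qed
    moreover have "act (a @ [int n] @ b) (agrees (Suc n) (insert (Suc n) S)) (\<lambda>j. j \<in> insert (Suc n) S) = act a
      ?h1 ?x"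
    proof -
      have "act (a @ [int n] @ b) (agrees (Suc n) (insert (Suc n) S)) (?x(Suc n := True)) = act a ?h1 ?x"
        unfolding act_simps act_slice[OF a] an ..
      then show ?thesis by (simp only: state_of_insert(2)[OF S])
    qed
    moreover have "act (a @ b) (agrees n S) ?x = 1 * act a ?h0 ?x + t_half 2 * act a ?h1 ?x"
      using act_linear[of a 1 ?h0 "t_half 2" ?h1] h by simp
    moreover have "t_half (2 * int (card (insert (Suc n) S))) = t_half 2 * t_half (2 * int (card S))"
      unfolding card_insert_Suc[OF S] t_half_add by simp
    ultimately show ?thesis by (simp add: algebra_simps del: act_simps)
  qed
  then show ?thesis unfolding weighted_trace_def sum_Pow_Suc by (rule sum.cong[OF refl])
qed

lemma weighted_trace_one: "weighted_trace 1 [] = 1 + t_half 2"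
proof -
  have "Pow {1..1::nat} = {{}, {1}}" by auto
  then show ?thesis unfolding weighted_trace_def by (simp add: agrees_def t_half_0)
qed

section \<open>Uniqueness of the Markov trace\<close>

lemma braid_word_append [simp]: "braid_word n (u @ v) \<longleftrightarrow> braid_word n u \<and> braid_word n v"
  and braid_word_Cons [simp]: "braid_word n (s # v) \<longleftrightarrow> 1 \<le> \<bar>s\<bar> \<and> \<bar>s\<bar> < int n \<and> braid_word n v"
  and braid_word_Nil [simp]: "braid_word n []"
  by (auto simp: braid_word_def)

lemma braid_word_mono: "braid_word m w \<Longrightarrow> m \<le> n \<Longrightarrow> braid_word n w"
  unfolding braid_word_def by fastforce

lemma braid_word_1: "braid_word 1 w \<longleftrightarrow> w = []"
  unfolding braid_word_def by (cases w) auto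

text \<open>
  Functionals on braid words that factor through the Hecke algebra.
\<close>

definition hecke_functional :: "nat \<Rightarrow> (int list \<Rightarrow> half_laurent) \<Rightarrow> bool" where
  "hecke_functional n D \<longleftrightarrow> (\<forall>x y. braid_step n x y \<longrightarrow> D x = D y) \<and>
     (\<forall>u i v. braid_word n (u @ [i] @ v) \<longrightarrow> 1 \<le> i \<longrightarrow>
        D (u @ [i] @ v) = t_half 2 * D (u @ [- i] @ v) + (1 - t_half 2) * D (u @ v))"

lemma hecke_skein:
  assumes "hecke_functional n D" "braid_word n (u @ [i] @ v)" "1 \<le> i"
  shows "D (u @ [i] @ v) = t_half 2 * D (u @ [- i] @ v) + (1 - t_half 2) * D (u @ v)"
  using assms unfolding hecke_functional_def by blast

lemma braid_step_words: "braid_step n x y \<Longrightarrow> braid_word n x \<and> braid_word n y"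
  by (induction rule: braid_step.induct) auto

lemma braid_step_context:
  assumes "braid_step n x y" "braid_word n p" "braid_word n r"
  shows "braid_step n (p @ x @ r) (p @ y @ r)"
  using assms(1)
proof cases
  case (cancel u s v)
  then show ?thesis using braid_step.cancel[of n "p @ u" s "v @ r"] assms(2,3) by simp
next
  case (far u i j v)
  then show ?thesis using braid_step.far[of n "p @ u" i j "v @ r"] assms(2,3) by simp
next
  case (braid u i v)
  then show ?thesis using braid_step.braid[of n "p @ u" i "v @ r"] assms(2,3) by simp
qed

lemma hecke_functional_context:
  assumes D: "hecke_functional n D" and p: "braid_word n p" and r: "braid_word n r"
  shows "hecke_functional n (\<lambda>x. D (p @ x @ r))"
  unfolding hecke_functional_def
proof (intro conjI allI impI)
  fix x y assume "braid_step n x y"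
  then show "D (p @ x @ r) = D (p @ y @ r)"
    using D braid_step_context[OF _ p r] unfolding hecke_functional_def by blast
next
  fix u i v assume "braid_word n (u @ [i] @ v)" "1 \<le> i"
  then show "D (p @ (u @ [i] @ v) @ r) = t_half 2 * D (p @ (u @ [- i] @ v) @ r) + (1 - t_half 2) * D (p @ (u @
    v) @ r)"
    using hecke_skein[OF D, of "p @ u" i "v @ r"] p r by simp
qed

lemma hecke_cancel:
  assumes "hecke_functional n D" "braid_word n (u @ v)" "1 \<le> \<bar>s\<bar>" "\<bar>s\<bar> < int n"
  shows "D (u @ [s, - s] @ v) = D (u @ v)"
  using assms braid_step.cancel[of n u s v] unfolding hecke_functional_def by simp

text \<open>
  The defining relations mention positive letters only; for a negative letter, insert a cancelling
  pair.
\<close>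

lemma hecke_far:
  assumes D: "hecke_functional n D" and w: "braid_word n (u @ v)" and s: "1 \<le> \<bar>s\<bar>" "\<bar>s\<bar> + 2 \<le> j" "j < int n"
  shows "D (u @ [s, j] @ v) = D (u @ [j, s] @ v)"
proof -
  have st: "D (u' @ [\<bar>s\<bar>, j] @ v') = D (u' @ [j, \<bar>s\<bar>] @ v')" if "braid_word n (u' @ v')" for u' v'
    using D braid_step.far[of n u' "\<bar>s\<bar>" j v'] that s unfolding hecke_functional_def by auto
  show ?thesis
  proof (cases "s > 0")
    case True
    then show ?thesis using st[OF w] by simp
  next
    case False
    then have s': "\<bar>s\<bar> = - s" by simp
    have "D (u @ [s, j] @ v) = D ((u @ [s, j]) @ [- s, - (- s)] @ v)"
      using hecke_cancel[OF D, of "u @ [s, j]" v "- s"] w s by simp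
    also have "\<dots> = D ((u @ [s]) @ [j, \<bar>s\<bar>] @ ([s] @ v))" using s' by simp
    also have "\<dots> = D ((u @ [s]) @ [\<bar>s\<bar>, j] @ ([s] @ v))"
      by (rule st[symmetric]) (use w s in auto)
    also have "\<dots> = D (u @ [s, - s] @ ([j, s] @ v))" using s' by simp
    also have "\<dots> = D (u @ [j, s] @ v)"
      using hecke_cancel[OF D, of u "[j, s] @ v" s] w s by simp
    finally show ?thesis .
  qed
qed

lemma hecke_pass:
  assumes D: "hecke_functional N D" and n: "n < N" and z: "braid_word (n - 1) z"
    and w: "braid_word N (u @ v)"
  shows "D (u @ [int n] @ z @ v) = D (u @ z @ [int n] @ v)"
  using z w
proof (induction z arbitrary: u)
  case (Cons s z)
  have s: "1 \<le> \<bar>s\<bar>" "\<bar>s\<bar> + 2 \<le> int n" "braid_word (n - 1) z" using Cons.prems(1) by auto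
  have zN: "braid_word N z" using s(3) n by (auto intro: braid_word_mono)
  have "D (u @ [int n] @ (s # z) @ v) = D (u @ [int n, s] @ (z @ v))" by simp
  also have "\<dots> = D (u @ [s, int n] @ (z @ v))"
    by (rule hecke_far[OF D, symmetric]) (use s n zN Cons.prems in auto)
  also have "\<dots> = D ((u @ [s]) @ [int n] @ z @ v)" by simp
  also have "\<dots> = D ((u @ [s]) @ z @ [int n] @ v)"
    by (rule Cons.IH[OF s(3)]) (use Cons.prems s n in auto)
  finally show ?case by simp
qed simp

lemma hecke_sign:
  assumes D: "hecke_functional n D" and w: "braid_word n (u @ v)" and s: "\<bar>s\<bar> = int i" "1 \<le> i" "i < n"
    and zero: "D (u @ [int i] @ v) = 0" "D (u @ v) = 0"
  shows "D (u @ [s] @ v) = 0"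
proof (cases "s > 0")
  case True
  then show ?thesis using s zero by auto
next
  case False
  then have s': "s = - int i" using s by auto
  have "D (u @ [int i] @ v) = t_half 2 * D (u @ [- int i] @ v) + (1 - t_half 2) * D (u @ v)"
    using hecke_skein[OF D, of u "int i" v] w s by simp
  then have "t_half (- 2) * (t_half 2 * D (u @ [- int i] @ v)) = 0" using zero by simp
  then show ?thesis unfolding s' mult.assoc[symmetric] t_inverse by simp
qed

lemma hecke_square:
  assumes D: "hecke_functional n D" and w: "braid_word n (u @ v)" and i: "1 \<le> i" "i < n"
    and zero: "D (u @ [int i] @ v) = 0" "D (u @ v) = 0"
  shows "D (u @ [int i, int i] @ v) = 0"
proof -
  have "D ((u @ [int i]) @ [int i] @ v) =
     t_half 2 * D ((u @ [int i]) @ [- int i] @ v) + (1 - t_half 2) * D ((u @ [int i]) @ v)"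
    using hecke_skein[OF D, of "u @ [int i]" "int i" v] w i by simp
  also have "D ((u @ [int i]) @ [- int i] @ v) = D (u @ v)"
    using hecke_cancel[OF D w, of "int i"] i by simp
  finally show ?thesis using zero by simp
qed

definition top_letters :: "nat \<Rightarrow> int list \<Rightarrow> nat" where
  "top_letters n w = length (filter (\<lambda>s. \<bar>s\<bar> = int n) w)"

lemma top_letters_append [simp]: "top_letters n (u @ v) = top_letters n u + top_letters n v"
  and top_letters_Cons [simp]: "top_letters n (s # v) = (if \<bar>s\<bar> = int n then Suc (top_letters n v) else
    top_letters n v)"
  by (simp_all add: top_letters_def)

lemma top_letters_0: "braid_word n w \<Longrightarrow> top_letters n w = 0"
  by (induction w) (auto simp: top_letters_def)

lemma top_letters_cases:
  assumes "braid_word (Suc n) w"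
  obtains "braid_word n w"
  | a s b where "w = a @ [s] @ b" "braid_word n a" "\<bar>s\<bar> = int n" "top_letters n w = Suc (top_letters n b)"
proof (cases "\<exists>s\<in>set w. \<bar>s\<bar> = int n")
  case True
  then obtain a s b where w: "w = a @ s # b" "\<bar>s\<bar> = int n" "\<forall>y\<in>set a. \<bar>y\<bar> \<noteq> int n"
    using split_list_first_prop[of w "\<lambda>s. \<bar>s\<bar> = int n"] by blast
  have "braid_word n a" unfolding braid_word_def
  proof
    fix y assume y: "y \<in> set a"
    then have "1 \<le> \<bar>y\<bar>" "\<bar>y\<bar> < int (Suc n)" using assms w(1) unfolding braid_word_def by auto
    moreover have "\<bar>y\<bar> \<noteq> int n" using w(3) y by blast
    ultimately show "1 \<le> \<bar>y\<bar> \<and> \<bar>y\<bar> < int n" by linarith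
  qed
  then show ?thesis using that(2)[of a s b] w top_letters_0[of n a] by simp
next
  case False
  have "braid_word n w" unfolding braid_word_def
  proof
    fix y assume y: "y \<in> set w"
    then have "1 \<le> \<bar>y\<bar>" "\<bar>y\<bar> < int (Suc n)" using assms unfolding braid_word_def by auto
    moreover have "\<bar>y\<bar> \<noteq> int n" using False y by blast
    ultimately show "1 \<le> \<bar>y\<bar> \<and> \<bar>y\<bar> < int n" by linarith
  qed
  then show ?thesis using that(1) by blast
qed

text \<open>
  Every word on \<open>n + 1\<close> strands is a combination of words that contain \<open>\<sigma>\<^sub>n\<close> at most once. Take two
  consecutive letters \<open>\<sigma>\<^sub>n\<close> (negative ones are made positive by the skein relation) and a word \<open>x\<close> on \<open>n\<close>
  strands between them. By induction on \<open>n\<close>, \<open>x\<close> may be assumed to contain \<open>\<sigma>\<^sub>n\<^sub>-\<^sub>1\<close> at most once. If it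
  does not, then the two letters meet and the skein relation applies to their square; if it does, then
  \<open>\<sigma>\<^sub>n \<sigma>\<^sub>n\<^sub>-\<^sub>1 \<sigma>\<^sub>n = \<sigma>\<^sub>n\<^sub>-\<^sub>1 \<sigma>\<^sub>n \<sigma>\<^sub>n\<^sub>-\<^sub>1\<close>. In both cases there are fewer letters \<open>\<sigma>\<^sub>n\<close>.
\<close>

theorem hecke_functional_vanish:
  assumes "1 \<le> n" "n < N" "hecke_functional N D"
    and "\<And>a. braid_word n a \<Longrightarrow> D a = 0"
    and "\<And>a b. braid_word n a \<Longrightarrow> braid_word n b \<Longrightarrow> D (a @ [int n] @ b) = 0"
    and "braid_word (Suc n) w"
  shows "D w = 0"
  using assms
proof (induction n arbitrary: D w)
  case 0
  then show ?case by simp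
next
  case (Suc m)
  let ?n = "Suc m"
  note D = Suc.prems(3) and nN = Suc.prems(2)
  have N: "braid_word N w" if "braid_word ?n w \<or> braid_word (Suc ?n) w" for w
    using that nN braid_word_mono[of _ w N] by auto
  show ?case using Suc.prems(6)
  proof (induction "top_letters ?n w" arbitrary: w rule: less_induct)
    case less
    have IH: "D w' = 0" if "top_letters ?n w' < top_letters ?n w" "braid_word (Suc ?n) w'" for w'
      using less.hyps that by blast
    show ?case using less.prems
    proof (cases rule: top_letters_cases)
      case 1
      then show ?thesis using Suc.prems(4) by blast
    next
      case (2 a s b)
      have b: "braid_word (Suc ?n) b" and aS: "braid_word (Suc ?n) a"
        using less.prems 2(1,2) braid_word_mono[of ?n a "Suc ?n"] by auto
      have ab: "braid_word N (a @ b)" using N b aS by auto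
      have Dab: "D (a @ b) = 0" by (rule IH) (use 2 b aS top_letters_0[OF 2(2)] in auto)
      have "D (a @ [int ?n] @ b) = 0"
        using b
      proof (cases rule: top_letters_cases)
        case 1
        then show ?thesis using Suc.prems(5)[OF 2(2)] by blast
      next
        case b': (2 x s' c)
        have c: "braid_word (Suc ?n) c" and xS: "braid_word (Suc ?n) x"
          using b b'(1,2) braid_word_mono[of ?n x "Suc ?n"] by auto
        have cnt: "top_letters ?n w = Suc (Suc (top_letters ?n c))" using 2(4) b' top_letters_0[OF b'(2)] by simp
        have low: "D y = 0" if "braid_word (Suc ?n) y" "top_letters ?n y \<le> Suc (top_letters ?n c)" for y
          using IH[OF _ that(1)] that(2) cnt by simp
        have ta: "top_letters ?n a = 0" by (rule top_letters_0[OF 2(2)])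
        have axc: "D (a @ [int ?n] @ x @ c) = 0"
          by (rule low) (use aS xS c ta top_letters_0[OF b'(2)] in auto)
        have "D ((a @ [int ?n]) @ x @ ([int ?n] @ c)) = 0"
        proof -
          have ctx: "hecke_functional N (\<lambda>z. D ((a @ [int ?n]) @ z @ ([int ?n] @ c)))"
            by (rule hecke_functional_context[OF D]) (use N aS c nN in auto)
          have zero: "D ((a @ [int ?n]) @ z @ ([int ?n] @ c)) = 0" if z: "braid_word m z" for z
          proof -
            have zS: "braid_word (Suc ?n) z" and zn: "braid_word ?n z" using z by (auto intro: braid_word_mono)
            have "D (a @ [int ?n] @ z @ ([int ?n] @ c)) = D (a @ z @ [int ?n] @ ([int ?n] @ c))"
              by (rule hecke_pass[OF D nN]) (use z N aS c nN in auto)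
            also have "\<dots> = D ((a @ z) @ [int ?n, int ?n] @ c)" by simp
            also have "\<dots> = 0"
            proof (rule hecke_square[OF D])
              show "D ((a @ z) @ [int ?n] @ c) = 0" "D ((a @ z) @ c) = 0"
                by (rule low; use aS zS c ta top_letters_0[OF zn] in auto)+
            qed (use N aS zS c nN in auto)
            finally show ?thesis by simp
          qed
          show ?thesis
          proof (cases "m = 0")
            case True
            then have "x = []" using b'(2) braid_word_1 by simp
            then show ?thesis using zero[of "[]"] by simp
          next
            case False
            show ?thesis
            proof (rule Suc.IH[OF _ _ ctx])
              fix e d assume ed: "braid_word m e" "braid_word m d"
              have eS: "braid_word (Suc ?n) e" "braid_word (Suc ?n) d" and en: "braid_word ?n e" "braid_word ?n d"
                using ed by (auto intro: braid_word_mono)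
              have "D ((a @ [int ?n]) @ (e @ [int m] @ d) @ ([int ?n] @ c)) = D (a @ [int ?n] @ e @ ([int m] @ d
                @ [int ?n] @ c))" by simp
              also have "\<dots> = D (a @ e @ [int ?n] @ ([int m] @ d @ [int ?n] @ c))"
                by (rule hecke_pass[OF D nN]) (use ed False N aS eS c nN in auto)
              also have "\<dots> = D ((a @ e @ [int ?n, int m]) @ d @ [int ?n] @ c)" by simp
              also have "\<dots> = D ((a @ e @ [int ?n, int m]) @ [int ?n] @ d @ c)"
                by (rule hecke_pass[OF D nN, symmetric]) (use ed False N aS eS c nN in auto)
              also have "\<dots> = D ((a @ e) @ [int m + 1, int m, int m + 1] @ (d @ c))" by (simp add: add.commute)
              also have "\<dots> = D ((a @ e) @ [int m, int m + 1, int m] @ (d @ c))"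
              proof -
                have "braid_step N ((a @ e) @ [int m, int m + 1, int m] @ (d @ c)) ((a @ e) @ [int m + 1, int m,
                  int m + 1] @ (d @ c))"
                  by (rule braid_step.braid) (use N aS eS c nN False in auto)
                then show ?thesis using D unfolding hecke_functional_def by metis
              qed
              also have "\<dots> = 0"
                by (rule low) (use aS eS c False ta top_letters_0[OF en(1)] top_letters_0[OF en(2)] in auto)
              finally show "D ((a @ [int ?n]) @ (e @ [int m] @ d) @ ([int ?n] @ c)) = 0" .
            qed (use False nN zero b'(2) in auto)
          qed
        qed
        then have nn: "D ((a @ [int ?n] @ x) @ [int ?n] @ c) = 0" by simp
        have "D ((a @ [int ?n] @ x) @ [s'] @ c) = 0"
          by (rule hecke_sign[OF D _ b'(3) _ _ nn]) (use axc N aS xS c nN in auto)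
        then show ?thesis using b'(1) by simp
      qed
      from hecke_sign[OF D ab 2(3) _ _ this Dab] show ?thesis using 2(1) nN by simp
    qed
  qed
qed

section \<open>The Jones polynomial of closed braids\<close>

abbreviation singles :: "int list \<Rightarrow> int set list" where
  "singles w \<equiv> map (\<lambda>s. {s}) w"

lemma valid_singles: "braid_word n w \<Longrightarrow> valid_diagram n (singles w)"
  unfolding braid_word_def valid_diagram_def valid_level_def by auto

lemma braid_closure_diagram:
  assumes "braid_word n w" shows "braid_closure n w = diagram n (singles w)"
proof -
  have "level_edges n k s = level n k {s} {}" for k s
    unfolding level_edges_def level_def letter_edges_def crossing_def straight_def Let_def by simp
  then show ?thesis unfolding braid_closure_def diagram_alt by simp
qed

definition alternating :: "int \<Rightarrow> half_laurent" where
  "alternating k = (if even k then 1 else - 1)"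

text \<open>
  Chosen so that the skein relation becomes the Hecke relation of the operators \<open>hop\<close>, and so that
  positive stabilisation, which raises the writhe and the number of strands by one, leaves it
  unchanged.
\<close>

definition normalised :: "(edges \<Rightarrow> half_laurent) \<Rightarrow> nat \<Rightarrow> int list \<Rightarrow> half_laurent" where
  "normalised V n w = alternating (writhe w + int n - 1) * t_half (int n - 1 - writhe w) * V (braid_closure n w)"

lemma writhe_simps [simp]: "writhe [] = 0" "writhe (s # w) = sgn s + writhe w" "writhe (u @ v) = writhe u + writhe v"
  by (simp_all add: writhe_def)

lemma alternating_simps: "alternating k * alternating k = 1" "alternating (k + 1) = - alternating k"
  "alternating (k - 1) = - alternating k" "alternating (k + 2) = alternating k"
  by (simp_all add: alternating_def)

lemma writhe_braid_step: "braid_step n x y \<Longrightarrow> writhe x = writhe y"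
  by (induction rule: braid_step.induct) (simp_all add: sgn_minus)

context
  fixes V :: "edges \<Rightarrow> half_laurent"
  assumes V: "jones_polynomial V"
begin

lemma V_isotopic: "is_link L \<Longrightarrow> is_link L' \<Longrightarrow> isotopic L L' \<Longrightarrow> V L = V L'"
  using V unfolding jones_polynomial_def by blast

lemma V_skein_triple:
  "skein_triple Lp Lm L0 \<Longrightarrow> t_half (- 2) * V Lp - t_half 2 * V Lm = (t_half 1 - t_half (- 1)) * V L0"
  using V unfolding jones_polynomial_def by blast

lemma V_diagrams:
  assumes "n \<ge> 1" "m \<ge> 1" "valid_diagram n u" "valid_diagram m v" "isotopic (diagram n u) (diagram m v)"
  shows "V (diagram n u) = V (diagram m v)"
  using V_isotopic is_link_diagram assms by blast

text \<open>
  A cancelling pair leaves two levels without crossings behind, which are dropped.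
\<close>

lemma V_braid_step:
  assumes n: "n \<ge> 1" and step: "braid_step n x y"
  shows "V (braid_closure n x) = V (braid_closure n y)"
proof -
  have w: "braid_word n x" "braid_word n y" using braid_step_words[OF step] by auto
  have "isotopic (diagram n (singles x)) (diagram n (singles y))"
    using step
  proof cases
    case (cancel u s v)
    have s: "1 \<le> \<bar>s\<bar>" "\<bar>s\<bar> < int n" and uv: "valid_diagram n (singles u)" "valid_diagram n (singles v)"
      using cancel(3) by (auto intro: valid_singles)
    have 1: "isotopic (diagram n (singles u @ [{s}, {- s}] @ singles v)) (diagram n (singles u @ [{}, {}] @
      singles v))"
      by (rule cancel_isotopic[OF uv s])
    have 2: "isotopic (diagram n ((singles u @ [{}]) @ [{}] @ singles v)) (diagram n ((singles u @ [{}]) @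
      singles v))"
      by (rule drop_level[OF n _ uv(2)]) (use uv in simp)
    have 3: "isotopic (diagram n (singles u @ [{}] @ singles v)) (diagram n (singles u @ singles v))"
      by (rule drop_level[OF n uv])
    show ?thesis using isotopic_trans[OF 1 isotopic_trans[OF _ 3]] 2 cancel(1,2) by simp
  next
    case (far u i j v)
    then show ?thesis using far_isotopic[of n "singles u" "singles v" i j] valid_singles by simp
  next
    case (braid u i v)
    then show ?thesis using braid_isotopic[of n "singles u" "singles v" i] valid_singles by simp
  qed
  then show ?thesis unfolding braid_closure_diagram[OF w(1)] braid_closure_diagram[OF w(2)]
    using V_diagrams[OF n n] valid_singles w by blast
qed

lemma V_skein:
  assumes w: "braid_word n (u @ [i] @ v)" and i: "1 \<le> i"
  shows "t_half (- 2) * V (braid_closure n (u @ [i] @ v)) - t_half 2 * V (braid_closure n (u @ [- i] @ v)) =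
    (t_half 1 - t_half (- 1)) * V (braid_closure n (u @ v))"
proof -
  have uv: "valid_diagram n (singles u)" "valid_diagram n (singles v)" and iN: "i < int n" and n: "n \<ge> 1"
    using w i by (auto intro: valid_singles)
  have w': "braid_word n (u @ [- i] @ v)" "braid_word n (u @ v)" using w by auto
  have "V (diagram n (singles u @ [{}] @ singles v)) = V (diagram n (singles u @ singles v))"
    by (rule V_diagrams[OF n n _ _ drop_level[OF n uv]]) (use uv in simp_all)
  moreover have sk: "skein_triple (diagram n (singles u @ [{i}] @ singles v)) (diagram n (singles u @ [{- i}] @
    singles v))
     (diagram n (singles u @ [{}] @ singles v))" by (rule skein_triple_diagram[OF uv i iN])
  ultimately show ?thesis using V_skein_triple[OF sk]
    unfolding braid_closure_diagram[OF w] braid_closure_diagram[OF w'(1)] braid_closure_diagram[OF w'(2)]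
      map_append list.map by simp
qed

lemma V_stabilise:
  assumes n: "n \<ge> 1" and a: "braid_word n a" and b: "braid_word n b" and s: "\<bar>s\<bar> = int n"
  shows "V (braid_closure (Suc n) (a @ [s] @ b)) = V (braid_closure n (a @ b))"
proof -
  have ab: "valid_diagram n (singles a)" "valid_diagram n (singles b)" using a b by (auto intro: valid_singles)
  have w: "braid_word (Suc n) (a @ [s] @ b)" "braid_word n (a @ b)"
    using a b s n by (auto intro: braid_word_mono)
  have "isotopic (diagram (Suc n) (singles a @ [{s}] @ singles b)) (diagram n (singles a @ singles b))"
    using isotopic_trans[OF stabilisation_isotopic[OF n ab s] drop_level[OF n ab]] .
  then show ?thesis unfolding braid_closure_diagram[OF w(1)] braid_closure_diagram[OF w(2)]
    using V_diagrams[OF _ n] valid_singles[OF w(1)] valid_singles[OF w(2)] by simp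
qed

lemma V_unknot: "V (braid_closure 1 []) = 1"
proof -
  have triangle: "is_link {(a, b), (b, c), (c, a)} \<Longrightarrow> V {(a, b), (b, c), (c, a)} = 1" for a b c
    using V unfolding jones_polynomial_def by blast
  have eq: "braid_closure 1 [] = {(pt 1 0 0, pt 1 1 1), (pt 1 1 1, pt 1 (- 1) 1), (pt 1 (- 1) 1, pt 1 0 0)}"
    unfolding braid_closure_def return_edges_def by simp
  have "is_link (braid_closure 1 [])"
    using is_link_diagram[of 1 "[]"] braid_closure_diagram[of 1 "[]"] by simp
  then show ?thesis unfolding eq by (rule triangle)
qed

abbreviation "F \<equiv> normalised V"

lemma F_skein:
  assumes w: "braid_word n (u @ [i] @ v)" and i: "1 \<le> i"
  shows "F n (u @ [i] @ v) = t_half 2 * F n (u @ [- i] @ v) + (1 - t_half 2) * F n (u @ v)"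
proof -
  define k where "k = writhe (u @ v) + int n - 1"
  define e where "e = int n - 1 - writhe (u @ v)"
  let ?V1 = "V (braid_closure n (u @ [i] @ v))" and ?V2 = "V (braid_closure n (u @ [- i] @ v))" and ?V0 = "V
    (braid_closure n (u @ v))"
  have wr: "writhe (u @ [i] @ v) = writhe (u @ v) + 1" "writhe (u @ [- i] @ v) = writhe (u @ v) - 1"
    using i by (simp_all add: sgn_minus)
  have F1: "F n (u @ [i] @ v) = - alternating k * t_half (e - 1) * ?V1"
    unfolding normalised_def wr k_def e_def using alternating_simps(2)[of "writhe (u @ v) + int n - 1"]
    by (simp add: algebra_simps del: writhe_simps)
  have F2: "F n (u @ [- i] @ v) = - alternating k * t_half (e + 1) * ?V2"
    unfolding normalised_def wr k_def e_def using alternating_simps(3)[of "writhe (u @ v) + int n - 1"]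
    by (simp add: algebra_simps del: writhe_simps)
  have F0: "F n (u @ v) = alternating k * t_half e * ?V0" unfolding normalised_def k_def e_def ..
  have t: "t_half (e - 1) = t_half (e + 1) * t_half (- 2)" "t_half 2 * t_half (e + 1) = t_half (e + 1) * t_half 2"
    "t_half e = t_half (e + 1) * t_half (- 1)" "t_half 2 * t_half e = t_half (e + 1) * t_half 1"
    unfolding t_half_add by (simp_all add: algebra_simps)
  have "F n (u @ [i] @ v) - t_half 2 * F n (u @ [- i] @ v) =
      - alternating k * t_half (e + 1) * (t_half (- 2) * ?V1 - t_half 2 * ?V2)"
    unfolding F1 F2 t(1) by (simp add: algebra_simps)
  also have "\<dots> = - alternating k * t_half (e + 1) * ((t_half 1 - t_half (- 1)) * ?V0)"
    unfolding V_skein[OF w i] ..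
  also have "\<dots> = alternating k * (t_half (e + 1) * t_half (- 1)) * ?V0 - alternating k * (t_half (e + 1) *
    t_half 1) * ?V0"
    by (simp add: algebra_simps)
  also have "\<dots> = (1 - t_half 2) * F n (u @ v)"
    unfolding F0 t(3,4)[symmetric] by (simp add: algebra_simps)
  finally show ?thesis by (simp add: algebra_simps)
qed

lemma F_braid_step: "n \<ge> 1 \<Longrightarrow> braid_step n x y \<Longrightarrow> F n x = F n y"
  unfolding normalised_def using V_braid_step writhe_braid_step by simp

lemma F_stabilise:
  assumes n: "n \<ge> 1" and a: "braid_word n a" and b: "braid_word n b"
  shows "F (Suc n) (a @ [int n] @ b) = F n (a @ b)" "F (Suc n) (a @ [- int n] @ b) = t_half 2 * F n (a @ b)"
proof -
  have s: "sgn (int n) = 1" using n by simp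
  have e: "int (Suc n) - 1 - (writhe a + (sgn (- int n) + writhe b)) = 2 + (int n - 1 - (writhe a + writhe b))"
    "writhe a + (sgn (int n) + writhe b) + int (Suc n) - 1 = writhe a + writhe b + int n - 1 + 2"
    "writhe a + (sgn (- int n) + writhe b) + int (Suc n) - 1 = writhe a + writhe b + int n - 1"
    "int (Suc n) - 1 - (writhe a + (sgn (int n) + writhe b)) = int n - 1 - (writhe a + writhe b)"
    unfolding sgn_minus s using n by simp_all
  have t2: "t_half (2 + x) = t_half 2 * t_half x" for x by (simp add: t_half_add)
  show "F (Suc n) (a @ [int n] @ b) = F n (a @ b)"
    using V_stabilise[OF n a b, of "int n"]
    unfolding normalised_def writhe_simps e add_0_right alternating_simps by simp
  show "F (Suc n) (a @ [- int n] @ b) = t_half 2 * F n (a @ b)"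
    using V_stabilise[OF n a b, of "- int n"]
    unfolding normalised_def writhe_simps e add_0_right t2 by (simp add: mult_ac)
qed

lemma t_half_cancel:
  assumes "(1 - t_half 2) * p = 0" shows "p = 0"
proof (rule ccontr)
  assume "p \<noteq> 0"
  let ?m = "Min (Poly_Mapping.keys p)"
  have k: "Poly_Mapping.keys p \<noteq> {}" using \<open>p \<noteq> 0\<close> by simp
  have "p = t_half 2 * p" using assms by (simp add: algebra_simps)
  moreover have "Poly_Mapping.keys (t_half 2 * p) \<subseteq> {2 + b |b. b \<in> Poly_Mapping.keys p}"
    using Poly_Mapping.keys_mult[of "t_half 2" p] unfolding t_half_def by auto
  moreover have "?m \<in> Poly_Mapping.keys p" using k by simp
  ultimately obtain b where b: "b \<in> Poly_Mapping.keys p" "?m = 2 + b" by auto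
  have "?m \<le> b" using b(1) by simp
  then show False using b(2) by simp
qed

text \<open>
  Adding an unlinked strand: compare the two stabilisations of \<open>a\<close> by the skein relation and cancel
  \<open>1 - t\<close>.
\<close>

lemma F_Suc:
  assumes n: "n \<ge> 1" and a: "braid_word n a"
  shows "F (Suc n) a = (1 + t_half 2) * F n a"
proof -
  have "braid_word (Suc n) (a @ [int n] @ [])" using a n by (auto intro: braid_word_mono)
  from F_skein[OF this] have "1 \<le> int n \<Longrightarrow> F (Suc n) (a @ [int n] @ []) = t_half 2 * F (Suc n) (a @ [- int n] @
    []) + (1 - t_half 2) * F (Suc n) (a @ [])" .
  then have "F (Suc n) (a @ [int n] @ []) = t_half 2 * F (Suc n) (a @ [- int n] @ []) + (1 - t_half 2) * F (Suc
    n) (a @ [])" using n by simp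
  then have "F n a = t_half 2 * (t_half 2 * F n a) + (1 - t_half 2) * F (Suc n) a"
    using F_stabilise[OF n a, of "[]"] by simp
  then have "(1 - t_half 2) * (F (Suc n) a - (1 + t_half 2) * F n a) = 0" by (simp add: algebra_simps)
  from t_half_cancel[OF this] show ?thesis by simp
qed

text \<open>
  The difference of the two sides is a functional that vanishes on the words in which the last
  generator occurs at most once, by induction on the number of strands. For one strand, both sides are
  \<open>1 + t\<close>.
\<close>

theorem F_weighted_trace:
  assumes "n \<ge> 1" "braid_word n w"
  shows "(1 + t_half 2) * F n w = weighted_trace n w"
  using assms
proof (induction n arbitrary: w rule: nat_induct_at_least)
  case base
  then have "w = []" using braid_word_1 by blast
  moreover have "F 1 [] = 1" using V_unknot by (simp add: normalised_def alternating_def t_half_0)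
  ultimately show ?case using weighted_trace_one by simp
next
  case (Suc n)
  let ?D = "\<lambda>w. (1 + t_half 2) * F (Suc n) w - weighted_trace (Suc n) w"
  have "?D w = 0"
  proof (rule hecke_functional_vanish[where N = "Suc n", OF Suc.hyps _ _ _ _ Suc.prems])
    show "hecke_functional (Suc n) ?D"
      unfolding hecke_functional_def
    proof (intro conjI allI impI)
      fix x y assume "braid_step (Suc n) x y"
      then show "?D x = ?D y" using F_braid_step weighted_trace_braid_step by simp
    next
      fix u i v assume w: "braid_word (Suc n) (u @ [i] @ v)" and i: "1 \<le> i"
      show "?D (u @ [i] @ v) = t_half 2 * ?D (u @ [- i] @ v) + (1 - t_half 2) * ?D (u @ v)"
        unfolding F_skein[OF w i] weighted_trace_skein[OF i] by (simp add: algebra_simps)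
    qed
    show "?D a = 0" if "braid_word n a" for a
      using that F_Suc[OF Suc.hyps that] weighted_trace_Suc[OF that] Suc.IH[OF that] by simp
    show "?D (a @ [int n] @ b) = 0" if "braid_word n a" "braid_word n b" for a b
      unfolding F_stabilise(1)[OF Suc.hyps that] weighted_trace_stabilise[OF Suc.hyps that]
      using Suc.IH[of "a @ b"] that by simp
  qed simp
  then show ?case by simp
qed

lemma lookup_t_half_mult: "Poly_Mapping.lookup (t_half a * p) k = Poly_Mapping.lookup p (k - a)"
proof -
  have eq: "(\<lambda>r. Poly_Mapping.lookup p r when k = a + r) = (\<lambda>r. Poly_Mapping.lookup p r when r = k - a)"
    by (auto simp: when_def)
  have "Sum_any (\<lambda>r. Poly_Mapping.lookup p r when k = a + r) = Poly_Mapping.lookup p (k - a)"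
    unfolding eq by (rule Sum_any_when_equal)
  then show ?thesis unfolding t_half_def lookup_mult lookup_single by (simp add: when_mult)
qed

theorem F_constant_term:
  assumes n: "n \<ge> 1" and w: "braid_word n w" "num_neg w \<le> n"
  shows "Poly_Mapping.lookup (F n (full_twist n @ w)) 0 = 1" "F n (full_twist n @ w) \<in> no_poles"
proof -
  let ?F = "F n (full_twist n @ w)"
  have ft: "braid_word n (full_twist n)" unfolding full_twist_def braid_word_def by auto
  \<comment> \<open>Dividing by \<open>1 + t\<close>: compare coefficients, starting from the lowest one of \<open>F\<close>.\<close>
  obtain p where p: "p \<in> no_poles" "weighted_trace n (full_twist n @ w) = 1 + t_half 2 * p"
    using weighted_trace_twisted[OF w] by blast
  have "(1 + t_half 2) * ?F = 1 + t_half 2 * p"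
    using F_weighted_trace[OF n, of "full_twist n @ w"] p ft w by simp
  then have "Poly_Mapping.lookup (?F + t_half 2 * ?F) k = Poly_Mapping.lookup (1 + t_half 2 * p) k" for k
    by (simp add: algebra_simps)
  then have rec: "Poly_Mapping.lookup ?F k + Poly_Mapping.lookup ?F (k - 2) = (if k = 0 then 1 else 0) +
    Poly_Mapping.lookup p (k - 2)" for k
    unfolding lookup_add lookup_t_half_mult by (simp add: lookup_one when_def)
  have neg: "Poly_Mapping.lookup ?F k = 0" if "k < 0" for k
  proof (rule ccontr)
    assume "Poly_Mapping.lookup ?F k \<noteq> 0"
    then have k: "k \<in> Poly_Mapping.keys ?F" by (simp add: in_keys_iff)
    let ?m = "Min (Poly_Mapping.keys ?F)"
    have m: "?m \<in> Poly_Mapping.keys ?F" using k by (intro Min_in) auto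
    have "?m \<le> k" using k by simp
    then have "?m < 0" using that by simp
    have "Poly_Mapping.lookup ?F (?m - 2) = 0"
    proof (rule ccontr)
      assume "Poly_Mapping.lookup ?F (?m - 2) \<noteq> 0"
      then have "?m - 2 \<in> Poly_Mapping.keys ?F" by (simp add: in_keys_iff)
      then have "?m \<le> ?m - 2" by (intro Min_le) auto
      then show False by simp
    qed
    moreover have "Poly_Mapping.lookup p (?m - 2) = 0" using p(1) \<open>?m < 0\<close> unfolding no_poles_def by (force simp:
      in_keys_iff)
    ultimately have "Poly_Mapping.lookup ?F ?m = 0" using rec[of ?m] \<open>?m < 0\<close> by simp
    then show False using m by (simp add: in_keys_iff)
  qed
  have "Poly_Mapping.lookup p (- 2) = 0" using p(1) unfolding no_poles_def by (force simp: in_keys_iff)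
  then show "Poly_Mapping.lookup ?F 0 = 1" using rec[of 0] neg[of "- 2"] by simp
  show "?F \<in> no_poles" unfolding no_poles_def using neg by (force simp: in_keys_iff not_le)
qed

lemma braid_equiv_invariant:
  assumes n: "n \<ge> 1" and eq: "braid_equiv n x y" and x: "braid_word n x"
  shows "braid_word n y \<and> writhe y = writhe x \<and> V (braid_closure n y) = V (braid_closure n x)"
  using eq unfolding braid_equiv_def
proof (induction rule: equivclp_induct)
  case base
  then show ?case using x by simp
next
  case (step y z)
  then show ?case using V_braid_step[OF n] writhe_braid_step braid_step_words by metis
qed

theorem jones_min_degree:
  assumes n: "n \<ge> 1" and w: "braid_word n w" "num_neg w \<le> n" and eq: "braid_equiv n v (full_twist n @ w)"
  shows "braid_word n v" "V (braid_closure n v) \<noteq> 0"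
    "2 * min_deg (V (braid_closure n v)) = real_of_int (writhe v) - real n + 1"
proof -
  let ?x = "full_twist n @ w"
  have ft: "braid_word n ?x" using w unfolding full_twist_def braid_word_def by auto
  have "braid_equiv n ?x v" using eq unfolding braid_equiv_def by (rule equivclp_sym)
  from braid_equiv_invariant[OF n this ft]
  have v: "braid_word n v" "writhe v = writhe ?x" "V (braid_closure n v) = V (braid_closure n ?x)" by auto
  let ?F = "F n ?x" and ?a = "alternating (writhe ?x + int n - 1)" and ?e = "writhe ?x - (int n - 1)"
  have "V (braid_closure n v) = ?a * (t_half ?e * ?F)"
  proof -
    have "?a * (t_half ?e * ?F) = (?a * ?a) * (t_half ?e * t_half (int n - 1 - writhe ?x)) * V (braid_closure n ?x)"
      unfolding normalised_def by (simp add: mult_ac)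
    also have "\<dots> = V (braid_closure n ?x)" unfolding alternating_simps(1) t_half_add by (simp add: t_half_0)
    finally show ?thesis using v by simp
  qed
  then have "V (braid_closure n v) = t_half ?e * ?F \<or> V (braid_closure n v) = - (t_half ?e * ?F)"
    unfolding alternating_def by auto
  then have keys: "k \<in> Poly_Mapping.keys (V (braid_closure n v)) \<longleftrightarrow> k - ?e \<in> Poly_Mapping.keys ?F" for k
    by (auto simp: in_keys_iff lookup_t_half_mult)
  have e: "?e \<in> Poly_Mapping.keys (V (braid_closure n v))"
    unfolding keys using F_constant_term(1)[OF n w] by (simp add: in_keys_iff)
  have le: "?e \<le> k" if "k \<in> Poly_Mapping.keys (V (braid_closure n v))" for k
    using that F_constant_term(2)[OF n w] unfolding keys no_poles_def by force
  have "Min (Poly_Mapping.keys (V (braid_closure n v))) = ?e"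
    using e le by (intro Min_eqI) auto
  then show "2 * min_deg (V (braid_closure n v)) = real_of_int (writhe v) - real n + 1"
    unfolding min_deg_def using v(2) by simp
  show "V (braid_closure n v) \<noteq> 0" using e by auto
  show "braid_word n v" by (fact v(1))
qed

end

lemma braid_index_isotopic:
  assumes "isotopic L L'" shows "braid_index L = braid_index L'"
proof -
  have "isotopic M L \<longleftrightarrow> isotopic M L'" for M using assms isotopic_trans isotopic_sym by blast
  then show ?thesis unfolding braid_index_def by simp
qed

theorem corollary2:
  fixes V :: "edges \<Rightarrow> half_laurent"
    and n c l :: nat
    and \<beta> \<beta>' :: "int list"
  assumes V: "jones_polynomial V"
    and n: "n \<ge> 1"
    and \<beta>': "braid_word n \<beta>'" "length \<beta>' = c" "num_neg \<beta>' = l" "l \<le> n"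
    and \<beta>: "braid_equiv n \<beta> (full_twist n @ \<beta>')"
  shows "V (braid_closure n \<beta>) \<noteq> 0 \<and>
         2 * min_deg (V (braid_closure n \<beta>)) = real_of_int (writhe \<beta>) - real n + 1 \<and>
         (n = braid_index (braid_closure n \<beta>) \<longrightarrow>
           (\<forall>m \<gamma> \<gamma>'. m \<ge> 1 \<and> braid_word m \<gamma>' \<and> num_neg \<gamma>' \<le> m \<and>
              braid_equiv m \<gamma> (full_twist m @ \<gamma>') \<and>
              m = braid_index (braid_closure m \<gamma>) \<and>
              isotopic (braid_closure n \<beta>) (braid_closure m \<gamma>) \<longrightarrow>
              writhe \<gamma> = writhe \<beta>))"
proof (intro conjI impI allI)
  have neg: "num_neg \<beta>' \<le> n" using \<beta>' by simp
  note deg = jones_min_degree[OF V n \<beta>'(1) neg \<beta>]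
  show "V (braid_closure n \<beta>) \<noteq> 0"
    "2 * min_deg (V (braid_closure n \<beta>)) = real_of_int (writhe \<beta>) - real n + 1"
    by (fact deg)+
  fix m \<gamma> \<gamma>'
  assume index: "n = braid_index (braid_closure n \<beta>)"
    and \<gamma>: "m \<ge> 1 \<and> braid_word m \<gamma>' \<and> num_neg \<gamma>' \<le> m \<and> braid_equiv m \<gamma> (full_twist m @ \<gamma>') \<and>
      m = braid_index (braid_closure m \<gamma>) \<and> isotopic (braid_closure n \<beta>) (braid_closure m \<gamma>)"
  then have m: "m \<ge> 1" and iso: "isotopic (braid_closure n \<beta>) (braid_closure m \<gamma>)"
    and deg': "braid_word m \<gamma>" "2 * min_deg (V (braid_closure m \<gamma>)) = real_of_int (writhe \<gamma>) - real m + 1"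
    using jones_min_degree[OF V, of m \<gamma>' \<gamma>] by blast+
  have "m = n" using braid_index_isotopic[OF iso] index \<gamma> by metis
  moreover have "is_link (braid_closure n \<beta>)" "is_link (braid_closure m \<gamma>)"
    using is_link_diagram valid_singles braid_closure_diagram deg(1) deg'(1) n m by metis+
  then have "V (braid_closure n \<beta>) = V (braid_closure m \<gamma>)" using V_isotopic[OF V] iso by blast
  ultimately show "writhe \<gamma> = writhe \<beta>" using deg(3) deg'(2) by simp
qed

end
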